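(* Let $(A,\mu_A,1_A,\Delta_A,\varepsilon_A)$ be a bialgebra and $(C,\Delta_C,\varepsilon_C)$ a coalgebra with a distinguished element $1_C\in C$, and let $A\otimes_{R,\sigma}C$ be a crossed product algebra. Let $W_0:A\otimes C\to C\otimes A$, $W_0(a\otimes c)=c\otimes a$, and $\rho_0:A\otimes C\to A\otimes A$, $\rho_0(a\otimes c)=a_1\otimes a_2\varepsilon_C(c)$ (so that the crossed coproduct $A_{\;W_0,\rho_0}\otimes C$ is the tensor product coalgebra $A\otimes C$). Assume that $A_{\;W_0}^{\;\rho_0}\bowtie_{\;R}^{\;\sigma}C$ is a cross product bialgebra, that is, the maps $\Delta:A\otimes_{R,\sigma}C\to(A\otimes_{R,\sigma}C)\otimes(A\otimes_{R,\sigma}C)$, $\Delta(a\otimes c)=(a_1\otimes c_1)\otimes(a_2\otimes c_2)$, and $\varepsilon_A\otimes\varepsilon_C:A\otimes_{R,\sigma}C\to k$ are algebra maps. Then a cross product bialgebra $A_{\;W'}^{\;\rho'}\bowtie_{\;R'}^{\;\sigma'}C$ is equivalent to $A_{\;W_0}^{\;\rho_0}\bowtie_{\;R}^{\;\sigma}C$ if and only if there exist linear maps $\theta,\gamma:C\to A\otimes C$, with notation $\theta(c)=c_{<-1>}\otimes c_{<0>}$ and $\gamma(c)=c_{\{-1\}}\otimes c_{\{0\}}$ for all $c\in C$, such that the following conditions (writing $\mu=\mu_A$, $\mu_2=\mu\circ(\mathrm{id}_A\otimes\mu)$) are satisfied: (i) $R'=(\mu_2\otimes \mathrm{id}_C)\circ(\mathrm{id}_A\otimes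 \mathrm{id}_A\otimes\gamma)\circ(\mathrm{id}_A\otimes R)\circ(\theta\otimes \mathrm{id}_A)$; (ii) $\sigma'=(\mu\otimes \mathrm{id}_C)\circ(\mathrm{id}_A\otimes\gamma)\circ(\mu_2\otimes \mathrm{id}_C)\circ(\mathrm{id}_A\otimes \mathrm{id}_A\otimes\sigma)\circ(\mathrm{id}_A\otimes R\otimes \mathrm{id}_C)\circ(\theta\otimes\theta)$; (iii) $\theta(1_C)=1_A\otimes 1_C$ and $\gamma(1_C)=1_A\otimes 1_C$; (iv) $c_{<-1>}c_{<0>_{\{-1\}}}\otimes c_{<0>_{\{0\}}}=1_A\otimes c$ for all $c\in C$; (v) $c_{\{-1\}}c_{\{0\}_{<-1>}}\otimes c_{\{0\}_{<0>}}=1_A\otimes c$ for all $c\in C$; (vi) $(\mu\otimes \mathrm{id}_C)\circ(\mu\otimes\sigma')\circ(\mathrm{id}_A\otimes\gamma\otimes \mathrm{id}_C)\circ(R\otimes \mathrm{id}_C)\circ(\mathrm{id}_C\otimes\gamma)=(\mu\otimes \mathrm{id}_C)\circ(\mathrm{id}_A\otimes\gamma)\circ\sigma$; and moreover, for all $a\in A$, $c\in C$: (vii) $W'(a\otimes c)=\varepsilon_A(c_{<0>_{1_{\{-1\}}}})\,\varepsilon_C(c_{<0>_{2_{\{0\}}}})\,c_{<0>_{1_{\{0\}}}}\otimes a\,c_{<-1>}c_{<0>_{2_{\{-1\}}}}$; (viii) $\rho'(a\otimes c)=\varepsilon_C(c_{<0>_{\{0\}_{\{0\}}}})\,a_1c_{<-1>_1}c_{<0>_{\{-1\}}}\otimes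 a_2c_{<-1>_2}c_{<0>_{\{0\}_{\{-1\}}}}$; (ix) $\varepsilon_A(c_{<-1>})\varepsilon_C(c_{<0>})=\varepsilon_C(c)=\varepsilon_A(c_{\{-1\}})\varepsilon_C(c_{\{0\}})$; (x) $c_{<-1>}\otimes c_{<0>_1}\otimes c_{<0>_2}=c_{1_{<-1>}}\otimes c_{1_{<0>}}\otimes c_2$; (xi) $c_{\{-1\}}\otimes c_{\{0\}_1}\otimes c_{\{0\}_2}=c_{1_{\{-1\}}}\otimes c_{1_{\{0\}}}\otimes c_2$.
   Context: Everything is over a fixed field $k$; $\otimes=\otimes_k$. Algebras are associative unital, coalgebras are coassociative counital; Sweedler notation $\Delta(c)=c_1\otimes c_2$ is used (sums suppressed). Iterated subscripts mean successive application of maps: e.g. $c_{<0>_{1_{\{-1\}}}}$ means apply $\theta$ to $c$, then $\Delta_C$ to the component $c_{<0>}$, then $\gamma$ to the component $c_{<0>_1}$; and $c_{<-1>_1}\otimes c_{<-1>_2}=\Delta_A(c_{<-1>})$. Crossed product (Brzeziński). Let $(A,\mu,1_A)$ be an algebra and $V$ a vector space with a distinguished element $1_V\in V$. Let $R:V\otimes A\to A\otimes V$ and $\sigma:V\otimes V\to A\otimes V$ be linear maps satisfying, for all $a\in A$, $v\in V$: (1) $R(1_V\otimes a)=a\otimes 1_V$, $R(v\otimes 1_A)=1_A\otimes v$; (2) $\sigma(1_V,v)=\sigma(v,1_V)=1_A\otimes v$; (3) $R\circ(\mathrm{id}_V\otimes\mu)=(\mu\otimes \mathrm{id}_V)\circ(\mathrm{id}_A\otimes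 R)\circ(R\otimes \mathrm{id}_A)$; (4) $(\mu\otimes \mathrm{id}_V)\circ(\mathrm{id}_A\otimes\sigma)\circ(R\otimes \mathrm{id}_V)\circ(\mathrm{id}_V\otimes\sigma)=(\mu\otimes \mathrm{id}_V)\circ(\mathrm{id}_A\otimes\sigma)\circ(\sigma\otimes \mathrm{id}_V)$; (5) $(\mu\otimes \mathrm{id}_V)\circ(\mathrm{id}_A\otimes\sigma)\circ(R\otimes \mathrm{id}_V)\circ(\mathrm{id}_V\otimes R)=(\mu\otimes \mathrm{id}_V)\circ(\mathrm{id}_A\otimes R)\circ(\sigma\otimes \mathrm{id}_A)$. Then $A\otimes V$ is an associative algebra with unit $1_A\otimes 1_V$ and multiplication $(\mu_2\otimes \mathrm{id}_V)\circ(\mathrm{id}_A\otimes \mathrm{id}_A\otimes\sigma)\circ(\mathrm{id}_A\otimes R\otimes \mathrm{id}_V)$, denoted $A\otimes_{R,\sigma}V$ and called the crossed product. Crossed coproduct. Let $(C,\Delta_C,\varepsilon_C)$ be a coalgebra and $X$ a vector space with a linear map $\varepsilon_X:X\to k$. Let $W:X\otimes C\to C\otimes X$ and $\rho:X\otimes C\to X\otimes X$ be linear maps satisfying: (1') $(\mathrm{id}_C\otimes\varepsilon_X)\circ W=\varepsilon_X\otimes \mathrm{id}_C$, $(\varepsilon_C\otimes \mathrm{id}_X)\circ W=\mathrm{id}_X\otimes\varepsilon_C$; (2') $(\mathrm{id}_X\otimes\varepsilon_X)\circ\rho=\mathrm{id}_X\otimes\varepsilon_C$, $(\varepsilon_X\otimes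 \mathrm{id}_X)\circ\rho=\mathrm{id}_X\otimes\varepsilon_C$; (3') $(\Delta_C\otimes \mathrm{id}_X)\circ W=(\mathrm{id}_C\otimes W)\circ(W\otimes \mathrm{id}_C)\circ(\mathrm{id}_X\otimes\Delta_C)$; (4') $(\rho\otimes \mathrm{id}_X)\circ(\mathrm{id}_X\otimes W)\circ(\rho\otimes \mathrm{id}_C)\circ(\mathrm{id}_X\otimes\Delta_C)=(\mathrm{id}_X\otimes\rho)\circ(\rho\otimes \mathrm{id}_C)\circ(\mathrm{id}_X\otimes\Delta_C)$; (5') $(W\otimes \mathrm{id}_X)\circ(\mathrm{id}_X\otimes W)\circ(\rho\otimes \mathrm{id}_C)\circ(\mathrm{id}_X\otimes\Delta_C)=(\mathrm{id}_C\otimes\rho)\circ(W\otimes \mathrm{id}_C)\circ(\mathrm{id}_X\otimes\Delta_C)$. Then $X\otimes C$ is a coassociative coalgebra with counit $\varepsilon_X\otimes\varepsilon_C$ and comultiplication $(\mathrm{id}_X\otimes W\otimes \mathrm{id}_C)\circ(\rho\otimes\Delta_C)\circ(\mathrm{id}_X\otimes\Delta_C)$, denoted $X_{\;W,\rho}\otimes C$ and called the crossed coproduct. Cross product bialgebra. A cross product bialgebra $A_{\;W}^{\;\rho}\bowtie_{\;R}^{\;\sigma}C$ is a bialgebra whose underlying algebra is a crossed product $A\otimes_{R,\sigma}C$ and whose underlying coalgebra is a crossed coproduct $A_{\;W,\rho}\otimes C$ on the same objects ($A$ is an algebra with a linear functional $\varepsilon_A$, and $C$ is a coalgebra with a distinguished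 element $1_C$). The space $A\otimes C$ is then a left $A$-module via $a'\cdot(a\otimes c)=a'a\otimes c$ and a right $C$-comodule via $a\otimes c\mapsto(a\otimes c_1)\otimes c_2$. Two cross product bialgebras $A_{\;W}^{\;\rho}\bowtie_{\;R}^{\;\sigma}C$ and $A_{\;W'}^{\;\rho'}\bowtie_{\;R'}^{\;\sigma'}C$ (built on the same algebra $A$ with the same $\varepsilon_A$ and the same coalgebra $C$ with the same $1_C$) are called equivalent if there exists a linear isomorphism $\varphi:A_{\;W'}^{\;\rho'}\bowtie_{\;R'}^{\;\sigma'}C\simeq A_{\;W}^{\;\rho}\bowtie_{\;R}^{\;\sigma}C$ which is a morphism of bialgebras, of left $A$-modules and of right $C$-comodules. *)

theory Defs
  imports Complex_Main "HOL-Library.FuncSet"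
begin

section \<open>Vector spaces and linear maps\<close>

text \<open>
  The ground field is a type \<^typ>\<open>'k\<close> of class \<^class>\<open>field\<close>. A vector space is a subspace
  \<open>pts\<close> of an ambient vector space whose addition is that of the type; taking \<open>pts = UNIV\<close> gives
  the vector spaces of the library. Carriers are needed because the tensor product of two vector
  spaces depends on their scalar multiplications and so cannot be a type of its own.
\<close>

record ('k, 'v) kspace =
  pts :: "'v set"
  scl :: "'k \<Rightarrow> 'v \<Rightarrow> 'v"

definition vspace :: "('k::field, 'v::ab_group_add) kspace \<Rightarrow> bool" where
  "vspace V \<longleftrightarrow> vector_space (scl V) \<and> module.subspace (scl V) (pts V)"

definition ground :: "('k::field, 'k) kspace" where
  "ground = \<lparr>pts = UNIV, scl = (*)\<rparr>"

text \<open>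
  A linear map carries its source and target, and is \<^const>\<open>undefined\<close> outside the source
  (\<^const>\<open>extensional\<close>), so that HOL equality of arrows is equality of linear maps.
\<close>

record ('k, 'u, 'v) arr =
  src :: "('k, 'u) kspace"
  tgt :: "('k, 'v) kspace"
  app :: "'u \<Rightarrow> 'v"

definition Hom :: "('k::field, 'u::ab_group_add) kspace \<Rightarrow> ('k, 'v::ab_group_add) kspace
    \<Rightarrow> ('k, 'u, 'v) arr set" where
  "Hom U V = {f. src f = U \<and> tgt f = V \<and> app f \<in> pts U \<rightarrow>\<^sub>E pts V \<and>
     (\<forall>x\<in>pts U. \<forall>y\<in>pts U. app f (x + y) = app f x + app f y) \<and>
     (\<forall>r. \<forall>x\<in>pts U. app f (scl U r x) = scl V r (app f x))}"

definition arrow :: "('k, 'u) kspace \<Rightarrow> ('k, 'v) kspace \<Rightarrow> ('u \<Rightarrow> 'v) \<Rightarrow> ('k, 'u, 'v) arr" where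
  "arrow U V f = \<lparr>src = U, tgt = V, app = restrict f (pts U)\<rparr>"

definition idl :: "('k, 'u) kspace \<Rightarrow> ('k, 'u, 'u) arr" where
  "idl U = arrow U U (\<lambda>x. x)"

definition comp_arr :: "('k, 'v, 'w) arr \<Rightarrow> ('k, 'u, 'v) arr \<Rightarrow> ('k, 'u, 'w) arr"
    (infixr \<open>\<odot>\<close> 60) where
  "g \<odot> f = arrow (src f) (tgt g) (\<lambda>x. app g (app f x))"


section \<open>Tensor products\<close>

text \<open>
  \<open>U \<otimes> V\<close> is realised inside the space of functionals on the bilinear forms
  \<open>\<beta>\<close> on \<open>U \<times> V\<close>, as the span of the evaluations \<open>u \<otimes> v = (\<beta> \<mapsto> \<beta>(u, v))\<close>. That this is the
  tensor product (every bilinear map factors uniquely) is theorem \<open>tensor_universal\<close> below.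
\<close>

typedef ('k, 'u, 'v) tens = "UNIV :: (('u \<Rightarrow> 'v \<Rightarrow> 'k) \<Rightarrow> 'k) set"
  morphisms tapp Tens by simp

setup_lifting type_definition_tens

instantiation tens :: (ab_group_add, type, type) ab_group_add
begin
lift_definition zero_tens :: "('a, 'b, 'c) tens" is "\<lambda>\<beta>. 0" .
lift_definition plus_tens :: "('a, 'b, 'c) tens \<Rightarrow> ('a, 'b, 'c) tens \<Rightarrow> ('a, 'b, 'c) tens"
  is "\<lambda>s t \<beta>. s \<beta> + t \<beta>" .
lift_definition uminus_tens :: "('a, 'b, 'c) tens \<Rightarrow> ('a, 'b, 'c) tens" is "\<lambda>s \<beta>. - s \<beta>" .
lift_definition minus_tens :: "('a, 'b, 'c) tens \<Rightarrow> ('a, 'b, 'c) tens \<Rightarrow> ('a, 'b, 'c) tens"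
  is "\<lambda>s t \<beta>. s \<beta> - t \<beta>" .
instance by standard (transfer; simp add: fun_eq_iff algebra_simps)+
end

lift_definition tscl :: "'k::field \<Rightarrow> ('k, 'u, 'v) tens \<Rightarrow> ('k, 'u, 'v) tens"
  is "\<lambda>r t \<beta>. r * t \<beta>" .

definition bilin :: "('k::field, 'u::ab_group_add) kspace \<Rightarrow> ('k, 'v::ab_group_add) kspace
    \<Rightarrow> ('k, 'w::ab_group_add) kspace \<Rightarrow> ('u \<Rightarrow> 'v \<Rightarrow> 'w) \<Rightarrow> bool" where
  "bilin U V W f \<longleftrightarrow>
     (\<forall>u\<in>pts U. \<forall>v\<in>pts V. f u v \<in> pts W) \<and>
     (\<forall>u\<in>pts U. \<forall>u'\<in>pts U. \<forall>v\<in>pts V. f (u + u') v = f u v + f u' v) \<and>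
     (\<forall>u\<in>pts U. \<forall>v\<in>pts V. \<forall>v'\<in>pts V. f u (v + v') = f u v + f u v') \<and>
     (\<forall>r. \<forall>u\<in>pts U. \<forall>v\<in>pts V. f (scl U r u) v = scl W r (f u v)) \<and>
     (\<forall>r. \<forall>u\<in>pts U. \<forall>v\<in>pts V. f u (scl V r v) = scl W r (f u v))"

definition ten :: "('k::field, 'u::ab_group_add) kspace \<Rightarrow> ('k, 'v::ab_group_add) kspace
    \<Rightarrow> 'u \<Rightarrow> 'v \<Rightarrow> ('k, 'u, 'v) tens" where
  "ten U V u v = Tens (\<lambda>\<beta>. if bilin U V ground \<beta> then \<beta> u v else 0)"

definition tspace :: "('k::field, 'u::ab_group_add) kspace \<Rightarrow> ('k, 'v::ab_group_add) kspace
    \<Rightarrow> ('k, ('k, 'u, 'v) tens) kspace" (infixr \<open>\<otimes>\<^sub>s\<close> 70) where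
  "U \<otimes>\<^sub>s V = \<lparr>pts = module.span tscl {ten U V u v | u v. u \<in> pts U \<and> v \<in> pts V}, scl = tscl\<rparr>"

text \<open>
  \<open>sw U V t F\<close> is the Sweedler sum \<open>\<Sum> F t\<^sub>1 t\<^sub>2\<close> for \<open>t = \<Sum> t\<^sub>1 \<otimes> t\<^sub>2\<close> in \<open>U \<otimes> V\<close>. For bilinear \<open>F\<close> it
  does not depend on the chosen representation (lemma \<open>sw_eq\<close>).
\<close>

definition sw :: "('k::field, 'u::ab_group_add) kspace \<Rightarrow> ('k, 'v::ab_group_add) kspace
    \<Rightarrow> ('k, 'u, 'v) tens \<Rightarrow> ('u \<Rightarrow> 'v \<Rightarrow> 'w::comm_monoid_add) \<Rightarrow> 'w" where
  "sw U V t F = (\<Sum>(u, v)\<leftarrow>(SOME xs. set xs \<subseteq> pts U \<times> pts V \<and> t = (\<Sum>(u, v)\<leftarrow>xs. ten U V u v)). F u v)"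


subsection \<open>The universal property\<close>

lemma vector_space_tscl: "vector_space (tscl :: 'k::field \<Rightarrow> ('k, 'u, 'v) tens \<Rightarrow> _)"
  by standard (transfer; simp add: fun_eq_iff algebra_simps)+

interpretation tscl: vector_space "tscl :: 'k::field \<Rightarrow> ('k, 'u, 'v) tens \<Rightarrow> _"
  by (rule vector_space_tscl)

lemma vspace_tensor: "vspace (U \<otimes>\<^sub>s V)"
  by (simp add: vspace_def tspace_def vector_space_tscl tscl.subspace_span)

lemma vspace_ground: "vspace ground"
proof -
  interpret vector_space "(*) :: 'a \<Rightarrow> 'a \<Rightarrow> 'a"
    by standard (simp_all add: algebra_simps)
  show ?thesis
    by (simp add: vspace_def ground_def vector_space_axioms)
qed

lemma ten_in: "u \<in> pts U \<Longrightarrow> v \<in> pts V \<Longrightarrow> ten U V u v \<in> pts (U \<otimes>\<^sub>s V)"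
  by (auto simp: tspace_def intro!: tscl.span_base)

lemma bilin_ten: "bilin U V (U \<otimes>\<^sub>s V) (ten U V)"
proof -
  have *: "tapp (ten U V u v) = (\<lambda>\<beta>. if bilin U V ground \<beta> then \<beta> u v else 0)" for u v
    by (simp add: ten_def Tens_inverse)
  have eq: "s = t \<longleftrightarrow> (\<forall>\<beta>. tapp s \<beta> = tapp t \<beta>)" for s t :: "('a, 'b, 'c) tens"
    by (simp add: tapp_inject[symmetric] fun_eq_iff)
  show ?thesis
    by (simp add: bilin_def ten_in) (simp add: tspace_def eq * plus_tens.rep_eq tscl.rep_eq;
      simp add: bilin_def ground_def)
qed

lemma tens_rep:
  assumes V: "vspace U" and t: "t \<in> pts (U \<otimes>\<^sub>s V)"
  shows "\<exists>xs. set xs \<subseteq> pts U \<times> pts V \<and> t = (\<Sum>(u, v)\<leftarrow>xs. ten U V u v)"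
proof -
  have "t \<in> tscl.span {ten U V u v | u v. u \<in> pts U \<and> v \<in> pts V}"
    using t by (simp add: tspace_def)
  then show ?thesis
  proof (induction rule: tscl.span_induct_alt)
    case base
    show ?case by (rule exI[of _ "[]"]) simp
  next
    case (step c x y)
    then obtain u v xs where x: "x = ten U V u v" "u \<in> pts U" "v \<in> pts V"
      and xs: "set xs \<subseteq> pts U \<times> pts V" "y = (\<Sum>(u, v)\<leftarrow>xs. ten U V u v)"
      by blast
    interpret vector_space "scl U" using V by (simp add: vspace_def)
    have "scl U c u \<in> pts U"
      using V x subspace_scale by (auto simp: vspace_def)
    moreover have "ten U V (scl U c u) v = tscl c x"
      using bilin_ten[of U V] x by (auto simp: bilin_def tspace_def)
    ultimately show ?case
      using xs x by (intro exI[of _ "(scl U c u, v) # xs"]) auto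
  qed
qed

lemma tapp_sum_ten:
  assumes "bilin U V ground \<beta>"
  shows "tapp (\<Sum>(u, v)\<leftarrow>xs. ten U V u v) \<beta> = (\<Sum>(u, v)\<leftarrow>xs. \<beta> u v)"
  using assms
  by (induction xs) (auto simp: zero_tens.rep_eq plus_tens.rep_eq ten_def Tens_inverse)

lemma vector_space_separates:
  assumes "vector_space s" and ne: "x \<noteq> 0"
  shows "\<exists>l. module_hom s ((*) :: 'k::field \<Rightarrow> _) l \<and> l x \<noteq> 0"
proof -
  interpret vector_space_pair s "(*) :: 'k \<Rightarrow> 'k \<Rightarrow> 'k"
    by (intro vector_space_pair.intro assms(1)) (standard; simp add: algebra_simps)
  have "vs1.independent {x}" using ne by simp
  from linear_independent_extend[OF this, of "\<lambda>_. 1"] obtain l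
    where "Vector_Spaces.linear s (*) l" "l x = 1" by auto
  then show ?thesis by (intro exI[of _ l]) (auto simp: Vector_Spaces.linear_def)
qed

lemma sw_eq:
  assumes W: "vspace W" and F: "bilin U V W F"
    and xs: "set xs \<subseteq> pts U \<times> pts V" "t = (\<Sum>(u, v)\<leftarrow>xs. ten U V u v)"
  shows "sw U V t F = (\<Sum>(u, v)\<leftarrow>xs. F u v)"
proof -
  define ys where "ys = (SOME xs. set xs \<subseteq> pts U \<times> pts V \<and> t = (\<Sum>(u, v)\<leftarrow>xs. ten U V u v))"
  have ys: "set ys \<subseteq> pts U \<times> pts V" "t = (\<Sum>(u, v)\<leftarrow>ys. ten U V u v)"
    using someI[of "\<lambda>xs. set xs \<subseteq> pts U \<times> pts V \<and> t = (\<Sum>(u, v)\<leftarrow>xs. ten U V u v)" xs] xs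
    unfolding ys_def by auto
  have "(\<Sum>(u, v)\<leftarrow>ys. F u v) = (\<Sum>(u, v)\<leftarrow>xs. F u v)"
  proof (rule ccontr)
    assume "\<not> ?thesis"
    then have "(\<Sum>(u, v)\<leftarrow>ys. F u v) - (\<Sum>(u, v)\<leftarrow>xs. F u v) \<noteq> 0" by simp
    then obtain l where l: "module_hom (scl W) ((*) :: 'a \<Rightarrow> _) l"
      "l ((\<Sum>(u, v)\<leftarrow>ys. F u v) - (\<Sum>(u, v)\<leftarrow>xs. F u v)) \<noteq> 0"
      using vector_space_separates W unfolding vspace_def by blast
    interpret module_hom "scl W" "(*) :: 'a \<Rightarrow> _" l by (rule l)
    have \<beta>: "bilin U V ground (\<lambda>u v. l (F u v))"
      using F by (simp add: bilin_def ground_def add scale)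
    have sum: "l (\<Sum>(u, v)\<leftarrow>zs. F u v) = (\<Sum>(u, v)\<leftarrow>zs. l (F u v))" for zs
      by (induction zs) (auto simp: add zero)
    have "(\<Sum>(u, v)\<leftarrow>ys. l (F u v)) = (\<Sum>(u, v)\<leftarrow>xs. l (F u v))"
      using tapp_sum_ten[OF \<beta>] ys(2) xs(2) by metis
    with l(2) show False by (simp add: diff sum)
  qed
  then show ?thesis by (simp add: sw_def ys_def)
qed

lemma sw_ten:
  assumes "vspace W" "bilin U V W F" "u \<in> pts U" "v \<in> pts V"
  shows "sw U V (ten U V u v) F = F u v"
  using sw_eq[OF assms(1,2), of "[(u, v)]"] assms(3,4) by simp

lemma sw_Hom:
  assumes U: "vspace U" and W: "vspace W" and F: "bilin U V W F"
  shows "arrow (U \<otimes>\<^sub>s V) W (\<lambda>t. sw U V t F) \<in> Hom (U \<otimes>\<^sub>s V) W"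
proof -
  interpret T: vector_space "scl (U \<otimes>\<^sub>s V)"
    using vspace_tensor[of U V] by (simp add: vspace_def)
  interpret W: vector_space "scl W" using W by (simp add: vspace_def)
  interpret Us: vector_space "scl U" using U by (simp add: vspace_def)
  have Tsub: "T.subspace (pts (U \<otimes>\<^sub>s V))" and Wsub: "W.subspace (pts W)"
    and Usub: "Us.subspace (pts U)"
    using vspace_tensor[of U V] W U by (simp_all add: vspace_def)
  have in_W: "(\<Sum>(u, v)\<leftarrow>xs. F u v) \<in> pts W" if "set xs \<subseteq> pts U \<times> pts V" for xs
    using that F by (induction xs) (auto simp: bilin_def W.subspace_0[OF Wsub] intro!: W.subspace_add[OF Wsub])
  have "sw U V x F \<in> pts W" if "x \<in> pts (U \<otimes>\<^sub>s V)" for x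
    using tens_rep[OF U that] sw_eq[OF W F] in_W by metis
  moreover have "sw U V (x + y) F = sw U V x F + sw U V y F"
    if xy: "x \<in> pts (U \<otimes>\<^sub>s V)" "y \<in> pts (U \<otimes>\<^sub>s V)" for x y
  proof -
    obtain xs where xs: "set xs \<subseteq> pts U \<times> pts V" "x = (\<Sum>(u, v)\<leftarrow>xs. ten U V u v)"
      using tens_rep[OF U xy(1)] by blast
    obtain ys where ys: "set ys \<subseteq> pts U \<times> pts V" "y = (\<Sum>(u, v)\<leftarrow>ys. ten U V u v)"
      using tens_rep[OF U xy(2)] by blast
    have "set (xs @ ys) \<subseteq> pts U \<times> pts V" "x + y = (\<Sum>(u, v)\<leftarrow>xs @ ys. ten U V u v)"
      using xs ys by auto
    from sw_eq[OF W F this] sw_eq[OF W F xs] sw_eq[OF W F ys] show ?thesis by simp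
  qed
  moreover have "sw U V (scl (U \<otimes>\<^sub>s V) r x) F = scl W r (sw U V x F)"
    if x: "x \<in> pts (U \<otimes>\<^sub>s V)" for r x
  proof -
    obtain xs where xs: "set xs \<subseteq> pts U \<times> pts V" "x = (\<Sum>(u, v)\<leftarrow>xs. ten U V u v)"
      using tens_rep[OF U x] by blast
    let ?ys = "map (\<lambda>(u, v). (scl U r u, v)) xs"
    have "set ?ys \<subseteq> pts U \<times> pts V"
      using xs Us.subspace_scale[OF Usub] by auto
    moreover have "(\<Sum>(u, v)\<leftarrow>?ys. G u v) = scl Z r (\<Sum>(u, v)\<leftarrow>xs. G u v)"
      if "bilin U V Z G" "vspace Z" for G and Z :: "('a, 'z::ab_group_add) kspace"
    proof -
      interpret Z: vector_space "scl Z" using that by (simp add: vspace_def)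
      show ?thesis using xs(1) that(1)
        by (induction xs) (auto simp: bilin_def Z.scale_right_distrib Z.scale_zero_right)
    qed
    ultimately show ?thesis
      using sw_eq[OF W F, of ?ys "scl (U \<otimes>\<^sub>s V) r x"] sw_eq[OF W F xs]
        bilin_ten[of U V] vspace_tensor[of U V] F W xs by metis
  qed
  moreover have "x + y \<in> pts (U \<otimes>\<^sub>s V)" "scl (U \<otimes>\<^sub>s V) r x \<in> pts (U \<otimes>\<^sub>s V)"
    if "x \<in> pts (U \<otimes>\<^sub>s V)" "y \<in> pts (U \<otimes>\<^sub>s V)" for r x y
    using that T.subspace_add[OF Tsub] T.subspace_scale[OF Tsub] by auto
  ultimately show ?thesis
    by (simp add: Hom_def arrow_def)
qed

theorem tensor_universal:
  fixes U :: "('k::field, 'u::ab_group_add) kspace" and V :: "('k, 'v::ab_group_add) kspace"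
    and W :: "('k, 'w::ab_group_add) kspace"
  assumes U: "vspace U" and W: "vspace W" and F: "bilin U V W F"
  shows "\<exists>!g. g \<in> Hom (U \<otimes>\<^sub>s V) W \<and> (\<forall>u\<in>pts U. \<forall>v\<in>pts V. app g (ten U V u v) = F u v)"
proof -
  let ?g = "arrow (U \<otimes>\<^sub>s V) W (\<lambda>t. sw U V t F)"
  have g: "?g \<in> Hom (U \<otimes>\<^sub>s V) W \<and> (\<forall>u\<in>pts U. \<forall>v\<in>pts V. app ?g (ten U V u v) = F u v)"
    using sw_Hom[OF U W F] by (simp add: arrow_def ten_in sw_ten[OF W F])
  have "h = ?g" if h: "h \<in> Hom (U \<otimes>\<^sub>s V) W"
    "\<forall>u\<in>pts U. \<forall>v\<in>pts V. app h (ten U V u v) = F u v" for h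
  proof -
    interpret T: vector_space "scl (U \<otimes>\<^sub>s V)"
      using vspace_tensor[of U V] by (simp add: vspace_def)
    have Tsub: "T.subspace (pts (U \<otimes>\<^sub>s V))"
      using vspace_tensor[of U V] by (simp add: vspace_def)
    have T0: "(0 :: ('k, 'u, 'v) tens) \<in> pts (U \<otimes>\<^sub>s V)"
      by (rule T.subspace_0[OF Tsub])
    have h0: "app h 0 = 0"
    proof -
      have "app h (0 + 0) = app h 0 + app h 0"
        using h(1) T0 unfolding Hom_def by blast
      then show ?thesis by simp
    qed
    have sum: "(\<Sum>(u, v)\<leftarrow>xs. ten U V u v) \<in> pts (U \<otimes>\<^sub>s V) \<and>
        app h (\<Sum>(u, v)\<leftarrow>xs. ten U V u v) = (\<Sum>(u, v)\<leftarrow>xs. F u v)"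
      if "set xs \<subseteq> pts U \<times> pts V" for xs
      using that
    proof (induction xs)
      case Nil
      then show ?case using h0 T0 by simp
    next
      case (Cons p xs)
      obtain u v where p: "p = (u, v)" by (cases p)
      have "ten U V u v \<in> pts (U \<otimes>\<^sub>s V)" "app h (ten U V u v) = F u v"
        using Cons.prems h(2) by (auto simp: p ten_in)
      moreover have "app h (x + y) = app h x + app h y"
        if "x \<in> pts (U \<otimes>\<^sub>s V)" "y \<in> pts (U \<otimes>\<^sub>s V)" for x y
        using h(1) that by (simp add: Hom_def)
      ultimately show ?case
        using Cons T.subspace_add[OF Tsub] by (simp add: p)
    qed
    have "app h t = sw U V t F" if "t \<in> pts (U \<otimes>\<^sub>s V)" for t
      using tens_rep[OF U that] sum sw_eq[OF W F] by metis
    then have "app h = app ?g"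
      using h(1) by (auto simp: Hom_def arrow_def fun_eq_iff restrict_def PiE_def extensional_def)
    then show ?thesis
      using h(1) by (cases h) (simp add: Hom_def arrow_def)
  qed
  with g show ?thesis by blast
qed


subsection \<open>Canonical maps\<close>

definition tmap :: "('k::field, 'u::ab_group_add, 'u'::ab_group_add) arr
    \<Rightarrow> ('k, 'v::ab_group_add, 'v'::ab_group_add) arr
    \<Rightarrow> ('k, ('k, 'u, 'v) tens, ('k, 'u', 'v') tens) arr" (infixr \<open>\<otimes>\<^sub>m\<close> 70) where
  "f \<otimes>\<^sub>m g = arrow (src f \<otimes>\<^sub>s src g) (tgt f \<otimes>\<^sub>s tgt g)
     (\<lambda>t. sw (src f) (src g) t (\<lambda>u v. ten (tgt f) (tgt g) (app f u) (app g v)))"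

text \<open>
  \<open>asc : (U \<otimes> V) \<otimes> W \<rightarrow> U \<otimes> (V \<otimes> W)\<close> and its inverse \<open>asi\<close>. Iterated tensor products are not
  identified, so a composite such as \<open>(\<mu> \<otimes> id) \<circ> (id \<otimes> R) \<circ> (R \<otimes> id)\<close> is written with these maps
  between its factors. The infix \<open>\<otimes>\<^sub>s\<close> associates to the right.
\<close>

definition asc :: "('k::field, 'u::ab_group_add) kspace \<Rightarrow> ('k, 'v::ab_group_add) kspace
    \<Rightarrow> ('k, 'w::ab_group_add) kspace
    \<Rightarrow> ('k, ('k, ('k, 'u, 'v) tens, 'w) tens, ('k, 'u, ('k, 'v, 'w) tens) tens) arr" where
  "asc U V W = arrow ((U \<otimes>\<^sub>s V) \<otimes>\<^sub>s W) (U \<otimes>\<^sub>s V \<otimes>\<^sub>s W)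
     (\<lambda>t. sw (U \<otimes>\<^sub>s V) W t (\<lambda>s w. sw U V s (\<lambda>u v. ten U (V \<otimes>\<^sub>s W) u (ten V W v w))))"

definition asi :: "('k::field, 'u::ab_group_add) kspace \<Rightarrow> ('k, 'v::ab_group_add) kspace
    \<Rightarrow> ('k, 'w::ab_group_add) kspace
    \<Rightarrow> ('k, ('k, 'u, ('k, 'v, 'w) tens) tens, ('k, ('k, 'u, 'v) tens, 'w) tens) arr" where
  "asi U V W = arrow (U \<otimes>\<^sub>s V \<otimes>\<^sub>s W) ((U \<otimes>\<^sub>s V) \<otimes>\<^sub>s W)
     (\<lambda>t. sw U (V \<otimes>\<^sub>s W) t (\<lambda>u s. sw V W s (\<lambda>v w. ten (U \<otimes>\<^sub>s V) W (ten U V u v) w)))"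

definition flip :: "('k::field, 'u::ab_group_add) kspace \<Rightarrow> ('k, 'v::ab_group_add) kspace
    \<Rightarrow> ('k, ('k, 'u, 'v) tens, ('k, 'v, 'u) tens) arr" where
  "flip U V = arrow (U \<otimes>\<^sub>s V) (V \<otimes>\<^sub>s U) (\<lambda>t. sw U V t (\<lambda>u v. ten V U v u))"

text \<open>The identifications \<open>k \<otimes> V = V\<close> and \<open>V \<otimes> k = V\<close>.\<close>

definition lunit :: "('k::field, 'v::ab_group_add) kspace \<Rightarrow> ('k, ('k, 'k, 'v) tens, 'v) arr" where
  "lunit V = arrow (ground \<otimes>\<^sub>s V) V (\<lambda>t. sw ground V t (\<lambda>r v. scl V r v))"

definition runit :: "('k::field, 'v::ab_group_add) kspace \<Rightarrow> ('k, ('k, 'v, 'k) tens, 'v) arr" where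
  "runit V = arrow (V \<otimes>\<^sub>s ground) V (\<lambda>t. sw V ground t (\<lambda>v r. scl V r v))"


section \<open>Algebras, coalgebras, bialgebras\<close>

record ('k, 'a) alg =
  aspc :: "('k, 'a) kspace"
  amul :: "('k, ('k, 'a, 'a) tens, 'a) arr"
  aone :: "'a"

record ('k, 'c) coalg =
  cspc :: "('k, 'c) kspace"
  cdel :: "('k, 'c, ('k, 'c, 'c) tens) arr"
  ceps :: "('k, 'c, 'k) arr"

definition algebra :: "('k::field, 'a::ab_group_add) alg \<Rightarrow> bool" where
  "algebra M \<longleftrightarrow> (let A = aspc M; \<mu> = amul M; e = aone M in
     vspace A \<and> \<mu> \<in> Hom (A \<otimes>\<^sub>s A) A \<and> e \<in> pts A \<and>
     \<mu> \<odot> (\<mu> \<otimes>\<^sub>m idl A) = \<mu> \<odot> (idl A \<otimes>\<^sub>m \<mu>) \<odot> asc A A A \<and>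
     (\<forall>a\<in>pts A. app \<mu> (ten A A e a) = a \<and> app \<mu> (ten A A a e) = a))"

definition coalgebra :: "('k::field, 'c::ab_group_add) coalg \<Rightarrow> bool" where
  "coalgebra D \<longleftrightarrow> (let C = cspc D; \<Delta> = cdel D; \<epsilon> = ceps D in
     vspace C \<and> \<Delta> \<in> Hom C (C \<otimes>\<^sub>s C) \<and> \<epsilon> \<in> Hom C ground \<and>
     asc C C C \<odot> (\<Delta> \<otimes>\<^sub>m idl C) \<odot> \<Delta> = (idl C \<otimes>\<^sub>m \<Delta>) \<odot> \<Delta> \<and>
     lunit C \<odot> (\<epsilon> \<otimes>\<^sub>m idl C) \<odot> \<Delta> = idl C \<and>
     runit C \<odot> (idl C \<otimes>\<^sub>m \<epsilon>) \<odot> \<Delta> = idl C)"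

definition alg_map :: "('k::field, 'a::ab_group_add) alg \<Rightarrow> ('k, 'b::ab_group_add) alg
    \<Rightarrow> ('k, 'a, 'b) arr \<Rightarrow> bool" where
  "alg_map M N f \<longleftrightarrow> f \<in> Hom (aspc M) (aspc N) \<and> app f (aone M) = aone N \<and>
     f \<odot> amul M = amul N \<odot> (f \<otimes>\<^sub>m f)"

definition coalg_map :: "('k::field, 'c::ab_group_add) coalg \<Rightarrow> ('k, 'd::ab_group_add) coalg
    \<Rightarrow> ('k, 'c, 'd) arr \<Rightarrow> bool" where
  "coalg_map D E f \<longleftrightarrow> f \<in> Hom (cspc D) (cspc E) \<and>
     (f \<otimes>\<^sub>m f) \<odot> cdel D = cdel E \<odot> f \<and> ceps E \<odot> f = ceps D"

definition tensor_alg :: "('k::field, 'a::ab_group_add) alg \<Rightarrow> ('k, 'b::ab_group_add) alg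
    \<Rightarrow> ('k, ('k, 'a, 'b) tens) alg" where
  "tensor_alg M N = (let A = aspc M; B = aspc N in
     \<lparr>aspc = A \<otimes>\<^sub>s B,
      amul = (amul M \<otimes>\<^sub>m amul N) \<odot> asi A A (B \<otimes>\<^sub>s B) \<odot> (idl A \<otimes>\<^sub>m asc A B B)
        \<odot> (idl A \<otimes>\<^sub>m flip B A \<otimes>\<^sub>m idl B) \<odot> (idl A \<otimes>\<^sub>m asi B A B) \<odot> asc A B (A \<otimes>\<^sub>s B),
      aone = ten A B (aone M) (aone N)\<rparr>)"

definition ground_alg :: "('k::field, 'k) alg" where
  "ground_alg = \<lparr>aspc = ground, amul = lunit ground, aone = 1\<rparr>"

definition bialgebra :: "('k::field, 'a::ab_group_add) alg \<Rightarrow> ('k, 'a) coalg \<Rightarrow> bool" where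
  "bialgebra M D \<longleftrightarrow> aspc M = cspc D \<and> algebra M \<and> coalgebra D \<and>
     alg_map M (tensor_alg M M) (cdel D) \<and> alg_map M ground_alg (ceps D)"


section \<open>Crossed products and crossed coproducts\<close>

definition crossed_product :: "('k::field, 'a::ab_group_add) alg \<Rightarrow> ('k, 'v::ab_group_add) kspace \<Rightarrow> 'v
    \<Rightarrow> ('k, ('k, 'v, 'a) tens, ('k, 'a, 'v) tens) arr
    \<Rightarrow> ('k, ('k, 'v, 'v) tens, ('k, 'a, 'v) tens) arr \<Rightarrow> bool" where
  "crossed_product M V e R \<sigma> \<longleftrightarrow> (let A = aspc M; \<mu> = amul M; u = aone M in
     algebra M \<and> vspace V \<and> e \<in> pts V \<and>
     R \<in> Hom (V \<otimes>\<^sub>s A) (A \<otimes>\<^sub>s V) \<and> \<sigma> \<in> Hom (V \<otimes>\<^sub>s V) (A \<otimes>\<^sub>s V) \<and>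
     (\<forall>a\<in>pts A. app R (ten V A e a) = ten A V a e) \<and>
     (\<forall>v\<in>pts V. app R (ten V A v u) = ten A V u v) \<and>
     (\<forall>v\<in>pts V. app \<sigma> (ten V V e v) = ten A V u v \<and> app \<sigma> (ten V V v e) = ten A V u v) \<and>
     R \<odot> (idl V \<otimes>\<^sub>m \<mu>)
       = (\<mu> \<otimes>\<^sub>m idl V) \<odot> asi A A V \<odot> (idl A \<otimes>\<^sub>m R) \<odot> asc A V A \<odot> (R \<otimes>\<^sub>m idl A) \<odot> asi V A A \<and>
     (\<mu> \<otimes>\<^sub>m idl V) \<odot> asi A A V \<odot> (idl A \<otimes>\<^sub>m \<sigma>) \<odot> asc A V V \<odot> (R \<otimes>\<^sub>m idl V) \<odot> asi V A V
         \<odot> (idl V \<otimes>\<^sub>m \<sigma>)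
       = (\<mu> \<otimes>\<^sub>m idl V) \<odot> asi A A V \<odot> (idl A \<otimes>\<^sub>m \<sigma>) \<odot> asc A V V \<odot> (\<sigma> \<otimes>\<^sub>m idl V) \<odot> asi V V V \<and>
     (\<mu> \<otimes>\<^sub>m idl V) \<odot> asi A A V \<odot> (idl A \<otimes>\<^sub>m \<sigma>) \<odot> asc A V V \<odot> (R \<otimes>\<^sub>m idl V) \<odot> asi V A V
         \<odot> (idl V \<otimes>\<^sub>m R)
       = (\<mu> \<otimes>\<^sub>m idl V) \<odot> asi A A V \<odot> (idl A \<otimes>\<^sub>m R) \<odot> asc A V A \<odot> (\<sigma> \<otimes>\<^sub>m idl A) \<odot> asi V V A)"

definition crossed_product_alg :: "('k::field, 'a::ab_group_add) alg \<Rightarrow> ('k, 'v::ab_group_add) kspace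
    \<Rightarrow> 'v \<Rightarrow> ('k, ('k, 'v, 'a) tens, ('k, 'a, 'v) tens) arr
    \<Rightarrow> ('k, ('k, 'v, 'v) tens, ('k, 'a, 'v) tens) arr \<Rightarrow> ('k, ('k, 'a, 'v) tens) alg" where
  "crossed_product_alg M V e R \<sigma> = (let A = aspc M; \<mu> = amul M in
     \<lparr>aspc = A \<otimes>\<^sub>s V,
      amul = ((\<mu> \<odot> (idl A \<otimes>\<^sub>m \<mu>)) \<otimes>\<^sub>m idl V) \<odot> asi A (A \<otimes>\<^sub>s A) V \<odot> (idl A \<otimes>\<^sub>m asi A A V)
        \<odot> (idl A \<otimes>\<^sub>m idl A \<otimes>\<^sub>m \<sigma>) \<odot> (idl A \<otimes>\<^sub>m asc A V V)
        \<odot> (idl A \<otimes>\<^sub>m R \<otimes>\<^sub>m idl V) \<odot> (idl A \<otimes>\<^sub>m asi V A V) \<odot> asc A V (A \<otimes>\<^sub>s V),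
      aone = ten A V (aone M) e\<rparr>)"

definition crossed_coproduct :: "('k::field, 'x::ab_group_add) kspace \<Rightarrow> ('k, 'x, 'k) arr
    \<Rightarrow> ('k, 'c::ab_group_add) coalg
    \<Rightarrow> ('k, ('k, 'x, 'c) tens, ('k, 'c, 'x) tens) arr
    \<Rightarrow> ('k, ('k, 'x, 'c) tens, ('k, 'x, 'x) tens) arr \<Rightarrow> bool" where
  "crossed_coproduct X \<epsilon>X D W \<rho> \<longleftrightarrow> (let C = cspc D; \<Delta> = cdel D; \<epsilon> = ceps D in
     coalgebra D \<and> vspace X \<and> \<epsilon>X \<in> Hom X ground \<and>
     W \<in> Hom (X \<otimes>\<^sub>s C) (C \<otimes>\<^sub>s X) \<and> \<rho> \<in> Hom (X \<otimes>\<^sub>s C) (X \<otimes>\<^sub>s X) \<and>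
     runit C \<odot> (idl C \<otimes>\<^sub>m \<epsilon>X) \<odot> W = lunit C \<odot> (\<epsilon>X \<otimes>\<^sub>m idl C) \<and>
     lunit X \<odot> (\<epsilon> \<otimes>\<^sub>m idl X) \<odot> W = runit X \<odot> (idl X \<otimes>\<^sub>m \<epsilon>) \<and>
     runit X \<odot> (idl X \<otimes>\<^sub>m \<epsilon>X) \<odot> \<rho> = runit X \<odot> (idl X \<otimes>\<^sub>m \<epsilon>) \<and>
     lunit X \<odot> (\<epsilon>X \<otimes>\<^sub>m idl X) \<odot> \<rho> = runit X \<odot> (idl X \<otimes>\<^sub>m \<epsilon>) \<and>
     asc C C X \<odot> (\<Delta> \<otimes>\<^sub>m idl X) \<odot> W
       = (idl C \<otimes>\<^sub>m W) \<odot> asc C X C \<odot> (W \<otimes>\<^sub>m idl C) \<odot> asi X C C \<odot> (idl X \<otimes>\<^sub>m \<Delta>) \<and>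
     asc X X X \<odot> (\<rho> \<otimes>\<^sub>m idl X) \<odot> asi X C X \<odot> (idl X \<otimes>\<^sub>m W) \<odot> asc X X C \<odot> (\<rho> \<otimes>\<^sub>m idl C)
         \<odot> asi X C C \<odot> (idl X \<otimes>\<^sub>m \<Delta>)
       = (idl X \<otimes>\<^sub>m \<rho>) \<odot> asc X X C \<odot> (\<rho> \<otimes>\<^sub>m idl C) \<odot> asi X C C \<odot> (idl X \<otimes>\<^sub>m \<Delta>) \<and>
     asc C X X \<odot> (W \<otimes>\<^sub>m idl X) \<odot> asi X C X \<odot> (idl X \<otimes>\<^sub>m W) \<odot> asc X X C \<odot> (\<rho> \<otimes>\<^sub>m idl C)
         \<odot> asi X C C \<odot> (idl X \<otimes>\<^sub>m \<Delta>)
       = (idl C \<otimes>\<^sub>m \<rho>) \<odot> asc C X C \<odot> (W \<otimes>\<^sub>m idl C) \<odot> asi X C C \<odot> (idl X \<otimes>\<^sub>m \<Delta>))"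

definition crossed_coproduct_coalg :: "('k::field, 'x::ab_group_add) kspace \<Rightarrow> ('k, 'x, 'k) arr
    \<Rightarrow> ('k, 'c::ab_group_add) coalg
    \<Rightarrow> ('k, ('k, 'x, 'c) tens, ('k, 'c, 'x) tens) arr
    \<Rightarrow> ('k, ('k, 'x, 'c) tens, ('k, 'x, 'x) tens) arr \<Rightarrow> ('k, ('k, 'x, 'c) tens) coalg" where
  "crossed_coproduct_coalg X \<epsilon>X D W \<rho> = (let C = cspc D; \<Delta> = cdel D; \<epsilon> = ceps D in
     \<lparr>cspc = X \<otimes>\<^sub>s C,
      cdel = asi X C (X \<otimes>\<^sub>s C) \<odot> (idl X \<otimes>\<^sub>m asc C X C) \<odot> (idl X \<otimes>\<^sub>m W \<otimes>\<^sub>m idl C)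
        \<odot> (idl X \<otimes>\<^sub>m asi X C C) \<odot> asc X X (C \<otimes>\<^sub>s C) \<odot> (\<rho> \<otimes>\<^sub>m \<Delta>)
        \<odot> asi X C C \<odot> (idl X \<otimes>\<^sub>m \<Delta>),
      ceps = lunit ground \<odot> (\<epsilon>X \<otimes>\<^sub>m \<epsilon>)\<rparr>)"


section \<open>Cross product bialgebras and their equivalence\<close>

definition cross_product_bialgebra :: "('k::field, 'a::ab_group_add) alg \<Rightarrow> ('k, 'a, 'k) arr
    \<Rightarrow> ('k, 'c::ab_group_add) coalg \<Rightarrow> 'c
    \<Rightarrow> ('k, ('k, 'a, 'c) tens, ('k, 'c, 'a) tens) arr
    \<Rightarrow> ('k, ('k, 'a, 'c) tens, ('k, 'a, 'a) tens) arr
    \<Rightarrow> ('k, ('k, 'c, 'a) tens, ('k, 'a, 'c) tens) arr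
    \<Rightarrow> ('k, ('k, 'c, 'c) tens, ('k, 'a, 'c) tens) arr \<Rightarrow> bool" where
  "cross_product_bialgebra M \<epsilon>A D e W \<rho> R \<sigma> \<longleftrightarrow>
     crossed_product M (cspc D) e R \<sigma> \<and> crossed_coproduct (aspc M) \<epsilon>A D W \<rho> \<and>
     bialgebra (crossed_product_alg M (cspc D) e R \<sigma>) (crossed_coproduct_coalg (aspc M) \<epsilon>A D W \<rho>)"

definition left_act :: "('k::field, 'a::ab_group_add) alg \<Rightarrow> ('k, 'c::ab_group_add) kspace
    \<Rightarrow> ('k, ('k, 'a, ('k, 'a, 'c) tens) tens, ('k, 'a, 'c) tens) arr" where
  "left_act M C = (amul M \<otimes>\<^sub>m idl C) \<odot> asi (aspc M) (aspc M) C"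

definition right_coact :: "('k::field, 'a::ab_group_add) kspace \<Rightarrow> ('k, 'c::ab_group_add) coalg
    \<Rightarrow> ('k, ('k, 'a, 'c) tens, ('k, ('k, 'a, 'c) tens, 'c) tens) arr" where
  "right_coact A D = asi A (cspc D) (cspc D) \<odot> (idl A \<otimes>\<^sub>m cdel D)"

definition equivalent_cpb :: "('k::field, 'a::ab_group_add) alg \<Rightarrow> ('k, 'a, 'k) arr
    \<Rightarrow> ('k, 'c::ab_group_add) coalg \<Rightarrow> 'c
    \<Rightarrow> ('k, ('k, 'a, 'c) tens, ('k, 'c, 'a) tens) arr
    \<Rightarrow> ('k, ('k, 'a, 'c) tens, ('k, 'a, 'a) tens) arr
    \<Rightarrow> ('k, ('k, 'c, 'a) tens, ('k, 'a, 'c) tens) arr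
    \<Rightarrow> ('k, ('k, 'c, 'c) tens, ('k, 'a, 'c) tens) arr
    \<Rightarrow> ('k, ('k, 'a, 'c) tens, ('k, 'c, 'a) tens) arr
    \<Rightarrow> ('k, ('k, 'a, 'c) tens, ('k, 'a, 'a) tens) arr
    \<Rightarrow> ('k, ('k, 'c, 'a) tens, ('k, 'a, 'c) tens) arr
    \<Rightarrow> ('k, ('k, 'c, 'c) tens, ('k, 'a, 'c) tens) arr \<Rightarrow> bool" where
  "equivalent_cpb M \<epsilon>A D e W \<rho> R \<sigma> W' \<rho>' R' \<sigma>' \<longleftrightarrow> (let A = aspc M; C = cspc D in
     \<exists>\<phi> \<in> Hom (A \<otimes>\<^sub>s C) (A \<otimes>\<^sub>s C). bij_betw (app \<phi>) (pts (A \<otimes>\<^sub>s C)) (pts (A \<otimes>\<^sub>s C)) \<and>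
       alg_map (crossed_product_alg M C e R' \<sigma>') (crossed_product_alg M C e R \<sigma>) \<phi> \<and>
       coalg_map (crossed_coproduct_coalg A \<epsilon>A D W' \<rho>') (crossed_coproduct_coalg A \<epsilon>A D W \<rho>) \<phi> \<and>
       \<phi> \<odot> left_act M C = left_act M C \<odot> (idl A \<otimes>\<^sub>m \<phi>) \<and>
       (\<phi> \<otimes>\<^sub>m idl C) \<odot> right_coact A D = right_coact A D \<odot> \<phi>)"

end

theory Submission
  imports Defs
begin

text \<open>
  Write \<open>H = A \<otimes> C\<close>. An equivalence \<open>\<phi>\<close> is \<open>A\<close>-linear, hence given by \<open>\<phi>(a \<otimes> c) = a \<theta>(c)\<close> with
  \<open>\<theta>(c) = \<phi>(1 \<otimes> c)\<close>; likewise \<open>\<phi>\<inverse>(a \<otimes> c) = a \<gamma>(c)\<close>. In these terms (iv) and (v) say that \<open>\<phi>\<close> and \<open>\<phi>\<inverse>\<close> are mutually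
  inverse, (iii) that they preserve the unit, (x) and (xi) that they are colinear, (ix) that they
  preserve the counit.

  \<^emph>\<open>Multiplication.\<close> In a crossed product \<open>(1 \<otimes> c)(a \<otimes> 1) = R(c \<otimes> a)\<close> and \<open>(1 \<otimes> c)(1 \<otimes> d) = \<sigma>(c \<otimes> d)\<close>. Hence (i) and (ii)
  are \<open>R'(c \<otimes> a) = \<phi>\<inverse>(\<theta>(c)(a \<otimes> 1))\<close> and \<open>\<sigma>'(c \<otimes> d) = \<phi>\<inverse>(\<theta>(c)\<theta>(d))\<close>, which hold if \<open>\<phi>\<close> is multiplicative and unital.
  They also suffice for multiplicativity, because these products together with \<open>A\<close> generate all products (\<open>extA_multiplicative\<close>).
  Condition (vi) expresses the multiplicativity of \<open>\<phi>\<inverse>\<close> on \<open>1 \<otimes> C\<close> (\<open>inverse_multiplicative_vi\<close>).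

  \<^emph>\<open>Comultiplication.\<close> \<open>\<phi>\<close> is comultiplicative iff \<open>\<Delta>' = (\<phi>\<inverse> \<otimes> \<phi>\<inverse>) \<circ> \<Delta>\<^sub>0 \<circ> \<phi>\<close>, where \<open>\<Delta>\<^sub>0\<close> is the coproduct of the tensor
  product coalgebra. A crossed coproduct determines \<open>W'\<close> and \<open>\<rho>'\<close> by applying counits to \<open>\<Delta>'\<close>
  (\<open>cdel_W\<close>, \<open>cdel_\<rho>\<close>), and on the transported coproduct this gives (vii) and (viii). In the converse
  direction, colinearity and (ix) imply \<open>(\<epsilon>\<^sub>A \<otimes> id) \<gamma> = id\<close> (\<open>counit_A_id\<close>); (vii) and (viii) then become
  \<open>W'(b \<gamma>(d)) = d\<^sub>1 \<otimes> b (id \<otimes> \<epsilon>\<^sub>C)(\<gamma>(d\<^sub>2))\<close> and a similar formula for \<open>\<rho>'\<close>, in which \<open>\<theta>\<close> no longer occurs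
  (\<open>eval_at_inverse\<close>), and \<open>\<Delta>'\<close> can be computed on the elements \<open>\<phi>\<inverse>(b \<otimes> d) = b \<gamma>(d)\<close> (\<open>cdel_at_inverse\<close>).

  Composites of arrows are evaluated on pure tensors by the simplifier, which turns them into nested
  Sweedler sums; identities between such sums follow by moving linear maps into and out of them and
  by reducing opaque tensors to pure ones (\<open>tens_lin_ext\<close>).
\<close>

section \<open>Linear maps and Sweedler sums\<close>

text \<open>
  Linearity of a HOL function on a carrier. The target enters through its scalar multiplication
  alone, and membership of the values in a carrier is always a separate side condition: a Sweedler
  sum \<open>sw U V t F\<close> does not name the space its values lie in, so a rewrite rule for it cannot mention the
  carrier of that space, whereas the scalar multiplication can be fixed by choosing one instance of
  the rule for each kind of value: tensors, scalars, elements of \<open>A\<close>, elements of \<open>C\<close>.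
\<close>

definition lin :: "('k::field, 'u::ab_group_add) kspace \<Rightarrow> ('k \<Rightarrow> 'w::ab_group_add \<Rightarrow> 'w) \<Rightarrow> ('u \<Rightarrow> 'w) \<Rightarrow> bool" where
  "lin U s f \<longleftrightarrow> (\<forall>x\<in>pts U. \<forall>y\<in>pts U. f (x + y) = f x + f y) \<and> (\<forall>r. \<forall>x\<in>pts U. f (scl U r x) = s r (f x))"

text \<open>
  Membership in a \<^const>\<open>Hom\<close> set without naming source and target. Side conditions such as
  \<open>x \<in> pts (src f)\<close> then mention no space that is absent from the term being rewritten, and source
  and target of a composite are computed by rewriting.
\<close>

definition arr :: "('k::field, 'u::ab_group_add, 'v::ab_group_add) arr \<Rightarrow> bool" where
  "arr f \<longleftrightarrow> f \<in> Hom (src f) (tgt f)"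

lemma arr_Hom: "f \<in> Hom U V \<longleftrightarrow> arr f \<and> src f = U \<and> tgt f = V"
  by (auto simp: arr_def Hom_def)

lemma scl_tspace [simp]: "scl (U \<otimes>\<^sub>s V) = tscl"
  by (simp add: tspace_def)

lemma scl_ground [simp]: "scl ground = (*)" and pts_ground [simp]: "pts ground = UNIV"
  by (simp_all add: ground_def)

declare vspace_tensor [simp] vspace_ground [simp] ten_in [simp]

lemma vspace_zero [simp]: "vspace V \<Longrightarrow> 0 \<in> pts V"
  by (auto simp: vspace_def module.subspace_def vector_space_def module_def)

lemma vspace_add [simp]: "vspace V \<Longrightarrow> x \<in> pts V \<Longrightarrow> y \<in> pts V \<Longrightarrow> x + y \<in> pts V"
  using module.subspace_add[of "scl V"] by (auto simp: vspace_def vector_space_def module_def)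

lemma vspace_scl [simp]: "vspace V \<Longrightarrow> x \<in> pts V \<Longrightarrow> scl V r x \<in> pts V"
  using module.subspace_scale[of "scl V"] by (auto simp: vspace_def vector_space_def module_def)

lemma vspace_tscl [simp]: "x \<in> pts (U \<otimes>\<^sub>s V) \<Longrightarrow> tscl r x \<in> pts (U \<otimes>\<^sub>s V)"
  using vspace_scl[of "U \<otimes>\<^sub>s V" x r] by simp

lemma vspace_module: "vspace V \<Longrightarrow> module (scl V)"
  by (auto simp: vspace_def vector_space_def module_def)

lemma src_simps [simp]:
  "src (f \<odot> g) = src g" "src (f \<otimes>\<^sub>m h) = src f \<otimes>\<^sub>s src h" "src (idl U) = U"
  "src (asc U V W) = (U \<otimes>\<^sub>s V) \<otimes>\<^sub>s W" "src (asi U V W) = U \<otimes>\<^sub>s V \<otimes>\<^sub>s W"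
  "src (flip U V) = U \<otimes>\<^sub>s V" "src (lunit V) = ground \<otimes>\<^sub>s V" "src (runit V) = V \<otimes>\<^sub>s ground"
  by (simp_all add: comp_arr_def tmap_def idl_def asc_def asi_def flip_def lunit_def runit_def arrow_def)

lemma tgt_simps [simp]:
  "tgt (f \<odot> g) = tgt f" "tgt (f \<otimes>\<^sub>m h) = tgt f \<otimes>\<^sub>s tgt h" "tgt (idl U) = U"
  "tgt (asi U V W) = (U \<otimes>\<^sub>s V) \<otimes>\<^sub>s W" "tgt (asc U V W) = U \<otimes>\<^sub>s V \<otimes>\<^sub>s W"
  "tgt (flip U V) = V \<otimes>\<^sub>s U" "tgt (lunit V) = V" "tgt (runit V) = V"
  by (simp_all add: comp_arr_def tmap_def idl_def asc_def asi_def flip_def lunit_def runit_def arrow_def)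

lemma linI: "(\<And>x y. x \<in> pts U \<Longrightarrow> y \<in> pts U \<Longrightarrow> f (x + y) = f x + f y) \<Longrightarrow>
   (\<And>r x. x \<in> pts U \<Longrightarrow> f (scl U r x) = s r (f x)) \<Longrightarrow> lin U s f"
  by (simp add: lin_def)

lemma lin_cong [cong]:
  "U = U' \<Longrightarrow> s = s' \<Longrightarrow> (\<And>x. x \<in> pts U' \<Longrightarrow> f x = g x) \<Longrightarrow> vspace U' \<Longrightarrow>
    lin U s f = lin U' s' g"
  by (simp add: lin_def)

lemma bilin_lin: "vspace U \<Longrightarrow> vspace V \<Longrightarrow> bilin U V W F \<longleftrightarrow> (\<forall>u\<in>pts U. \<forall>v\<in>pts V. F u v \<in> pts W) \<and>
    (\<forall>v\<in>pts V. lin U (scl W) (\<lambda>u. F u v)) \<and> (\<forall>u\<in>pts U. lin V (scl W) (\<lambda>v. F u v))"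
  by (auto simp: bilin_def lin_def)

definition univ :: "('k \<Rightarrow> 'w \<Rightarrow> 'w) \<Rightarrow> ('k, 'w) kspace" where
  "univ s = \<lparr>pts = UNIV, scl = s\<rparr>"

lemma univ_simps [simp]: "pts (univ s) = UNIV" "scl (univ s) = s" by (simp_all add: univ_def)

lemma vspace_univ [simp]: "vector_space s \<Longrightarrow> vspace (univ s)"
  by (simp add: vspace_def module.subspace_def[OF module.intro] vector_space_def module.subspace_UNIV module_def)

text \<open>
  The particular decomposition of \<open>t\<close> into pure tensors that \<^const>\<open>sw\<close> sums over. It does not depend on
  the summand, so sums over it can be interchanged, and additive maps pushed through them, without
  any bilinearity.
\<close>

definition slist where
  "slist U V t = (SOME xs. set xs \<subseteq> pts U \<times> pts V \<and> t = (\<Sum>(u, v)\<leftarrow>xs. ten U V u v))"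

lemma sw_slist: "sw U V t F = (\<Sum>p\<leftarrow>slist U V t. F (fst p) (snd p))"
  by (simp add: sw_def slist_def case_prod_unfold)

lemma slist: "vspace U \<Longrightarrow> t \<in> pts (U \<otimes>\<^sub>s V) \<Longrightarrow>
    set (slist U V t) \<subseteq> pts U \<times> pts V \<and> t = (\<Sum>(u, v)\<leftarrow>slist U V t. ten U V u v)"
  unfolding slist_def using tens_rep by (rule someI_ex)

lemma slist_mem: "vspace U \<Longrightarrow> t \<in> pts (U \<otimes>\<^sub>s V) \<Longrightarrow> (u, v) \<in> set (slist U V t) \<Longrightarrow> u \<in> pts U \<and> v \<in> pts V"
  using slist by blast

text \<open>
  As a congruence rule, this lets the simplifier use the membership of the bound components \<open>u\<close>, \<open>v\<close>
  when it rewrites under a Sweedler sum; nearly all rules below have such memberships as side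
  conditions.
\<close>

lemma sw_cong [cong]:
  assumes "U = U'" "V = V'" "t = t'" "\<And>u v. u \<in> pts U' \<Longrightarrow> v \<in> pts V' \<Longrightarrow> F u v = G u v" "vspace U'" "t' \<in> pts (U' \<otimes>\<^sub>s V')"
  shows "sw U V t F = sw U' V' t' G"
  unfolding sw_slist assms(1-3)
  by (rule arg_cong[of _ _ sum_list], rule map_cong) (use assms(4) slist_mem[OF assms(5,6)] in auto)

lemma sw_swap:
  fixes F :: "'d::ab_group_add \<Rightarrow> 'e::ab_group_add \<Rightarrow> 'g::ab_group_add \<Rightarrow> 'h::ab_group_add \<Rightarrow> 'f::comm_monoid_add"
  shows "sw U V t (\<lambda>u v. sw X Y s (\<lambda>x y. F u v x y)) = sw X Y s (\<lambda>x y. sw U V t (\<lambda>u v. F u v x y))"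
proof -
  have "(\<Sum>p\<leftarrow>ps. \<Sum>q\<leftarrow>qs. G p q) = (\<Sum>q\<leftarrow>qs. \<Sum>p\<leftarrow>ps. G p q)" for ps :: "('d \<times> 'e) list" and qs :: "('g \<times> 'h) list" and G :: "_ \<Rightarrow> _ \<Rightarrow> 'f"
    by (induction ps) (simp_all add: sum_list_addf)
  then show ?thesis by (simp only: sw_slist)
qed

lemma sw_push:
  assumes "vspace U" "t \<in> pts (U \<otimes>\<^sub>s V)" "\<And>u v. u \<in> pts U \<Longrightarrow> v \<in> pts V \<Longrightarrow> F u v \<in> pts X" "lin X s f" "vspace X"
  shows "f (sw U V t F) = sw U V t (\<lambda>u v. f (F u v))" and "sw U V t F \<in> pts X"
proof -
  have f0: "f 0 = 0" using assms(4) vspace_zero[OF assms(5)] by (auto simp: lin_def) (metis add_cancel_left_left)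
  have "set xs \<subseteq> pts U \<times> pts V \<Longrightarrow> (\<Sum>p\<leftarrow>xs. F (fst p) (snd p)) \<in> pts X \<and> f (\<Sum>p\<leftarrow>xs. F (fst p) (snd p)) = (\<Sum>p\<leftarrow>xs. f (F (fst p) (snd p)))" for xs
    using assms(3-5) by (induction xs) (auto simp: f0 lin_def)
  from this[of "slist U V t"] slist[OF assms(1,2)]
  show "f (sw U V t F) = sw U V t (\<lambda>u v. f (F u v))" and "sw U V t F \<in> pts X"
    by (simp_all add: sw_slist)
qed

lemma lin_id [simp]: "lin U (scl U) (\<lambda>x. x)" by (simp add: lin_def)

lemma lin_id' [simp]: "lin (U \<otimes>\<^sub>s V) tscl (\<lambda>x. x)" by (simp add: lin_def)

lemma lin_id'' [simp]: "lin ground (*) (\<lambda>x. x)" by (simp add: lin_def)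

lemma sw_in [simp]:
  assumes "vspace X" "vspace U" "t \<in> pts (U \<otimes>\<^sub>s V)" "\<And>u v. u \<in> pts U \<Longrightarrow> v \<in> pts V \<Longrightarrow> F u v \<in> pts X"
  shows "sw U V t F \<in> pts X"
  by (rule sw_push(2)[OF assms(2-4) lin_id assms(1)])

lemma app_in [simp]: "arr f \<Longrightarrow> tgt f = W \<Longrightarrow> x \<in> pts (src f) \<Longrightarrow> app f x \<in> pts W"
  by (auto simp: arr_def Hom_def)

lemma lin_app [simp]:
  assumes "arr f" "vspace U" "scl (tgt f) = s" "lin U (scl (src f)) e" "\<And>x. x \<in> pts U \<Longrightarrow> e x \<in> pts (src f)"
  shows "lin U s (\<lambda>x. app f (e x))"
  using assms by (auto simp: lin_def arr_def Hom_def)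

lemma lin_app_id [simp]: "arr f \<Longrightarrow> vspace (src f) \<Longrightarrow> scl (tgt f) = s \<Longrightarrow> lin (src f) s (app f)"
  by (auto simp: lin_def arr_def Hom_def)

lemma app_sw:
  assumes "arr f" "vspace (src f)" "vspace U" "t \<in> pts (U \<otimes>\<^sub>s V)" "\<And>u v. u \<in> pts U \<Longrightarrow> v \<in> pts V \<Longrightarrow> F u v \<in> pts (src f)"
  shows "app f (sw U V t F) = sw U V t (\<lambda>u v. app f (F u v))"
  by (rule sw_push(1)[OF assms(3,4,5)]) (auto intro: assms lin_app_id)

lemma ten_distribs: "u \<in> pts U \<Longrightarrow> u' \<in> pts U \<Longrightarrow> v \<in> pts V \<Longrightarrow> ten U V (u + u') v = ten U V u v + ten U V u' v"
  "u \<in> pts U \<Longrightarrow> v' \<in> pts V \<Longrightarrow> v \<in> pts V \<Longrightarrow> ten U V u (v + v') = ten U V u v + ten U V u v'"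
  "u \<in> pts U \<Longrightarrow> v \<in> pts V \<Longrightarrow> ten U V (scl U r u) v = tscl r (ten U V u v)"
  "u \<in> pts U \<Longrightarrow> v \<in> pts V \<Longrightarrow> ten U V u (scl V r v) = tscl r (ten U V u v)"
  using bilin_ten[of U V] by (auto simp: bilin_def)

lemma lin_ten_left [simp]:
  assumes "vspace U" "lin U (scl V) e" "\<And>x. x \<in> pts U \<Longrightarrow> e x \<in> pts V" "w \<in> pts W"
  shows "lin U tscl (\<lambda>x. ten V W (e x) w)"
  using assms by (auto simp: lin_def ten_distribs)

lemma lin_ten_right [simp]:
  assumes "vspace U" "lin U (scl W) e" "\<And>x. x \<in> pts U \<Longrightarrow> e x \<in> pts W" "v \<in> pts V"
  shows "lin U tscl (\<lambda>x. ten V W v (e x))"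
  using assms by (auto simp: lin_def ten_distribs)

lemma ten_sw_left:
  assumes "vspace U" "vspace V" "t \<in> pts (U \<otimes>\<^sub>s V)" "vspace X" "\<And>u v. u \<in> pts U \<Longrightarrow> v \<in> pts V \<Longrightarrow> F u v \<in> pts X" "y \<in> pts Y"
  shows "ten X Y (sw U V t F) y = sw U V t (\<lambda>u v. ten X Y (F u v) y)"
  by (rule sw_push(1)[OF assms(1,3,5) lin_ten_left[OF assms(4) lin_id] assms(4)]) (simp_all add: assms)

lemma ten_sw_right:
  assumes "vspace U" "vspace V" "t \<in> pts (U \<otimes>\<^sub>s V)" "vspace Y" "\<And>u v. u \<in> pts U \<Longrightarrow> v \<in> pts V \<Longrightarrow> F u v \<in> pts Y" "x \<in> pts X"
  shows "ten X Y x (sw U V t F) = sw U V t (\<lambda>u v. ten X Y x (F u v))"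
  by (rule sw_push(1)[OF assms(1,3,5) lin_ten_right[OF assms(4) lin_id] assms(4)]) (simp_all add: assms)

lemma sw_ten_id: "vspace U \<Longrightarrow> t \<in> pts (U \<otimes>\<^sub>s V) \<Longrightarrow> sw U V t (ten U V) = t"
  using slist[of U t V] by (simp add: sw_slist case_prod_unfold)

text \<open>
  The codomain of \<open>F\<close> can be taken as a whole type here (\<open>univ s\<close>), since the value of the sum on a pure
  tensor does not depend on the carrier in which the values are counted.
\<close>

lemma sw_ten_gen:
  assumes "vector_space s" "vspace U" "vspace V" "u \<in> pts U" "v \<in> pts V"
    "\<And>v. v \<in> pts V \<Longrightarrow> lin U s (\<lambda>u. F u v)" "\<And>u. u \<in> pts U \<Longrightarrow> lin V s (\<lambda>v. F u v)"
  shows "sw U V (ten U V u v) F = F u v"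
  using assms by (intro sw_ten[of "univ s"]) (auto simp: bilin_lin)

lemma sw_lin:
  assumes "vector_space s" "vspace U" "vspace V"
    "\<And>v. v \<in> pts V \<Longrightarrow> lin U s (\<lambda>u. F u v)" "\<And>u. u \<in> pts U \<Longrightarrow> lin V s (\<lambda>v. F u v)"
  shows "lin (U \<otimes>\<^sub>s V) s (\<lambda>t. sw U V t F)"
  using sw_Hom[of U "univ s" V F] assms by (simp add: bilin_lin) (auto simp: Hom_def arrow_def lin_def)

lemma lin_comp:
  assumes "lin V s f" "lin U (scl V) e" "\<And>x. x \<in> pts U \<Longrightarrow> e x \<in> pts V"
  shows "lin U s (\<lambda>x. f (e x))"
  using assms by (auto simp: lin_def)

lemma lin_sw_arg:
  assumes "vector_space s" "vspace U" "vspace V" "vspace X" "lin X tscl e" "\<And>x. x \<in> pts X \<Longrightarrow> e x \<in> pts (U \<otimes>\<^sub>s V)"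
    "\<And>v. v \<in> pts V \<Longrightarrow> lin U s (\<lambda>u. F u v)" "\<And>u. u \<in> pts U \<Longrightarrow> lin V s (\<lambda>v. F u v)"
  shows "lin X s (\<lambda>x. sw U V (e x) F)"
  by (rule lin_comp[of "U \<otimes>\<^sub>s V"]) (use assms in \<open>simp_all add: sw_lin\<close>)

lemma sum_list_lin:
  assumes "module s" "\<And>z. z \<in> set zs \<Longrightarrow> lin X s (\<lambda>x. F x z)"
  shows "lin X s (\<lambda>x. \<Sum>z\<leftarrow>zs. F x z)"
  using assms(2) by (induction zs) (auto simp: lin_def module.scale_zero_right[OF assms(1)] module.scale_right_distrib[OF assms(1)] algebra_simps)

lemma lin_sw_fun:
  assumes "vector_space s" "vspace U" "vspace V" "vspace X" "t \<in> pts (U \<otimes>\<^sub>s V)"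
    "\<And>u v. u \<in> pts U \<Longrightarrow> v \<in> pts V \<Longrightarrow> lin X s (\<lambda>x. F x u v)"
  shows "lin X s (\<lambda>x. sw U V t (\<lambda>u v. F x u v))"
  unfolding sw_slist
  by (rule sum_list_lin) (use assms slist_mem[OF assms(2,5)] in \<open>auto simp: vector_space_def module_def\<close>)

lemma sw_sw:
  assumes "vector_space s" "vspace U" "vspace V" "vspace X" "vspace Y" "t \<in> pts (X \<otimes>\<^sub>s Y)"
    "\<And>x y. x \<in> pts X \<Longrightarrow> y \<in> pts Y \<Longrightarrow> G x y \<in> pts (U \<otimes>\<^sub>s V)"
    "\<And>v. v \<in> pts V \<Longrightarrow> lin U s (\<lambda>u. F u v)" "\<And>u. u \<in> pts U \<Longrightarrow> lin V s (\<lambda>v. F u v)"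
  shows "sw U V (sw X Y t G) F = sw X Y t (\<lambda>x y. sw U V (G x y) F)"
  by (rule sw_push(1)[OF assms(4,6,7) sw_lin]) (use assms in auto)

lemma sw_scl:
  assumes "vector_space s" "vspace U" "vspace V" "t \<in> pts (U \<otimes>\<^sub>s V)"
    "\<And>v. v \<in> pts V \<Longrightarrow> lin U s (\<lambda>u. F u v)" "\<And>u. u \<in> pts U \<Longrightarrow> lin V s (\<lambda>v. F u v)"
  shows "sw U V (tscl r t) F = s r (sw U V t F)"
  using sw_lin[OF assms(1,2,3,5,6)] assms(4) unfolding lin_def scl_tspace by blast

lemma vs_mult: "vector_space ((*) :: 'k::field \<Rightarrow> 'k \<Rightarrow> 'k)"
  using vspace_ground[where 'a='k] unfolding vspace_def by simp

lemma vs_scl: "vspace V \<Longrightarrow> vector_space (scl V)" by (simp add: vspace_def)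

lemma lin_scl_right [simp]: "vspace V \<Longrightarrow> vspace U \<Longrightarrow> lin U (scl V) e \<Longrightarrow> lin U (scl V) (\<lambda>x. scl V r (e x))"
  by (simp add: lin_def module.scale_right_distrib[OF vspace_module] module.scale_scale[OF vspace_module] mult.commute)

lemma lin_scl_left [simp]: "vspace V \<Longrightarrow> vspace U \<Longrightarrow> lin U (*) e \<Longrightarrow> lin U (scl V) (\<lambda>x. scl V (e x) v)"
  by (simp add: lin_def module.scale_left_distrib[OF vspace_module] module.scale_scale[OF vspace_module])

lemma lin_tscl_right [simp]: "vspace U \<Longrightarrow> lin U tscl e \<Longrightarrow> lin U tscl (\<lambda>x. tscl r (e x))"
  by (simp add: lin_def tscl.scale_right_distrib mult.commute)

lemma lin_tscl_left [simp]: "vspace U \<Longrightarrow> lin U (*) e \<Longrightarrow> lin U tscl (\<lambda>x. tscl (e x) v)"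
  by (simp add: lin_def tscl.scale_left_distrib)

lemma lin_mult_left [simp]: "vspace U \<Longrightarrow> lin U (*) e \<Longrightarrow> lin U (*) (\<lambda>x. e x * (r::'k::field))"
  by (simp add: lin_def algebra_simps)

lemma lin_mult_right [simp]: "vspace U \<Longrightarrow> lin U (*) e \<Longrightarrow> lin U (*) (\<lambda>x. (r::'k::field) * e x)"
  by (simp add: lin_def algebra_simps)

lemma tscl_sw:
  fixes F :: "'d::ab_group_add \<Rightarrow> 'e::ab_group_add \<Rightarrow> ('k::field, 'g, 'h) tens"
  shows "tscl r (sw U V t F) = sw U V t (\<lambda>u v. tscl r (F u v))"
proof -
  have "tscl r (\<Sum>p\<leftarrow>ps. G p) = (\<Sum>p\<leftarrow>ps. tscl r (G p))" for ps :: "('d \<times> 'e) list" and G :: "_ \<Rightarrow> ('k, 'g, 'h) tens"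
    by (induction ps) (simp_all add: tscl.scale_right_distrib)
  then show ?thesis by (simp only: sw_slist)
qed

lemma mult_sw: "r * sw U V t F = sw U V t (\<lambda>u v. r * (F u v :: 'k::field))"
  by (simp only: sw_slist sum_list_const_mult)

lemma sw_scl_left:
  fixes F :: "'d::ab_group_add \<Rightarrow> 'e::ab_group_add \<Rightarrow> 'k::field"
  shows "vspace X \<Longrightarrow> scl X (sw U V t F) x = sw U V t (\<lambda>u v. scl X (F u v) x)"
proof -
  assume X: "vspace X"
  have "scl X (\<Sum>p\<leftarrow>ps. G p) x = (\<Sum>p\<leftarrow>ps. scl X (G p) x)" for ps :: "('d \<times> 'e) list" and G
    by (induction ps) (simp_all add: module.scale_left_distrib[OF vspace_module[OF X]] module.scale_zero_left[OF vspace_module[OF X]])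
  then show ?thesis by (simp only: sw_slist)
qed

text \<open>
  The rules for the canonical arrows turn a composite of structure maps, applied to pure tensors,
  into nested Sweedler sums; this is how every identity between arrows is evaluated below.
\<close>

lemma arrow_app: "x \<in> pts U \<Longrightarrow> app (arrow U V f) x = f x" by (simp add: arrow_def)

lemma arr_arrow: "vspace U \<Longrightarrow> vspace V \<Longrightarrow> lin U (scl V) f \<Longrightarrow> (\<And>x. x \<in> pts U \<Longrightarrow> f x \<in> pts V) \<Longrightarrow> arr (arrow U V f)"
  by (auto simp: arr_def Hom_def arrow_def lin_def)

lemma comp_app [simp]: "x \<in> pts (src f) \<Longrightarrow> app (g \<odot> f) x = app g (app f x)"
  by (simp add: comp_arr_def arrow_def)

lemma idl_app [simp]: "x \<in> pts U \<Longrightarrow> app (idl U) x = x" by (simp add: idl_def arrow_def)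

lemma tmap_app: "t \<in> pts (src f \<otimes>\<^sub>s src g) \<Longrightarrow> app (f \<otimes>\<^sub>m g) t = sw (src f) (src g) t (\<lambda>u v. ten (tgt f) (tgt g) (app f u) (app g v))"
  by (simp add: tmap_def arrow_def)

lemma asc_app: "t \<in> pts ((U \<otimes>\<^sub>s V) \<otimes>\<^sub>s W) \<Longrightarrow> app (asc U V W) t = sw (U \<otimes>\<^sub>s V) W t (\<lambda>s w. sw U V s (\<lambda>u v. ten U (V \<otimes>\<^sub>s W) u (ten V W v w)))"
  by (simp add: asc_def arrow_def)

lemma asi_app: "t \<in> pts (U \<otimes>\<^sub>s V \<otimes>\<^sub>s W) \<Longrightarrow> app (asi U V W) t = sw U (V \<otimes>\<^sub>s W) t (\<lambda>u s. sw V W s (\<lambda>v w. ten (U \<otimes>\<^sub>s V) W (ten U V u v) w))"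
  by (simp add: asi_def arrow_def)

lemma flip_app: "t \<in> pts (U \<otimes>\<^sub>s V) \<Longrightarrow> app (flip U V) t = sw U V t (\<lambda>u v. ten V U v u)"
  by (simp add: flip_def arrow_def)

lemma lunit_app: "t \<in> pts (ground \<otimes>\<^sub>s V) \<Longrightarrow> app (lunit V) t = sw ground V t (\<lambda>r v. scl V r v)"
  by (simp add: lunit_def arrow_def)

lemma runit_app: "t \<in> pts (V \<otimes>\<^sub>s ground) \<Longrightarrow> app (runit V) t = sw V ground t (\<lambda>v r. scl V r v)"
  by (simp add: runit_def arrow_def)

lemma arr_idl [simp]: "vspace U \<Longrightarrow> arr (idl U)" unfolding idl_def by (rule arr_arrow) auto

lemma arr_comp [simp]: "arr g \<Longrightarrow> arr f \<Longrightarrow> src g = tgt f \<Longrightarrow> vspace (src f) \<Longrightarrow> arr (g \<odot> f)"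
  by (auto simp: arr_def Hom_def comp_arr_def arrow_def)

lemmas sw_gens = sw_ten_gen[OF vector_space_tscl] sw_ten_gen[OF vs_mult]
  lin_sw_arg[OF vector_space_tscl] lin_sw_arg[OF vs_mult] lin_sw_fun[OF vector_space_tscl] lin_sw_fun[OF vs_mult]
  sw_sw[OF vector_space_tscl] sw_sw[OF vs_mult] sw_scl[OF vector_space_tscl] sw_scl[OF vs_mult]

declare sw_gens[simp]

lemma sw_scls:
  assumes "vspace X"
  shows "vspace U \<Longrightarrow> vspace V \<Longrightarrow> u \<in> pts U \<Longrightarrow> v \<in> pts V \<Longrightarrow> (\<And>v. v \<in> pts V \<Longrightarrow> lin U (scl X) (\<lambda>u. F u v)) \<Longrightarrow>
    (\<And>u. u \<in> pts U \<Longrightarrow> lin V (scl X) (\<lambda>v. F u v)) \<Longrightarrow> sw U V (ten U V u v) F = F u v"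
  and "vspace U \<Longrightarrow> vspace V \<Longrightarrow> vspace Z \<Longrightarrow> lin Z tscl e \<Longrightarrow> (\<And>x. x \<in> pts Z \<Longrightarrow> e x \<in> pts (U \<otimes>\<^sub>s V)) \<Longrightarrow> (\<And>v. v \<in> pts V \<Longrightarrow> lin U (scl X) (\<lambda>u. F u v)) \<Longrightarrow>
    (\<And>u. u \<in> pts U \<Longrightarrow> lin V (scl X) (\<lambda>v. F u v)) \<Longrightarrow> lin Z (scl X) (\<lambda>x. sw U V (e x) F)"
  by (rule sw_ten_gen[OF vs_scl[OF assms]]; assumption) (rule lin_sw_arg[OF vs_scl[OF assms]]; assumption)

lemma arr_tmap [simp]: "arr f \<Longrightarrow> arr g \<Longrightarrow> vspace (src f) \<Longrightarrow> vspace (src g) \<Longrightarrow> arr (f \<otimes>\<^sub>m g)"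
  unfolding tmap_def by (rule arr_arrow) simp_all

lemma arr_asc [simp]: "vspace U \<Longrightarrow> vspace V \<Longrightarrow> vspace W \<Longrightarrow> arr (asc U V W)"
  unfolding asc_def by (rule arr_arrow) simp_all

lemma arr_asi [simp]: "vspace U \<Longrightarrow> vspace V \<Longrightarrow> vspace W \<Longrightarrow> arr (asi U V W)"
  unfolding asi_def by (rule arr_arrow) simp_all

lemma arr_flip [simp]: "vspace U \<Longrightarrow> vspace V \<Longrightarrow> arr (flip U V)"
  unfolding flip_def by (rule arr_arrow) simp_all

lemma arr_lunit [simp]: "vspace V \<Longrightarrow> arr (lunit V)"
  unfolding lunit_def by (rule arr_arrow) (simp_all add: sw_scls[of V])

lemma arr_runit [simp]: "vspace V \<Longrightarrow> arr (runit V)"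
  unfolding runit_def by (rule arr_arrow) (simp_all add: sw_scls[of V])

declare app_sw [simp] ten_sw_left [simp] ten_sw_right [simp] tscl_sw [simp] mult_sw [simp]

lemma tmap_ten [simp]: "arr f \<Longrightarrow> arr g \<Longrightarrow> vspace (src f) \<Longrightarrow> vspace (src g) \<Longrightarrow> u \<in> pts (src f) \<Longrightarrow> v \<in> pts (src g) \<Longrightarrow>
   src f = U \<Longrightarrow> src g = V \<Longrightarrow> app (f \<otimes>\<^sub>m g) (ten U V u v) = ten (tgt f) (tgt g) (app f u) (app g v)"
  by (simp add: tmap_app)

lemma asc_ten: "vspace U \<Longrightarrow> vspace V \<Longrightarrow> vspace W \<Longrightarrow> s \<in> pts (U \<otimes>\<^sub>s V) \<Longrightarrow> w \<in> pts W \<Longrightarrow>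
   app (asc U V W) (ten (U \<otimes>\<^sub>s V) W s w) = sw U V s (\<lambda>u v. ten U (V \<otimes>\<^sub>s W) u (ten V W v w))"
  by (simp add: asc_app)

lemma arr_eqI:
  assumes "arr f" "arr g" "src f = src g" "tgt f = tgt g" "\<And>x. x \<in> pts (src g) \<Longrightarrow> app f x = app g x"
  shows "f = g"
proof (rule arr.equality)
  have "app f \<in> extensional (pts (src g))" "app g \<in> extensional (pts (src g))"
    using assms(1,2) unfolding assms(3)[symmetric] arr_def Hom_def PiE_def by (blast, metis (no_types, lifting) IntD2 assms(3) mem_Collect_eq)
  then show "app f = app g"
    by (rule extensionalityI) (rule assms(5))
qed (rule assms(3,4) | simp)+

text \<open>
  Two linear maps on a tensor product agree if they agree on pure tensors. Stated for functions, it
  replaces a choice of decomposition: an opaque tensor such as \<open>\<theta>(c)\<close> may be assumed pure in any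
  identity whose two sides are linear in it.
\<close>

lemma tens_lin_ext:
  assumes "vspace U" "vspace V" "lin (U \<otimes>\<^sub>s V) s f" "lin (U \<otimes>\<^sub>s V) s g" "t \<in> pts (U \<otimes>\<^sub>s V)"
    "\<And>u v. u \<in> pts U \<Longrightarrow> v \<in> pts V \<Longrightarrow> f (ten U V u v) = g (ten U V u v)"
  shows "f t = g t"
proof -
  have "f t = f (sw U V t (ten U V))" using sw_ten_id[OF assms(1,5)] by simp
  also have "\<dots> = sw U V t (\<lambda>u v. f (ten U V u v))"
    by (rule sw_push(1)[OF assms(1,5) _ assms(3)]) auto
  also have "\<dots> = sw U V t (\<lambda>u v. g (ten U V u v))" by (rule sw_cong[OF refl refl refl assms(6,1,5)])
  also have "\<dots> = g (sw U V t (ten U V))"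
    by (rule sw_push(1)[OF assms(1,5) _ assms(4), symmetric]) auto
  also have "\<dots> = g t" using sw_ten_id[OF assms(1,5)] by simp
  finally show ?thesis .
qed

lemma tens_arr_eqI:
  assumes "arr f" "arr g" "src f = U \<otimes>\<^sub>s V" "src g = U \<otimes>\<^sub>s V" "tgt f = tgt g" "vspace U" "vspace V"
     "\<And>u v. u \<in> pts U \<Longrightarrow> v \<in> pts V \<Longrightarrow> app f (ten U V u v) = app g (ten U V u v)"
  shows "f = g"
proof (rule arr_eqI)
  fix t assume t: "t \<in> pts (src g)"
  show "app f t = app g t"
  proof (rule tens_lin_ext[where U=U and V=V and f="app f" and g="app g" and s="scl (tgt g)"])
    show "vspace U" "vspace V" by (rule assms(6,7))+
    show "app f (ten U V u v) = app g (ten U V u v)" if "u \<in> pts U" "v \<in> pts V" for u v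
      using that by (rule assms(8))
    show "lin (U \<otimes>\<^sub>s V) (scl (tgt g)) (app f)" "lin (U \<otimes>\<^sub>s V) (scl (tgt g)) (app g)"
      using lin_app_id[OF assms(1) _ refl] lin_app_id[OF assms(2) _ refl] assms(3-5) by simp_all
    show "t \<in> pts (U \<otimes>\<^sub>s V)" using t assms(4) by simp
  qed
qed (simp_all only: assms)

lemma tmap_inverse:
  assumes "arr f" "arr g" "src f = V" "tgt f = U" "src g = U" "tgt g = V"
    and "arr f'" "arr g'" "src f' = V'" "tgt f' = U'" "src g' = U'" "tgt g' = V'"
    and "vspace U" "vspace V" "vspace U'" "vspace V'"
    and "\<And>x. x \<in> pts U \<Longrightarrow> app f (app g x) = x" "\<And>x. x \<in> pts U' \<Longrightarrow> app f' (app g' x) = x"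
    and "t \<in> pts (U \<otimes>\<^sub>s U')"
  shows "app (f \<otimes>\<^sub>m f') (app (g \<otimes>\<^sub>m g') t) = t"
  by (rule tens_lin_ext[of U U' tscl "\<lambda>t. app (f \<otimes>\<^sub>m f') (app (g \<otimes>\<^sub>m g') t)" "\<lambda>t. t"])
    (use assms in simp_all)

text \<open>
  The counit axioms in the form in which they are applied: a counit against one leg of a coproduct
  cancels inside any linear expression in the other leg.
\<close>

lemma counit:
  assumes "coalgebra \<lparr>cspc = V, cdel = \<Delta>, ceps = \<epsilon>\<rparr>" and c: "c \<in> pts V" and F: "lin V s F"
  shows counit_left: "sw V V (app \<Delta> c) (\<lambda>c1 c2. s (app \<epsilon> c1) (F c2)) = F c"
    and counit_right: "sw V V (app \<Delta> c) (\<lambda>c1 c2. s (app \<epsilon> c2) (F c1)) = F c"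
proof -
  have [simp]: "vspace V" "arr \<Delta>" "src \<Delta> = V" "tgt \<Delta> = V \<otimes>\<^sub>s V" "arr \<epsilon>" "src \<epsilon> = V" "tgt \<epsilon> = ground"
    and l: "lunit V \<odot> (\<epsilon> \<otimes>\<^sub>m idl V) \<odot> \<Delta> = idl V" and r: "runit V \<odot> (idl V \<otimes>\<^sub>m \<epsilon>) \<odot> \<Delta> = idl V"
    using assms(1) by (simp_all add: coalgebra_def arr_Hom)
  note [simp] = sw_ten_gen[OF vs_scl[of V]] sw_sw[OF vs_scl[of V]]
  have "F c = F (sw V V (app \<Delta> c) (\<lambda>c1 c2. scl V (app \<epsilon> c1) c2))"
    using arg_cong[OF l, of "\<lambda>f. app f c"] c by (simp add: lunit_app tmap_app)
  also have "\<dots> = sw V V (app \<Delta> c) (\<lambda>c1 c2. F (scl V (app \<epsilon> c1) c2))"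
    using c by (intro sw_push(1)[OF _ _ _ F]) simp_all
  also have "\<dots> = sw V V (app \<Delta> c) (\<lambda>c1 c2. s (app \<epsilon> c1) (F c2))"
    using c F by (intro sw_cong refl) (simp_all add: lin_def)
  finally show "sw V V (app \<Delta> c) (\<lambda>c1 c2. s (app \<epsilon> c1) (F c2)) = F c" by simp
  have "F c = F (sw V V (app \<Delta> c) (\<lambda>c1 c2. scl V (app \<epsilon> c2) c1))"
    using arg_cong[OF r, of "\<lambda>f. app f c"] c by (simp add: runit_app tmap_app)
  also have "\<dots> = sw V V (app \<Delta> c) (\<lambda>c1 c2. F (scl V (app \<epsilon> c2) c1))"
    using c by (intro sw_push(1)[OF _ _ _ F]) simp_all
  also have "\<dots> = sw V V (app \<Delta> c) (\<lambda>c1 c2. s (app \<epsilon> c2) (F c1))"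
    using c F by (intro sw_cong refl) (simp_all add: lin_def)
  finally show "sw V V (app \<Delta> c) (\<lambda>c1 c2. s (app \<epsilon> c2) (F c1)) = F c" by simp
qed

section \<open>Crossed products over a bialgebra and a coalgebra\<close>

locale bialg_coalg =
  fixes A :: "('k::field, 'a::ab_group_add) kspace"
    and C :: "('k, 'c::ab_group_add) kspace"
    and \<mu> :: "('k, ('k, 'a, 'a) tens, 'a) arr" and oneA :: 'a
    and \<Delta>A :: "('k, 'a, ('k, 'a, 'a) tens) arr" and \<epsilon>A :: "('k, 'a, 'k) arr"
    and \<Delta>C :: "('k, 'c, ('k, 'c, 'c) tens) arr" and \<epsilon>C :: "('k, 'c, 'k) arr" and oneC :: 'c
  assumes bialg: "bialgebra \<lparr>aspc = A, amul = \<mu>, aone = oneA\<rparr> \<lparr>cspc = A, cdel = \<Delta>A, ceps = \<epsilon>A\<rparr>"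
    and coalg: "coalgebra \<lparr>cspc = C, cdel = \<Delta>C, ceps = \<epsilon>C\<rparr>" and oneC [simp]: "oneC \<in> pts C"
begin

abbreviation mul (infixl \<open>\<star>\<close> 75) where "a \<star> b \<equiv> app \<mu> (ten A A a b)"

abbreviation H where "H \<equiv> A \<otimes>\<^sub>s C"

abbreviation tAC where "tAC \<equiv> ten A C"

lemma vspace_AC [simp]: "vspace A" "vspace C"
  using bialg coalg by (simp_all add: bialgebra_def algebra_def coalgebra_def)

lemma oneA [simp]: "oneA \<in> pts A"
  using bialg by (simp add: bialgebra_def algebra_def)

lemma str_arrs [simp]:
  "arr \<mu>" "src \<mu> = A \<otimes>\<^sub>s A" "tgt \<mu> = A" "arr \<Delta>A" "src \<Delta>A = A" "tgt \<Delta>A = A \<otimes>\<^sub>s A"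
  "arr \<epsilon>A" "src \<epsilon>A = A" "tgt \<epsilon>A = ground" "arr \<Delta>C" "src \<Delta>C = C" "tgt \<Delta>C = C \<otimes>\<^sub>s C"
  "arr \<epsilon>C" "src \<epsilon>C = C" "tgt \<epsilon>C = ground"
  using bialg coalg by (simp_all add: bialgebra_def algebra_def coalgebra_def arr_Hom)

lemmas vs_A = vs_scl[OF vspace_AC(1)] and vs_C = vs_scl[OF vspace_AC(2)]

lemmas sw_AC [simp] = sw_ten_gen[OF vs_A] sw_ten_gen[OF vs_C] lin_sw_arg[OF vs_A] lin_sw_arg[OF vs_C]
  lin_sw_fun[OF vs_A] lin_sw_fun[OF vs_C] sw_sw[OF vs_A] sw_sw[OF vs_C] sw_scl[OF vs_A] sw_scl[OF vs_C]

lemma mul_assoc: "a \<in> pts A \<Longrightarrow> b \<in> pts A \<Longrightarrow> c \<in> pts A \<Longrightarrow> (a \<star> b) \<star> c = a \<star> (b \<star> c)"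
proof -
  assume a: "a \<in> pts A" "b \<in> pts A" "c \<in> pts A"
  have "\<mu> \<odot> (\<mu> \<otimes>\<^sub>m idl A) = \<mu> \<odot> (idl A \<otimes>\<^sub>m \<mu>) \<odot> asc A A A"
    using bialg by (simp add: bialgebra_def algebra_def)
  from arg_cong[OF this, of "\<lambda>f. app f (ten (A \<otimes>\<^sub>s A) A (ten A A a b) c)"] a
  show ?thesis by (simp add: asc_ten)
qed

lemma mul_one [simp]: "a \<in> pts A \<Longrightarrow> oneA \<star> a = a" "a \<in> pts A \<Longrightarrow> a \<star> oneA = a"
  using bialg by (simp_all add: bialgebra_def algebra_def)

lemma \<epsilon>A_mul [simp]: "a \<in> pts A \<Longrightarrow> b \<in> pts A \<Longrightarrow> app \<epsilon>A (a \<star> b) = app \<epsilon>A a * app \<epsilon>A b"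
proof -
  assume a: "a \<in> pts A" "b \<in> pts A"
  have "\<epsilon>A \<odot> \<mu> = lunit ground \<odot> (\<epsilon>A \<otimes>\<^sub>m \<epsilon>A)"
    using bialg by (simp add: bialgebra_def alg_map_def ground_alg_def)
  from arg_cong[OF this, of "\<lambda>f. app f (ten A A a b)"] a
  show ?thesis by (simp add: lunit_app)
qed

lemma \<epsilon>A_one [simp]: "app \<epsilon>A oneA = 1"
  using bialg by (simp add: bialgebra_def alg_map_def ground_alg_def)

lemma \<Delta>A_mul: "a \<in> pts A \<Longrightarrow> b \<in> pts A \<Longrightarrow> app \<Delta>A (a \<star> b) =
  sw A A (app \<Delta>A a) (\<lambda>a1 a2. sw A A (app \<Delta>A b) (\<lambda>b1 b2. ten A A (a1 \<star> b1) (a2 \<star> b2)))"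
proof -
  assume a: "a \<in> pts A" "b \<in> pts A"
  have "\<Delta>A \<odot> \<mu> = amul (tensor_alg \<lparr>aspc = A, amul = \<mu>, aone = oneA\<rparr> \<lparr>aspc = A, amul = \<mu>, aone = oneA\<rparr>) \<odot> (\<Delta>A \<otimes>\<^sub>m \<Delta>A)"
    using bialg by (simp add: bialgebra_def alg_map_def)
  from arg_cong[OF this, of "\<lambda>f. app f (ten A A a b)"] a
  show ?thesis by (simp add: tensor_alg_def asc_app asi_app flip_app tmap_app)
qed

lemmas counit_left_C = counit_left[OF coalg] and counit_right_C = counit_right[OF coalg]

lemma counit_left_A: "a \<in> pts A \<Longrightarrow> lin A s F \<Longrightarrow> sw A A (app \<Delta>A a) (\<lambda>a1 a2. s (app \<epsilon>A a1) (F a2)) = F a"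
  by (rule counit_left) (use bialg in \<open>simp_all add: bialgebra_def\<close>)

text \<open>
  Coassociativity inside an arbitrary trilinear expression: the axiom is an identity in
  \<open>C \<otimes> (C \<otimes> C)\<close>, to which the linear map induced by \<open>F\<close> is applied.
\<close>

lemma coassoc_C:
  assumes "vector_space s" "c \<in> pts C"
    and "\<And>y z. y \<in> pts C \<Longrightarrow> z \<in> pts C \<Longrightarrow> lin C s (\<lambda>x. F x y z)"
    and "\<And>x z. x \<in> pts C \<Longrightarrow> z \<in> pts C \<Longrightarrow> lin C s (\<lambda>y. F x y z)"
    and "\<And>x y. x \<in> pts C \<Longrightarrow> y \<in> pts C \<Longrightarrow> lin C s (\<lambda>z. F x y z)"
  shows "sw C C (app \<Delta>C c) (\<lambda>d z. sw C C (app \<Delta>C d) (\<lambda>x y. F x y z))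
    = sw C C (app \<Delta>C c) (\<lambda>x d. sw C C (app \<Delta>C d) (\<lambda>y z. F x y z))"
proof -
  let ?G = "\<lambda>t. sw C (C \<otimes>\<^sub>s C) t (\<lambda>x s. sw C C s (\<lambda>y z. F x y z))"
  note gen = sw_ten_gen[OF assms(1)] lin_sw_arg[OF assms(1)] lin_sw_fun[OF assms(1)] sw_sw[OF assms(1)]
  have "asc C C C \<odot> (\<Delta>C \<otimes>\<^sub>m idl C) \<odot> \<Delta>C = (idl C \<otimes>\<^sub>m \<Delta>C) \<odot> \<Delta>C"
    using coalg by (simp add: coalgebra_def)
  from arg_cong[OF this, of "\<lambda>f. ?G (app f c)"] assms
  show ?thesis by (simp add: asc_app tmap_app gen)
qed

end

section \<open>A-linear endomorphisms of the tensor product\<close>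

declare sw_ten_id [simp]

context bialg_coalg begin

abbreviation act (infixr \<open>\<rhd>\<close> 75) where "a \<rhd> x \<equiv> sw A C x (\<lambda>b c. tAC (a \<star> b) c)"

text \<open>
  An \<open>A\<close>-linear endomorphism of \<open>A \<otimes> C\<close> is determined by its values on \<open>1 \<otimes> c\<close>, and every linear map
  \<open>g : C \<rightarrow> A \<otimes> C\<close> arises in this way: \<open>extA g\<close> is the map \<open>a \<otimes> c \<mapsto> a g(c)\<close>. The two maps of the theorem
  are \<open>\<theta>(c) = \<phi>(1 \<otimes> c)\<close> and \<open>\<gamma>(c) = \<phi>\<inverse>(1 \<otimes> c)\<close>, so that \<open>\<phi> = extA \<theta>\<close> and \<open>\<phi>\<inverse> = extA \<gamma>\<close>.
\<close>

definition extA :: "('k, 'c, ('k, 'a, 'c) tens) arr \<Rightarrow> ('k, ('k, 'a, 'c) tens, ('k, 'a, 'c) tens) arr" where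
  "extA g = arrow H H (\<lambda>t. sw A C t (\<lambda>a c. a \<rhd> app g c))"

text \<open>
  \<open>g \<in> Hom C (A \<otimes> C)\<close>, split into the form that rewriting uses.
\<close>

definition arr_to_H where "arr_to_H g \<longleftrightarrow> arr g \<and> src g = C \<and> tgt g = H"

lemma arr_to_HD: "arr_to_H g \<Longrightarrow> arr g" "arr_to_H g \<Longrightarrow> src g = C" "arr_to_H g \<Longrightarrow> tgt g = H"
  by (simp_all add: arr_to_H_def)

lemma arr_extA [simp]: "arr_to_H g \<Longrightarrow> arr (extA g)" "src (extA g) = H" "tgt (extA g) = H"
  unfolding extA_def arr_to_H_def by (rule arr_arrow; simp; fail) (simp_all add: arrow_def)

lemma extA_app: "arr_to_H g \<Longrightarrow> t \<in> pts H \<Longrightarrow> app (extA g) t = sw A C t (\<lambda>a c. a \<rhd> app g c)"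
  unfolding extA_def by (simp add: arrow_app)

lemma extA_ten: "arr_to_H g \<Longrightarrow> a \<in> pts A \<Longrightarrow> c \<in> pts C \<Longrightarrow> app (extA g) (tAC a c) = a \<rhd> app g c"
  by (simp add: extA_app arr_to_HD)

lemma extA_act: "arr_to_H g \<Longrightarrow> a \<in> pts A \<Longrightarrow> x \<in> pts H \<Longrightarrow> app (extA g) (a \<rhd> x) = a \<rhd> app (extA g) x"
  by (simp add: extA_app arr_to_HD mul_assoc)

text \<open>
  Conditions (iv) and (v) say that \<open>extA \<gamma> \<circ> extA \<theta>\<close> and \<open>extA \<theta> \<circ> extA \<gamma>\<close> fix the elements \<open>1 \<otimes> c\<close>; by
  \<open>A\<close>-linearity this suffices for \<open>extA \<theta>\<close> and \<open>extA \<gamma>\<close> to be mutually inverse.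
\<close>

lemma extA_inverse:
  assumes "arr_to_H f" "arr_to_H g" "\<And>c. c \<in> pts C \<Longrightarrow> app (extA f) (app g c) = tAC oneA c" "x \<in> pts H"
  shows "app (extA f) (app (extA g) x) = x"
proof (rule tens_lin_ext[of A C tscl "\<lambda>x. app (extA f) (app (extA g) x)" "\<lambda>x. x" x])
  fix a c assume ac: "a \<in> pts A" "c \<in> pts C"
  have "app (extA f) (app (extA g) (tAC a c)) = a \<rhd> app (extA f) (app g c)"
    using ac assms(1,2) by (simp only: extA_ten extA_act arr_to_HD app_in)
  also have "\<dots> = tAC a c" using ac assms(3) by simp
  finally show "app (extA f) (app (extA g) (tAC a c)) = tAC a c" .
qed (use assms in simp_all)

end

section \<open>Multiplication\<close>

text \<open>
  The algebra axioms of the crossed product are assumed rather than derived from the conditions on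
  \<open>R\<close> and \<open>\<sigma>\<close>: they are part of what it means to be a cross product bialgebra.
\<close>

locale crossed = bialg_coalg A C \<mu> oneA \<Delta>A \<epsilon>A \<Delta>C \<epsilon>C oneC
  for A :: "('k::field, 'a::ab_group_add) kspace"
    and C :: "('k, 'c::ab_group_add) kspace"
    and \<mu> and oneA and \<Delta>A and \<epsilon>A and \<Delta>C and \<epsilon>C and oneC +
  fixes R :: "('k, ('k, 'c, 'a) tens, ('k, 'a, 'c) tens) arr" and \<sigma> :: "('k, ('k, 'c, 'c) tens, ('k, 'a, 'c) tens) arr"
  assumes cp: "crossed_product \<lparr>aspc = A, amul = \<mu>, aone = oneA\<rparr> C oneC R \<sigma>"
   and alg: "algebra (crossed_product_alg \<lparr>aspc = A, amul = \<mu>, aone = oneA\<rparr> C oneC R \<sigma>)"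
begin

abbreviation "M \<equiv> amul (crossed_product_alg \<lparr>aspc = A, amul = \<mu>, aone = oneA\<rparr> C oneC R \<sigma>)"

abbreviation hmul (infixl \<open>\<Zcat>\<close> 75) where "x \<Zcat> y \<equiv> app M (ten H H x y)"

lemma R\<sigma>_arr [simp]: "arr R" "src R = C \<otimes>\<^sub>s A" "tgt R = H" "arr \<sigma>" "src \<sigma> = C \<otimes>\<^sub>s C" "tgt \<sigma> = H"
  using cp by (simp_all add: crossed_product_def arr_Hom)

lemma M_arr [simp]: "arr M" "src M = H \<otimes>\<^sub>s H" "tgt M = H"
  using alg by (simp_all add: algebra_def arr_Hom crossed_product_alg_def Let_def)

lemma hmul_ten: "a \<in> pts A \<Longrightarrow> b \<in> pts A \<Longrightarrow> c \<in> pts C \<Longrightarrow> d \<in> pts C \<Longrightarrow>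
  tAC a c \<Zcat> tAC b d = sw A C (app R (ten C A c b)) (\<lambda>b' c'. sw A C (app \<sigma> (ten C C c' d)) (\<lambda>s z. tAC (a \<star> (b' \<star> s)) z))"
  unfolding crossed_product_alg_def Let_def
  by (simp add: asc_app asi_app tmap_app)

lemma R\<sigma>_unit [simp]: "a \<in> pts A \<Longrightarrow> app R (ten C A oneC a) = tAC a oneC" "c \<in> pts C \<Longrightarrow> app R (ten C A c oneA) = tAC oneA c"
  "c \<in> pts C \<Longrightarrow> app \<sigma> (ten C C oneC c) = tAC oneA c" "c \<in> pts C \<Longrightarrow> app \<sigma> (ten C C c oneC) = tAC oneA c"
  using cp by (simp_all add: crossed_product_def)

lemma hmul_assoc: "x \<in> pts H \<Longrightarrow> y \<in> pts H \<Longrightarrow> z \<in> pts H \<Longrightarrow> (x \<Zcat> y) \<Zcat> z = x \<Zcat> (y \<Zcat> z)"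
proof -
  assume a: "x \<in> pts H" "y \<in> pts H" "z \<in> pts H"
  have "M \<odot> (M \<otimes>\<^sub>m idl H) = M \<odot> (idl H \<otimes>\<^sub>m M) \<odot> asc H H H"
    using alg by (simp add: algebra_def crossed_product_alg_def Let_def)
  from arg_cong[OF this, of "\<lambda>f. app f (ten (H \<otimes>\<^sub>s H) H (ten H H x y) z)"] a
  show ?thesis by (simp add: asc_ten)
qed

lemma act_hmul: "a \<in> pts A \<Longrightarrow> x \<in> pts H \<Longrightarrow> y \<in> pts H \<Longrightarrow> (a \<rhd> x) \<Zcat> y = a \<rhd> (x \<Zcat> y)"
proof (rule tens_lin_ext[of A C tscl "\<lambda>x. (a \<rhd> x) \<Zcat> y" "\<lambda>x. a \<rhd> (x \<Zcat> y)" x])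
  fix b c assume a: "a \<in> pts A" "b \<in> pts A" "c \<in> pts C" and y: "y \<in> pts H"
  have "(a \<rhd> tAC b c) \<Zcat> y = a \<rhd> (tAC b c \<Zcat> y)"
    by (rule tens_lin_ext[of A C tscl "\<lambda>y. (a \<rhd> tAC b c) \<Zcat> y" "\<lambda>y. a \<rhd> (tAC b c \<Zcat> y)" y])
     (use a y in \<open>simp_all add: hmul_ten mul_assoc\<close>)
  then show "(a \<rhd> tAC b c) \<Zcat> y = a \<rhd> (tAC b c \<Zcat> y)" .
qed simp_all

lemma hmul_A: "a \<in> pts A \<Longrightarrow> x \<in> pts H \<Longrightarrow> tAC a oneC \<Zcat> x = a \<rhd> x"
  by (rule tens_lin_ext[of A C tscl "\<lambda>x. tAC a oneC \<Zcat> x" "\<lambda>x. a \<rhd> x" x]) (simp_all add: hmul_ten)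

lemma hmul_R: "a \<in> pts A \<Longrightarrow> c \<in> pts C \<Longrightarrow> tAC oneA c \<Zcat> tAC a oneC = app R (ten C A c a)"
  by (simp add: hmul_ten)

lemma hmul_\<sigma>: "c \<in> pts C \<Longrightarrow> d \<in> pts C \<Longrightarrow> tAC oneA c \<Zcat> tAC oneA d = app \<sigma> (ten C C c d)"
  by (simp add: hmul_ten)

text \<open>
  The right-hand side of (i) is \<open>c \<otimes> a \<mapsto> \<phi>\<inverse>(\<theta>(c) (a \<otimes> 1))\<close>. Both sides below are linear in \<open>\<theta>(c)\<close>, so this
  is a computation with \<open>\<theta>(c)\<close> pure.
\<close>

lemma R_conjugate_ten: "arr_to_H \<theta> \<Longrightarrow> arr_to_H \<gamma> \<Longrightarrow> c \<in> pts C \<Longrightarrow> a \<in> pts A \<Longrightarrow>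
  app (((\<mu> \<odot> (idl A \<otimes>\<^sub>m \<mu>)) \<otimes>\<^sub>m idl C) \<odot> asi A (A \<otimes>\<^sub>s A) C \<odot> (idl A \<otimes>\<^sub>m asi A A C)
             \<odot> (idl A \<otimes>\<^sub>m idl A \<otimes>\<^sub>m \<gamma>) \<odot> (idl A \<otimes>\<^sub>m R) \<odot> asc A C A \<odot> (\<theta> \<otimes>\<^sub>m idl A)) (ten C A c a)
   = app (extA \<gamma>) (app \<theta> c \<Zcat> tAC a oneC)"
proof -
  assume *: "arr_to_H \<theta>" "arr_to_H \<gamma>" "c \<in> pts C" "a \<in> pts A"
  let ?f = "\<lambda>t. app (((\<mu> \<odot> (idl A \<otimes>\<^sub>m \<mu>)) \<otimes>\<^sub>m idl C) \<odot> asi A (A \<otimes>\<^sub>s A) C \<odot> (idl A \<otimes>\<^sub>m asi A A C)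
             \<odot> (idl A \<otimes>\<^sub>m idl A \<otimes>\<^sub>m \<gamma>) \<odot> (idl A \<otimes>\<^sub>m R) \<odot> asc A C A) (ten H A t a)"
  have "?f (app \<theta> c) = app (extA \<gamma>) (app \<theta> c \<Zcat> tAC a oneC)"
    by (rule tens_lin_ext[of A C tscl ?f "\<lambda>t. app (extA \<gamma>) (t \<Zcat> tAC a oneC)"])
      (use * in \<open>simp_all add: arr_to_HD hmul_ten asc_app asi_app tmap_app extA_app mul_assoc\<close>)
  then show ?thesis using * by (simp add: arr_to_HD)
qed

text \<open>
  The right-hand side of (ii) is \<open>c \<otimes> d \<mapsto> \<phi>\<inverse>(\<theta>(c) \<theta>(d))\<close>: its middle factors compose to the
  multiplication of the crossed product.
\<close>

lemma sigma_conjugate_ten: "arr_to_H \<theta> \<Longrightarrow> arr_to_H \<gamma> \<Longrightarrow> c \<in> pts C \<Longrightarrow> d \<in> pts C \<Longrightarrow>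
  app ((\<mu> \<otimes>\<^sub>m idl C) \<odot> asi A A C \<odot> (idl A \<otimes>\<^sub>m \<gamma>)
             \<odot> ((\<mu> \<odot> (idl A \<otimes>\<^sub>m \<mu>)) \<otimes>\<^sub>m idl C) \<odot> asi A (A \<otimes>\<^sub>s A) C \<odot> (idl A \<otimes>\<^sub>m asi A A C)
             \<odot> (idl A \<otimes>\<^sub>m idl A \<otimes>\<^sub>m \<sigma>) \<odot> (idl A \<otimes>\<^sub>m asc A C C)
             \<odot> (idl A \<otimes>\<^sub>m R \<otimes>\<^sub>m idl C) \<odot> (idl A \<otimes>\<^sub>m asi C A C) \<odot> asc A C (A \<otimes>\<^sub>s C)
             \<odot> (\<theta> \<otimes>\<^sub>m \<theta>)) (ten C C c d)
   = app (extA \<gamma>) (app \<theta> c \<Zcat> app \<theta> d)"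
proof -
  assume *: "arr_to_H \<theta>" "arr_to_H \<gamma>" "c \<in> pts C" "d \<in> pts C"
  have 1: "app (extA \<gamma>) x = app (\<mu> \<otimes>\<^sub>m idl C) (app (asi A A C) (app (idl A \<otimes>\<^sub>m \<gamma>) x))" if "x \<in> pts H" for x
   using * that by (simp add: arr_to_HD asi_app tmap_app extA_app)
  show ?thesis using *
    by (simp add: 1 crossed_product_alg_def Let_def arr_to_HD)
qed

end

text \<open>
  The unprimed crossed product is the one that carries the tensor product coalgebra; the primed one is
  compared with it.
\<close>

locale two_crossed = crossed A C \<mu> oneA \<Delta>A \<epsilon>A \<Delta>C \<epsilon>C oneC R \<sigma> + P: crossed A C \<mu> oneA \<Delta>A \<epsilon>A \<Delta>C \<epsilon>C oneC R' \<sigma>'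
  for A :: "('k::field, 'a::ab_group_add) kspace"
    and C :: "('k, 'c::ab_group_add) kspace"
    and \<mu> and oneA and \<Delta>A and \<epsilon>A and \<Delta>C and \<epsilon>C and oneC and R \<sigma> R' \<sigma>'
begin

abbreviation hmul' (infixl \<open>\<Zcat>''\<close> 75) where "x \<Zcat>' y \<equiv> app P.M (ten H H x y)"

lemma vi_left_ten: "arr_to_H \<gamma> \<Longrightarrow> c \<in> pts C \<Longrightarrow> d \<in> pts C \<Longrightarrow>
   app ((\<mu> \<otimes>\<^sub>m idl C) \<odot> asi A A C \<odot> (\<mu> \<otimes>\<^sub>m \<sigma>') \<odot> asi A A (C \<otimes>\<^sub>s C) \<odot> (idl A \<otimes>\<^sub>m asc A C C)
          \<odot> (idl A \<otimes>\<^sub>m \<gamma> \<otimes>\<^sub>m idl C) \<odot> asc A C C \<odot> (R \<otimes>\<^sub>m idl C) \<odot> asi C A C \<odot> (idl C \<otimes>\<^sub>m \<gamma>)) (ten C C c d) =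
    sw A C (app \<gamma> d) (\<lambda>x y. app (extA \<gamma>) (app R (ten C A c x)) \<Zcat>' tAC oneA y)"
  by (simp add: arr_to_HD asc_app asi_app tmap_app extA_app P.hmul_ten mul_assoc)

text \<open>
  Why (i) and (ii) make \<open>\<phi> = extA \<theta>\<close> multiplicative: they say that \<open>\<phi>\<close> respects the products
  \<open>(1 \<otimes> c)(a \<otimes> 1)\<close> and \<open>(1 \<otimes> c)(1 \<otimes> d)\<close>. By \<open>A\<close>-linearity and associativity on both sides, every product
  \<open>(a \<otimes> c)(b \<otimes> d) = a ((1 \<otimes> c)(b \<otimes> 1)) (1 \<otimes> d)\<close> reduces to these.
\<close>

lemma extA_multiplicative:
  assumes t: "arr_to_H \<theta>"
    and i: "\<And>a c. a \<in> pts A \<Longrightarrow> c \<in> pts C \<Longrightarrow> app (extA \<theta>) (app R' (ten C A c a)) = app \<theta> c \<Zcat> tAC a oneC"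
    and ii: "\<And>c d. c \<in> pts C \<Longrightarrow> d \<in> pts C \<Longrightarrow> app (extA \<theta>) (app \<sigma>' (ten C C c d)) = app \<theta> c \<Zcat> app \<theta> d"
    and xy: "x \<in> pts H" "y \<in> pts H"
  shows "app (extA \<theta>) (x \<Zcat>' y) = app (extA \<theta>) x \<Zcat> app (extA \<theta>) y"
proof -
  note [simp] = t arr_to_HD[OF t]
  have 1: "app (extA \<theta>) (z \<Zcat>' tAC oneA d) = app (extA \<theta>) z \<Zcat> app \<theta> d" if "z \<in> pts H" "d \<in> pts C" for z d
  proof (rule tens_lin_ext[of A C tscl "\<lambda>z. app (extA \<theta>) (z \<Zcat>' tAC oneA d)" "\<lambda>z. app (extA \<theta>) z \<Zcat> app \<theta> d"])
    fix a c assume ac: "a \<in> pts A" "c \<in> pts C"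
    have "tAC a c \<Zcat>' tAC oneA d = a \<rhd> app \<sigma>' (ten C C c d)" using ac that by (simp add: P.hmul_ten)
    then show "app (extA \<theta>) (tAC a c \<Zcat>' tAC oneA d) = app (extA \<theta>) (tAC a c) \<Zcat> app \<theta> d"
      using ac that t by (simp only: extA_act extA_ten ii act_hmul app_in arr_to_HD P.R\<sigma>_arr ten_in)
  qed (use that in simp_all)
  have 2: "app (extA \<theta>) (tAC a c \<Zcat>' tAC b d) = app (extA \<theta>) (tAC a c) \<Zcat> app (extA \<theta>) (tAC b d)"
    if "a \<in> pts A" "b \<in> pts A" "c \<in> pts C" "d \<in> pts C" for a b c d
  proof -
    have "tAC a c \<Zcat>' tAC b d = a \<rhd> (app R' (ten C A c b) \<Zcat>' tAC oneA d)"
      using that by (simp add: P.hmul_R[symmetric] P.act_hmul[symmetric] P.hmul_assoc P.hmul_A)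
    then have "app (extA \<theta>) (tAC a c \<Zcat>' tAC b d) = a \<rhd> ((app \<theta> c \<Zcat> tAC b oneC) \<Zcat> app \<theta> d)"
      using that t by (simp only: extA_act 1 i app_in arr_to_HD P.R\<sigma>_arr P.M_arr ten_in oneA)
    also have "\<dots> = app (extA \<theta>) (tAC a c) \<Zcat> app (extA \<theta>) (tAC b d)"
      using that t by (simp only: hmul_assoc hmul_A extA_ten act_hmul app_in arr_to_HD M_arr ten_in oneC
        sw_in vspace_AC vspace_tensor str_arrs)
    finally show ?thesis .
  qed
  have 3: "app (extA \<theta>) (tAC a c \<Zcat>' y) = app (extA \<theta>) (tAC a c) \<Zcat> app (extA \<theta>) y"
    if "a \<in> pts A" "c \<in> pts C" for a c
    by (rule tens_lin_ext[of A C tscl "\<lambda>y. app (extA \<theta>) (tAC a c \<Zcat>' y)" "\<lambda>y. app (extA \<theta>) (tAC a c) \<Zcat> app (extA \<theta>) y" y])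
     (use that xy in \<open>simp_all add: 2\<close>)
  show ?thesis
    by (rule tens_lin_ext[of A C tscl "\<lambda>x. app (extA \<theta>) (x \<Zcat>' y)" "\<lambda>x. app (extA \<theta>) x \<Zcat> app (extA \<theta>) y" x])
     (use xy in \<open>simp_all add: 3\<close>)
qed

text \<open>
  Condition (vi) is \<open>\<gamma>(c) \<gamma>(d) = \<phi>\<inverse>((1 \<otimes> c)(1 \<otimes> d))\<close>, a consequence of \<open>\<phi>\<inverse>\<close> being multiplicative. For \<open>\<gamma>(d) = x \<otimes> y\<close>
  its left-hand side has \<open>\<phi>\<inverse>(R(c \<otimes> x))\<close> in the place of the product \<open>\<gamma>(c) (x \<otimes> 1)\<close>, to which it is equal.
\<close>

lemma inverse_multiplicative_vi:
  assumes g: "arr_to_H \<gamma>" and u: "app \<gamma> oneC = tAC oneA oneC"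
    and m: "\<And>x y. x \<in> pts H \<Longrightarrow> y \<in> pts H \<Longrightarrow> app (extA \<gamma>) (x \<Zcat> y) = app (extA \<gamma>) x \<Zcat>' app (extA \<gamma>) y"
    and c: "c \<in> pts C" "d \<in> pts C"
  shows "sw A C (app \<gamma> d) (\<lambda>x y. app (extA \<gamma>) (app R (ten C A c x)) \<Zcat>' tAC oneA y) = app (extA \<gamma>) (app \<sigma> (ten C C c d))"
proof -
  note [simp] = g arr_to_HD[OF g]
  have e1: "app (extA \<gamma>) (tAC a oneC) = tAC a oneC" if "a \<in> pts A" for a
    using that by (simp add: extA_ten g u)
  have e2: "app (extA \<gamma>) (tAC oneA c) = app \<gamma> c" if "c \<in> pts C" for c
    using that by (simp add: extA_ten g)
  have "app (extA \<gamma>) (app R (ten C A c x)) \<Zcat>' tAC oneA y = app \<gamma> c \<Zcat>' tAC x y" if "x \<in> pts A" "y \<in> pts C" for x y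
  proof -
    have "app (extA \<gamma>) (app R (ten C A c x)) = app \<gamma> c \<Zcat>' tAC x oneC"
      using that c by (simp add: hmul_R[symmetric] m e1 e2)
    then show ?thesis using that c by (simp add: P.hmul_assoc P.hmul_A)
  qed
  then have "sw A C (app \<gamma> d) (\<lambda>x y. app (extA \<gamma>) (app R (ten C A c x)) \<Zcat>' tAC oneA y) = sw A C (app \<gamma> d) (\<lambda>x y. app \<gamma> c \<Zcat>' tAC x y)"
    using c by (intro sw_cong) simp_all
  also have "\<dots> = app \<gamma> c \<Zcat>' sw A C (app \<gamma> d) tAC"
    using c by (simp del: sw_ten_id)
  also have "\<dots> = app (extA \<gamma>) (tAC oneA c) \<Zcat>' app (extA \<gamma>) (tAC oneA d)"
    using c by (simp add: extA_ten[OF g])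
  also have "\<dots> = app (extA \<gamma>) (app \<sigma> (ten C C c d))"
    using c by (simp add: m[symmetric] hmul_\<sigma>)
  finally show ?thesis .
qed

end

section \<open>Colinear maps and counits\<close>

context bialg_coalg begin

text \<open>
  The formula of (x) and (xi): \<open>g : C \<rightarrow> A \<otimes> C\<close> is a map of right \<open>C\<close>-comodules, for the coactions \<open>\<Delta>\<^sub>C\<close> and \<open>id \<otimes> \<Delta>\<^sub>C\<close>.
\<close>

definition colinear where
  "colinear g \<longleftrightarrow> (\<forall>c\<in>pts C. sw A C (app g c) (\<lambda>p q. sw C C (app \<Delta>C q) (\<lambda>q1 q2.
           ten A (C \<otimes>\<^sub>s C) p (ten C C q1 q2)))
         = sw C C (app \<Delta>C c) (\<lambda>c1 c2. sw A C (app g c1) (\<lambda>p q. ten A (C \<otimes>\<^sub>s C) p (ten C C q c2))))"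

lemma colinear:
  assumes "colinear g" "arr_to_H g" "vector_space s" "c \<in> pts C"
    and "\<And>y z. y \<in> pts C \<Longrightarrow> z \<in> pts C \<Longrightarrow> lin A s (\<lambda>x. F x y z)"
    and "\<And>x z. x \<in> pts A \<Longrightarrow> z \<in> pts C \<Longrightarrow> lin C s (\<lambda>y. F x y z)"
    and "\<And>x y. x \<in> pts A \<Longrightarrow> y \<in> pts C \<Longrightarrow> lin C s (\<lambda>z. F x y z)"
  shows "sw A C (app g c) (\<lambda>x y. sw C C (app \<Delta>C y) (\<lambda>y1 y2. F x y1 y2))
    = sw C C (app \<Delta>C c) (\<lambda>c1 c2. sw A C (app g c1) (\<lambda>x y. F x y c2))"
proof -
  let ?G = "\<lambda>t. sw A (C \<otimes>\<^sub>s C) t (\<lambda>x s. sw C C s (\<lambda>y z. F x y z))"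
  note gen = sw_ten_gen[OF assms(3)] lin_sw_arg[OF assms(3)] lin_sw_fun[OF assms(3)] sw_sw[OF assms(3)]
  have "sw A C (app g c) (\<lambda>p q. sw C C (app \<Delta>C q) (\<lambda>q1 q2.
           ten A (C \<otimes>\<^sub>s C) p (ten C C q1 q2)))
         = sw C C (app \<Delta>C c) (\<lambda>c1 c2. sw A C (app g c1) (\<lambda>p q. ten A (C \<otimes>\<^sub>s C) p (ten C C q c2)))"
    using assms by (simp add: colinear_def)
  from arg_cong[OF this, of ?G] assms(2-)
  show ?thesis by (simp add: gen arr_to_HD)
qed

text \<open>
  A colinear map is determined by \<open>(id \<otimes> \<epsilon>) g\<close>, namely \<open>g(c) = (id \<otimes> \<epsilon>)(g(c\<^sub>1)) \<otimes> c\<^sub>2\<close>.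
\<close>

lemma colinear_counit:
  assumes "colinear g" "arr_to_H g" "vector_space s" "c \<in> pts C"
    and "\<And>y. y \<in> pts C \<Longrightarrow> lin A s (\<lambda>x. F x y)"
    and "\<And>x. x \<in> pts A \<Longrightarrow> lin C s (\<lambda>y. F x y)"
  shows "sw A C (app g c) F = sw C C (app \<Delta>C c) (\<lambda>c1 c2. sw A C (app g c1) (\<lambda>x y. s (app \<epsilon>C y) (F x c2)))"
proof -
  note [simp] = arr_to_HD[OF assms(2)] assms(4)
  interpret vector_space s by (rule assms(3))
  have *: "lin U s e \<Longrightarrow> lin U s (\<lambda>x. s r (e x))" "lin U (*) d \<Longrightarrow> lin U s (\<lambda>x. s (d x) v)" if "vspace U" for r e v d and U :: "('k, 'x::ab_group_add) kspace"
    using that by (simp_all add: lin_def scale_right_distrib scale_left_distrib mult.commute del: lin_cong cong: ball_cong)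
  have "sw A C (app g c) F = sw A C (app g c) (\<lambda>x y. sw C C (app \<Delta>C y) (\<lambda>y1 y2. s (app \<epsilon>C y1) (F x y2)))"
    using counit_left_C[of _ s] assms by (intro sw_cong refl) simp_all
  also have "\<dots> = sw C C (app \<Delta>C c) (\<lambda>c1 c2. sw A C (app g c1) (\<lambda>x y. s (app \<epsilon>C y) (F x c2)))"
    using assms by (intro colinear[OF assms(1-3)]) (simp_all add: *)
  finally show ?thesis .
qed

text \<open>
  For \<open>g(c) = x \<otimes> y\<close>, the map \<open>f(c) = \<epsilon>\<^sub>A(x) y\<close> is again colinear and \<open>\<epsilon> f = \<epsilon>\<close> by (ix). A colinear
  endomorphism of \<open>C\<close> is recovered from \<open>\<epsilon> f\<close> as \<open>f(c) = \<epsilon>(f(c\<^sub>1)) c\<^sub>2\<close>, whence \<open>f = id\<close>. This is what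
  removes the factor \<open>\<epsilon>\<^sub>A\<close> from (vii).
\<close>

lemma counit_A_id:
  assumes "colinear g" "arr_to_H g" "c \<in> pts C" and e: "\<And>c. c \<in> pts C \<Longrightarrow> sw A C (app g c) (\<lambda>p q. app \<epsilon>A p * app \<epsilon>C q) = app \<epsilon>C c"
  shows "sw A C (app g c) (\<lambda>x y. scl C (app \<epsilon>A x) y) = c"
proof -
  note [simp] = arr_to_HD[OF assms(2)] assms(3)
  interpret vector_space "scl C" by (rule vs_C)
  have "sw A C (app g c) (\<lambda>x y. scl C (app \<epsilon>A x) y)
    = sw C C (app \<Delta>C c) (\<lambda>c1 c2. sw A C (app g c1) (\<lambda>x y. scl C (app \<epsilon>C y) (scl C (app \<epsilon>A x) c2)))"
    by (intro colinear_counit assms vs_C) simp_all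
  also have "\<dots> = sw C C (app \<Delta>C c) (\<lambda>c1 c2. scl C (sw A C (app g c1) (\<lambda>x y. app \<epsilon>A x * app \<epsilon>C y)) c2)"
    by (simp add: sw_scl_left mult.commute)
  also have "\<dots> = sw C C (app \<Delta>C c) (\<lambda>c1 c2. scl C (app \<epsilon>C c1) c2)"
    by (simp add: e)
  also have "\<dots> = c" by (rule counit_left_C[where s="scl C"]) simp_all
  finally show ?thesis .
qed

end

section \<open>Crossed coproducts\<close>

context bialg_coalg begin

abbreviation "cocross W \<rho> \<equiv> crossed_coproduct_coalg A \<epsilon>A \<lparr>cspc = C, cdel = \<Delta>C, ceps = \<epsilon>C\<rparr> W \<rho>"

lemma cspc_cocross: "cspc (cocross W \<rho>) = H" by (simp add: crossed_coproduct_coalg_def Let_def)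

text \<open>
  The arrows of a crossed coproduct on \<open>A\<close> and \<open>C\<close>, with source and target in the form that rewriting
  uses.
\<close>

definition cross_arrows where
  "cross_arrows W \<rho> \<longleftrightarrow> arr W \<and> src W = H \<and> tgt W = C \<otimes>\<^sub>s A \<and> arr \<rho> \<and> src \<rho> = H \<and> tgt \<rho> = A \<otimes>\<^sub>s A"

lemma cross_arrowsD: "cross_arrows W \<rho> \<Longrightarrow> arr W" "cross_arrows W \<rho> \<Longrightarrow> src W = H" "cross_arrows W \<rho> \<Longrightarrow> tgt W = C \<otimes>\<^sub>s A"
  "cross_arrows W \<rho> \<Longrightarrow> arr \<rho>" "cross_arrows W \<rho> \<Longrightarrow> src \<rho> = H" "cross_arrows W \<rho> \<Longrightarrow> tgt \<rho> = A \<otimes>\<^sub>s A"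
  by (simp_all add: cross_arrows_def)

lemma cdel_arr: "cross_arrows W \<rho> \<Longrightarrow> arr (cdel (cocross W \<rho>))" "src (cdel (cocross W \<rho>)) = H" "tgt (cdel (cocross W \<rho>)) = H \<otimes>\<^sub>s H"
  by (simp_all add: crossed_coproduct_coalg_def Let_def cross_arrowsD)

lemma cdel_ten: "cross_arrows W \<rho> \<Longrightarrow> a \<in> pts A \<Longrightarrow> c \<in> pts C \<Longrightarrow> app (cdel (cocross W \<rho>)) (tAC a c) =
  sw C C (app \<Delta>C c) (\<lambda>c1 c2. sw A A (app \<rho> (tAC a c1)) (\<lambda>u v. sw C C (app \<Delta>C c2) (\<lambda>d e.
    sw C A (app W (tAC v d)) (\<lambda>z w. ten H H (tAC u z) (tAC w e)))))"
  by (simp add: crossed_coproduct_coalg_def Let_def cross_arrowsD asi_app asc_app tmap_app)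

lemma ceps_arr: "arr (ceps (cocross W \<rho>))" "src (ceps (cocross W \<rho>)) = H" "tgt (ceps (cocross W \<rho>)) = ground"
  by (simp_all add: crossed_coproduct_coalg_def Let_def)

lemma ceps_ten: "a \<in> pts A \<Longrightarrow> c \<in> pts C \<Longrightarrow> app (ceps (cocross W \<rho>)) (tAC a c) = app \<epsilon>A a * app \<epsilon>C c"
  by (simp add: crossed_coproduct_coalg_def Let_def lunit_app)

lemma cdel0_ten:
  assumes "cross_arrows W0 \<rho>0" "\<forall>a\<in>pts A. \<forall>c\<in>pts C. app W0 (ten A C a c) = ten C A c a"
   "\<forall>a\<in>pts A. \<forall>c\<in>pts C. app \<rho>0 (ten A C a c) = sw A A (app \<Delta>A a) (\<lambda>a1 a2. ten A A a1 (scl A (app \<epsilon>C c) a2))"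
   "a \<in> pts A" "c \<in> pts C"
  shows "app (cdel (cocross W0 \<rho>0)) (tAC a c) = sw A A (app \<Delta>A a) (\<lambda>a1 a2. sw C C (app \<Delta>C c) (\<lambda>c1 c2. ten H H (tAC a1 c1) (tAC a2 c2)))"
proof -
  have "app (cdel (cocross W0 \<rho>0)) (tAC a c) = sw C C (app \<Delta>C c) (\<lambda>c1 c2. sw A A (app \<Delta>A a) (\<lambda>a1 a2. sw C C (app \<Delta>C c2) (\<lambda>d e.
     tscl (app \<epsilon>C c1) (ten H H (tAC a1 d) (tAC a2 e)))))"
    using assms by (simp add: cdel_ten ten_distribs)
  also have "\<dots> = sw C C (app \<Delta>C c) (\<lambda>c1 c2. tscl (app \<epsilon>C c1) (sw A A (app \<Delta>A a) (\<lambda>a1 a2. sw C C (app \<Delta>C c2) (\<lambda>d e.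
     ten H H (tAC a1 d) (tAC a2 e)))))" using assms by simp
  also have "\<dots> = sw A A (app \<Delta>A a) (\<lambda>a1 a2. sw C C (app \<Delta>C c) (\<lambda>d e. ten H H (tAC a1 d) (tAC a2 e)))"
    using assms by (intro counit_left_C[where s=tscl]) simp_all
  finally show ?thesis .
qed

lemma crossed_coproduct_counits:
  assumes "crossed_coproduct A \<epsilon>A \<lparr>cspc = C, cdel = \<Delta>C, ceps = \<epsilon>C\<rparr> W \<rho>"
  shows "cross_arrows W \<rho>"
  and "a \<in> pts A \<Longrightarrow> c \<in> pts C \<Longrightarrow> sw C A (app W (tAC a c)) (\<lambda>z w. scl A (app \<epsilon>C z) w) = scl A (app \<epsilon>C c) a"
  and "a \<in> pts A \<Longrightarrow> c \<in> pts C \<Longrightarrow> sw A A (app \<rho> (tAC a c)) (\<lambda>u v. scl A (app \<epsilon>A u) v) = scl A (app \<epsilon>C c) a"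
proof -
  show x: "cross_arrows W \<rho>" using assms by (simp add: crossed_coproduct_def cross_arrows_def arr_Hom)
  have 1: "lunit A \<odot> (\<epsilon>C \<otimes>\<^sub>m idl A) \<odot> W = runit A \<odot> (idl A \<otimes>\<^sub>m \<epsilon>C)" "lunit A \<odot> (\<epsilon>A \<otimes>\<^sub>m idl A) \<odot> \<rho> = runit A \<odot> (idl A \<otimes>\<^sub>m \<epsilon>C)"
    using assms by (simp_all add: crossed_coproduct_def)
  show "a \<in> pts A \<Longrightarrow> c \<in> pts C \<Longrightarrow> sw C A (app W (tAC a c)) (\<lambda>z w. scl A (app \<epsilon>C z) w) = scl A (app \<epsilon>C c) a"
    using arg_cong[OF 1(1), of "\<lambda>f. app f (tAC a c)"] x by (simp add: cross_arrowsD lunit_app runit_app tmap_app)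
  show "a \<in> pts A \<Longrightarrow> c \<in> pts C \<Longrightarrow> sw A A (app \<rho> (tAC a c)) (\<lambda>u v. scl A (app \<epsilon>A u) v) = scl A (app \<epsilon>C c) a"
    using arg_cong[OF 1(2), of "\<lambda>f. app f (tAC a c)"] x by (simp add: cross_arrowsD lunit_app runit_app tmap_app)
qed

text \<open>
  A crossed coproduct \<open>\<Delta>\<close> determines its \<open>W\<close> and \<open>\<rho>\<close> by applying counits to the outer, respectively to
  the second and fourth, of the four tensor factors (lemmas \<open>cdel_W\<close> and \<open>cdel_\<rho>\<close> below). The next two
  lemmas apply these counits to the transported tensor product coproduct
  \<open>(\<phi>\<inverse> \<otimes> \<phi>\<inverse>)(\<Delta>\<^sub>0(b \<otimes> q)) = b\<^sub>1 \<gamma>(q\<^sub>1) \<otimes> b\<^sub>2 \<gamma>(q\<^sub>2)\<close>; with \<open>b = a p\<close> and \<open>\<theta>(c) = p \<otimes> q\<close> they give the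
  right-hand sides of (vii) and (viii).
\<close>

lemma W_of_conjugate_cdel:
  assumes "arr_to_H \<gamma>" "b \<in> pts A" "q \<in> pts C"
  defines "P \<equiv> \<lambda>t. sw H H t (\<lambda>s s'. sw A C s (\<lambda>u z. sw A C s' (\<lambda>w e. tscl (app \<epsilon>A u * app \<epsilon>C e) (ten C A z w))))"
  shows "P (app (extA \<gamma> \<otimes>\<^sub>m extA \<gamma>) (sw A A (app \<Delta>A b) (\<lambda>a1 a2. sw C C (app \<Delta>C q) (\<lambda>c1 c2. ten H H (tAC a1 c1) (tAC a2 c2)))))
     = sw C C (app \<Delta>C q) (\<lambda>q1 q2. sw A C (app \<gamma> q1) (\<lambda>x1 y1. sw A C (app \<gamma> q2) (\<lambda>x2 y2.
             tscl (app \<epsilon>A x1 * app \<epsilon>C y2) (ten C A y1 (b \<star> x2)))))" (is "?L = ?Y b")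
proof -
  note [simp] = assms(1-3) arr_to_HD[OF assms(1)]
  \<comment> \<open>after evaluation, the sums over \<open>\<gamma>(q\<^sub>1)\<close> and \<open>\<gamma>(q\<^sub>2)\<close> are nested in the opposite order on the two sides\<close>
  have "?L = sw A A (app \<Delta>A b) (\<lambda>b1 b2. tscl (app \<epsilon>A b1) (?Y b2))"
    unfolding P_def by (simp add: extA_ten mult.assoc)
      (rule sw_cong[OF refl refl refl], rule sw_cong[OF refl refl refl], rule sw_swap, simp_all)
  also have "\<dots> = ?Y b" by (rule counit_left_A[where s=tscl]) simp_all
  finally show ?thesis .
qed

text \<open>
  Condition (viii) contains \<open>\<gamma>\<close> applied twice in succession, the transported coproduct \<open>\<gamma>\<close> applied to \<open>q\<^sub>1\<close>
  and to \<open>q\<^sub>2\<close>; colinearity of \<open>\<gamma>\<close> exchanges the two.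
\<close>

lemma \<rho>_of_conjugate_cdel:
  assumes "arr_to_H \<gamma>" "colinear \<gamma>" "b \<in> pts A" "q \<in> pts C"
  defines "P \<equiv> \<lambda>t. sw H H t (\<lambda>s s'. sw A C s (\<lambda>u z. sw A C s' (\<lambda>w e. tscl (app \<epsilon>C z * app \<epsilon>C e) (ten A A u w))))"
  shows "P (app (extA \<gamma> \<otimes>\<^sub>m extA \<gamma>) (sw A A (app \<Delta>A b) (\<lambda>a1 a2. sw C C (app \<Delta>C q) (\<lambda>c1 c2. ten H H (tAC a1 c1) (tAC a2 c2)))))
     = sw A A (app \<Delta>A b) (\<lambda>b1 b2. sw A C (app \<gamma> q) (\<lambda>x y. sw A C (app \<gamma> y) (\<lambda>x' y'.
             tscl (app \<epsilon>C y') (ten A A (b1 \<star> x) (b2 \<star> x')))))"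
proof -
  note [simp] = assms(1,3,4) arr_to_HD[OF assms(1)]
  have 1: "sw A C (app \<gamma> q) (\<lambda>x y. sw A C (app \<gamma> y) (\<lambda>x' y'. tscl (app \<epsilon>C y') (ten A A (b1 \<star> x) (b2 \<star> x'))))
    = sw C C (app \<Delta>C q) (\<lambda>q1 q2. sw A C (app \<gamma> q1) (\<lambda>x y. tscl (app \<epsilon>C y) (sw A C (app \<gamma> q2) (\<lambda>x' y'. tscl (app \<epsilon>C y') (ten A A (b1 \<star> x) (b2 \<star> x'))))))"
    if "b1 \<in> pts A" "b2 \<in> pts A" for b1 b2
    by (rule colinear_counit[OF assms(2,1) vector_space_tscl]) (use that in simp_all)
  show ?thesis unfolding P_def by (simp add: extA_ten 1)
      (rule sw_cong[OF refl refl refl], rule sw_cong[OF refl refl refl], rule sw_swap, simp_all)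
qed

lemma cdel_W:
  assumes "crossed_coproduct A \<epsilon>A \<lparr>cspc = C, cdel = \<Delta>C, ceps = \<epsilon>C\<rparr> W \<rho>" "a \<in> pts A" "c \<in> pts C"
  defines "P \<equiv> \<lambda>t. sw H H t (\<lambda>s s'. sw A C s (\<lambda>u z. sw A C s' (\<lambda>w e. tscl (app \<epsilon>A u * app \<epsilon>C e) (ten C A z w))))"
  shows "P (app (cdel (cocross W \<rho>)) (tAC a c)) = app W (tAC a c)"
proof -
  note X = crossed_coproduct_counits[OF assms(1)]
  note [simp] = assms(2,3) X(1) cross_arrowsD[OF X(1)]
  have 0: "sw C A t (\<lambda>z w. tscl r (ten C A z w)) = tscl r t" if "t \<in> pts (C \<otimes>\<^sub>s A)" for t r
    using that tscl_sw[of r C A t "ten C A"] by (simp del: tscl_sw)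
  have scale: "app W (tAC (scl A r v) d) = tscl r (app W (tAC v d))" if "v \<in> pts A" "d \<in> pts C" for r v d
  proof -
    have "lin A tscl (\<lambda>v. app W (tAC v d))" using that by simp
    then show ?thesis using that unfolding lin_def by blast
  qed
  have "P (app (cdel (cocross W \<rho>)) (tAC a c)) = sw C C (app \<Delta>C c) (\<lambda>c1 c2. sw A A (app \<rho> (tAC a c1)) (\<lambda>u v. sw C C (app \<Delta>C c2) (\<lambda>d e.
      tscl (app \<epsilon>C e) (tscl (app \<epsilon>A u) (app W (tAC v d))))))"
    unfolding P_def by (simp add: cdel_ten 0 mult.commute)
  also have "\<dots> = sw C C (app \<Delta>C c) (\<lambda>c1 c2. sw A A (app \<rho> (tAC a c1)) (\<lambda>u v. tscl (app \<epsilon>A u) (app W (tAC v c2))))"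
    by (intro sw_cong refl counit_right_C[where s=tscl]) simp_all
  also have "\<dots> = sw C C (app \<Delta>C c) (\<lambda>c1 c2. app W (tAC (sw A A (app \<rho> (tAC a c1)) (\<lambda>u v. scl A (app \<epsilon>A u) v)) c2))"
    by (simp add: scale)
  also have "\<dots> = sw C C (app \<Delta>C c) (\<lambda>c1 c2. tscl (app \<epsilon>C c1) (app W (tAC a c2)))"
    by (simp add: X(3) scale del: app_sw ten_sw_left)
  also have "\<dots> = app W (tAC a c)" by (rule counit_left_C[where s=tscl]) simp_all
  finally show ?thesis .
qed

lemma cdel_\<rho>:
  assumes "crossed_coproduct A \<epsilon>A \<lparr>cspc = C, cdel = \<Delta>C, ceps = \<epsilon>C\<rparr> W \<rho>" "a \<in> pts A" "c \<in> pts C"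
  defines "P \<equiv> \<lambda>t. sw H H t (\<lambda>s s'. sw A C s (\<lambda>u z. sw A C s' (\<lambda>w e. tscl (app \<epsilon>C z * app \<epsilon>C e) (ten A A u w))))"
  shows "P (app (cdel (cocross W \<rho>)) (tAC a c)) = app \<rho> (tAC a c)"
proof -
  note X = crossed_coproduct_counits[OF assms(1)]
  note [simp] = assms(2,3) X(1) cross_arrowsD[OF X(1)]
  have 0: "sw A A t (\<lambda>z w. tscl r (ten A A z w)) = tscl r t" if "t \<in> pts (A \<otimes>\<^sub>s A)" for t r
    using that tscl_sw[of r A A t "ten A A"] by (simp del: tscl_sw)
  have "P (app (cdel (cocross W \<rho>)) (tAC a c)) = sw C C (app \<Delta>C c) (\<lambda>c1 c2. sw A A (app \<rho> (tAC a c1)) (\<lambda>u v. sw C C (app \<Delta>C c2) (\<lambda>d e.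
      tscl (app \<epsilon>C e) (ten A A u (sw C A (app W (tAC v d)) (\<lambda>z w. scl A (app \<epsilon>C z) w))))))"
    unfolding P_def by (simp add: cdel_ten mult.commute ten_distribs)
  also have "\<dots> = sw C C (app \<Delta>C c) (\<lambda>c1 c2. sw A A (app \<rho> (tAC a c1)) (\<lambda>u v. sw C C (app \<Delta>C c2) (\<lambda>d e.
      tscl (app \<epsilon>C e) (tscl (app \<epsilon>C d) (ten A A u v)))))"
    by (simp add: X(2) ten_distribs del: ten_sw_right tscl.scale_scale)
  also have "\<dots> = sw C C (app \<Delta>C c) (\<lambda>c1 c2. sw A A (app \<rho> (tAC a c1)) (\<lambda>u v. tscl (app \<epsilon>C c2) (ten A A u v)))"
    by (intro sw_cong refl counit_right_C[where s=tscl]) simp_all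
  also have "\<dots> = sw C C (app \<Delta>C c) (\<lambda>c1 c2. tscl (app \<epsilon>C c2) (app \<rho> (tAC a c1)))"
    by (simp add: 0 del: tscl_sw)
  also have "\<dots> = app \<rho> (tAC a c)" by (rule counit_right_C[where s=tscl]) simp_all
  finally show ?thesis .
qed

end

section \<open>Comultiplication\<close>

context bialg_coalg begin

text \<open>
  Both (vii) and (viii) have the form \<open>f(a \<otimes> c) = Y(\<phi>(a \<otimes> c))\<close> with \<open>Y\<close> bilinear, that is \<open>f = Y \<circ> \<phi>\<close>. Hence
  \<open>f \<circ> \<phi>\<inverse> = Y\<close>, and on \<open>\<phi>\<inverse>(b \<otimes> d) = b \<gamma>(d)\<close> the map \<open>\<theta>\<close> has disappeared.
\<close>

lemma eval_at_inverse:
  assumes "arr_to_H \<theta>" "arr_to_H \<gamma>" and inv: "\<And>c. c \<in> pts C \<Longrightarrow> app (extA \<theta>) (app \<gamma> c) = tAC oneA c"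
    and f: "arr f" "src f = H" "scl (tgt f) = tscl"
    and Y: "\<And>c. c \<in> pts C \<Longrightarrow> lin A tscl (\<lambda>a. Y a c)" "\<And>a. a \<in> pts A \<Longrightarrow> lin C tscl (\<lambda>c. Y a c)"
    and fY: "\<And>a c. a \<in> pts A \<Longrightarrow> c \<in> pts C \<Longrightarrow> app f (tAC a c) = sw A C (app \<theta> c) (\<lambda>p q. Y (a \<star> p) q)"
    and b: "b \<in> pts A" "d \<in> pts C"
  shows "app f (b \<rhd> app \<gamma> d) = Y b d"
proof -
  note [simp] = assms(1,2) arr_to_HD[OF assms(1)] arr_to_HD[OF assms(2)] f b
  have Ym: "lin A tscl (\<lambda>p. Y (a \<star> p) q)" if "a \<in> pts A" "q \<in> pts C" for a q
    by (rule lin_comp[OF Y(1)]) (use that in simp_all)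
  have *: "app f t = sw A C (app (extA \<theta>) t) Y" if "t \<in> pts H" for t
    by (rule tens_lin_ext[of A C tscl "app f" "\<lambda>t. sw A C (app (extA \<theta>) t) Y" t])
      (use that Y Ym lin_app_id[of f tscl] in \<open>simp_all add: fY extA_ten\<close>)
  have "app f (app (extA \<gamma>) (tAC b d)) = sw A C (app (extA \<theta>) (app (extA \<gamma>) (tAC b d))) Y"
    by (rule *) simp
  also have "app (extA \<theta>) (app (extA \<gamma>) (tAC b d)) = tAC b d"
    by (rule extA_inverse[OF assms(1,2) inv]) simp_all
  also have "sw A C (tAC b d) Y = Y b d"
    by (rule sw_ten_gen[OF vector_space_tscl]) (use Y in simp_all)
  also have "app (extA \<gamma>) (tAC b d) = b \<rhd> app \<gamma> d"
    by (rule extA_ten) simp_all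
  finally show ?thesis .
qed

text \<open>
  The comultiplication \<open>\<Delta>'\<close> built from (vii) and (viii) satisfies \<open>\<Delta>' \<circ> \<phi>\<inverse> = (\<phi>\<inverse> \<otimes> \<phi>\<inverse>) \<circ> \<Delta>\<^sub>0\<close>. Evaluated at \<open>b \<otimes> d\<close>,
  the right-hand side is \<open>b\<^sub>1 \<gamma>(d\<^sub>1) \<otimes> b\<^sub>2 \<gamma>(d\<^sub>2)\<close>. On the left-hand side, colinearity of \<open>\<gamma>\<close> moves each \<open>\<gamma>\<close> across the
  coproducts of \<open>C\<close> until \<open>\<rho>'\<close> and \<open>W'\<close> are applied to elements \<open>\<phi>\<inverse>(b \<otimes> d)\<close>, where they are known.
\<close>

lemma cdel_at_inverse:
  assumes "arr_to_H \<theta>" "arr_to_H \<gamma>" and inv: "\<And>c. c \<in> pts C \<Longrightarrow> app (extA \<theta>) (app \<gamma> c) = tAC oneA c"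
    and W: "cross_arrows W \<rho>" and col: "colinear \<gamma>"
    and e: "\<And>c. c \<in> pts C \<Longrightarrow> sw A C (app \<gamma> c) (\<lambda>p q. app \<epsilon>A p * app \<epsilon>C q) = app \<epsilon>C c"
    and fW: "\<And>a c. a \<in> pts A \<Longrightarrow> c \<in> pts C \<Longrightarrow> app W (tAC a c) = sw A C (app \<theta> c) (\<lambda>p q.
      sw C C (app \<Delta>C q) (\<lambda>q1 q2. sw A C (app \<gamma> q1) (\<lambda>x1 y1. sw A C (app \<gamma> q2) (\<lambda>x2 y2.
             tscl (app \<epsilon>A x1 * app \<epsilon>C y2) (ten C A y1 ((a \<star> p) \<star> x2))))))"
    and f\<rho>: "\<And>a c. a \<in> pts A \<Longrightarrow> c \<in> pts C \<Longrightarrow> app \<rho> (tAC a c) = sw A C (app \<theta> c) (\<lambda>p q.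
      sw A A (app \<Delta>A (a \<star> p)) (\<lambda>b1 b2. sw A C (app \<gamma> q) (\<lambda>x y. sw A C (app \<gamma> y) (\<lambda>x' y'.
             tscl (app \<epsilon>C y') (ten A A (b1 \<star> x) (b2 \<star> x'))))))"
    and b: "b \<in> pts A" "d \<in> pts C"
  shows "app (cdel (cocross W \<rho>)) (b \<rhd> app \<gamma> d) = app (extA \<gamma> \<otimes>\<^sub>m extA \<gamma>)
    (sw A A (app \<Delta>A b) (\<lambda>a1 a2. sw C C (app \<Delta>C d) (\<lambda>c1 c2. ten H H (tAC a1 c1) (tAC a2 c2))))"
proof -
  note [simp] = assms(1,2) arr_to_HD[OF assms(1)] arr_to_HD[OF assms(2)] W cross_arrowsD[OF W] b
  have W1: "app W (b \<rhd> app \<gamma> d) = sw C C (app \<Delta>C d) (\<lambda>q1 q2. sw A C (app \<gamma> q2) (\<lambda>x y. tscl (app \<epsilon>C y) (ten C A q1 (b \<star> x))))"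
    if bd: "b \<in> pts A" "d \<in> pts C" for b d
  proof -
    have "app W (b \<rhd> app \<gamma> d) = sw C C (app \<Delta>C d) (\<lambda>q1 q2. sw A C (app \<gamma> q1) (\<lambda>x1 y1. sw A C (app \<gamma> q2) (\<lambda>x2 y2.
             tscl (app \<epsilon>A x1 * app \<epsilon>C y2) (ten C A y1 (b \<star> x2)))))"
      by (rule eval_at_inverse[OF assms(1,2) inv _ _ _ _ _ fW]) (use bd in simp_all)
    also have "\<dots> = sw C C (app \<Delta>C d) (\<lambda>q1 q2. sw A C (app \<gamma> q2) (\<lambda>x2 y2. sw A C (app \<gamma> q1) (\<lambda>x1 y1.
             tscl (app \<epsilon>A x1 * app \<epsilon>C y2) (ten C A y1 (b \<star> x2)))))"
      by (rule sw_cong[OF refl refl refl], rule sw_swap) (use bd in simp_all)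
    also have "\<dots> = sw C C (app \<Delta>C d) (\<lambda>q1 q2. sw A C (app \<gamma> q2) (\<lambda>x2 y2.
             tscl (app \<epsilon>C y2) (ten C A (sw A C (app \<gamma> q1) (\<lambda>x1 y1. scl C (app \<epsilon>A x1) y1)) (b \<star> x2))))"
      using bd by (simp add: ten_distribs mult.commute)
    \<comment> \<open>here the first \<open>\<gamma>\<close> disappears, as \<open>(\<epsilon>\<^sub>A \<otimes> id) \<gamma> = id\<close>\<close>
    also have "\<dots> = sw C C (app \<Delta>C d) (\<lambda>q1 q2. sw A C (app \<gamma> q2) (\<lambda>x2 y2. tscl (app \<epsilon>C y2) (ten C A q1 (b \<star> x2))))"
      using bd by (simp add: counit_A_id[OF col assms(2) _ e] del: ten_sw_left)
    finally show ?thesis .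
  qed
  let ?K = "\<lambda>b d. sw A A (app \<Delta>A b) (\<lambda>b1 b2. sw A C (app \<gamma> d) (\<lambda>x y. sw A C (app \<gamma> y) (\<lambda>x' y'.
             tscl (app \<epsilon>C y') (ten A A (b1 \<star> x) (b2 \<star> x')))))"
  have \<rho>1: "app \<rho> (b \<rhd> app \<gamma> d) = ?K b d" if "b \<in> pts A" "d \<in> pts C" for b d
    by (rule eval_at_inverse[OF assms(1,2) inv _ _ _ _ _ f\<rho>]) (use that in simp_all)
  \<comment> \<open>\<open>\<Delta>'(a \<otimes> c) = \<Xi> (\<rho>'(a \<otimes> c\<^sub>1)) c\<^sub>2\<close>, and \<open>\<Xi>'\<close> is \<open>\<Xi>\<close> on pure tensors\<close>
  define \<Xi> where "\<Xi> = (\<lambda>r e. sw A A r (\<lambda>u v. sw C C (app \<Delta>C e) (\<lambda>d e. sw C A (app W (tAC v d)) (\<lambda>z w. ten H H (tAC u z) (tAC w e)))))"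
  define \<Xi>' where "\<Xi>' = (\<lambda>u v e. sw C C (app \<Delta>C e) (\<lambda>d e. sw C A (app W (tAC v d)) (\<lambda>z w. ten H H (tAC u z) (tAC w e))))"
  have "app (cdel (cocross W \<rho>)) (b \<rhd> app \<gamma> d) = sw A C (app \<gamma> d) (\<lambda>x y. sw C C (app \<Delta>C y) (\<lambda>y1 y2. \<Xi> (app \<rho> (tAC (b \<star> x) y1)) y2))"
    by (simp add: cdel_ten \<Xi>_def cdel_arr)
  also have "\<dots> = sw C C (app \<Delta>C d) (\<lambda>d1 d2. sw A C (app \<gamma> d1) (\<lambda>x y. \<Xi> (app \<rho> (tAC (b \<star> x) y)) d2))"
    by (rule colinear[OF col _ vector_space_tscl]) (simp_all add: \<Xi>_def)
  also have "\<dots> = sw C C (app \<Delta>C d) (\<lambda>d1 d2. \<Xi> (app \<rho> (b \<rhd> app \<gamma> d1)) d2)"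
    by (simp add: \<Xi>_def)
  also have "\<dots> = sw C C (app \<Delta>C d) (\<lambda>d1 d2. sw A A (app \<Delta>A b) (\<lambda>b1 b2. sw A C (app \<gamma> d1) (\<lambda>x y. sw A C (app \<gamma> y) (\<lambda>x' y'.
             tscl (app \<epsilon>C y') (\<Xi>' (b1 \<star> x) (b2 \<star> x') d2)))))"
    unfolding \<Xi>_def \<Xi>'_def by (simp add: \<rho>1 del: app_sw)
  also have "\<dots> = sw A A (app \<Delta>A b) (\<lambda>b1 b2. sw C C (app \<Delta>C d) (\<lambda>d1 d2. sw A C (app \<gamma> d1) (\<lambda>x y. sw A C (app \<gamma> y) (\<lambda>x' y'.
             tscl (app \<epsilon>C y') (\<Xi>' (b1 \<star> x) (b2 \<star> x') d2)))))"
    by (rule sw_swap)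
  also have "\<dots> = sw A A (app \<Delta>A b) (\<lambda>b1 b2. sw C C (app \<Delta>C d) (\<lambda>c1 c2. ten H H (b1 \<rhd> app \<gamma> c1) (b2 \<rhd> app \<gamma> c2)))"
  proof (rule sw_cong[OF refl refl refl])
    fix b1 b2 assume bb [simp]: "b1 \<in> pts A" "b2 \<in> pts A"
    have "sw C C (app \<Delta>C d) (\<lambda>d1 d2. sw A C (app \<gamma> d1) (\<lambda>x y. sw A C (app \<gamma> y) (\<lambda>x' y'. tscl (app \<epsilon>C y') (\<Xi>' (b1 \<star> x) (b2 \<star> x') d2))))
      = sw A C (app \<gamma> d) (\<lambda>x y. sw C C (app \<Delta>C y) (\<lambda>y1 y2. sw A C (app \<gamma> y1) (\<lambda>x' y'. tscl (app \<epsilon>C y') (\<Xi>' (b1 \<star> x) (b2 \<star> x') y2))))"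
      by (rule colinear[OF col _ vector_space_tscl, symmetric]) (simp_all add: \<Xi>'_def)
    also have "\<dots> = sw A C (app \<gamma> d) (\<lambda>x y. sw C C (app \<Delta>C y) (\<lambda>y1 y2. ten H H (tAC (b1 \<star> x) y1) (b2 \<rhd> app \<gamma> y2)))"
    proof (rule sw_cong[OF refl refl refl])
      fix x y assume [simp]: "x \<in> pts A" "y \<in> pts C"
      define u where "u = b1 \<star> x"
      have [simp]: "u \<in> pts A" by (simp add: u_def)
      define L where "L = (\<lambda>s e. sw C A s (\<lambda>z w. ten H H (tAC u z) (tAC w e)))"
      have "sw C C (app \<Delta>C y) (\<lambda>y1 y2. sw A C (app \<gamma> y1) (\<lambda>x' y'. tscl (app \<epsilon>C y') (\<Xi>' u (b2 \<star> x') y2)))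
         = sw A C (app \<gamma> y) (\<lambda>x' y'. \<Xi>' u (b2 \<star> x') y')"
        by (rule colinear_counit[OF col _ vector_space_tscl, symmetric]) (simp_all add: \<Xi>'_def)
      also have "\<dots> = sw A C (app \<gamma> y) (\<lambda>x' y'. sw C C (app \<Delta>C y') (\<lambda>d e. L (app W (tAC (b2 \<star> x') d)) e))"
        by (simp add: \<Xi>'_def L_def)
      also have "\<dots> = sw C C (app \<Delta>C y) (\<lambda>y1 y2. sw A C (app \<gamma> y1) (\<lambda>x' y'. L (app W (tAC (b2 \<star> x') y')) y2))"
        by (rule colinear[OF col _ vector_space_tscl]) (simp_all add: L_def)
      also have "\<dots> = sw C C (app \<Delta>C y) (\<lambda>y1 y2. L (app W (b2 \<rhd> app \<gamma> y1)) y2)"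
        by (simp add: L_def)
      also have "\<dots> = sw C C (app \<Delta>C y) (\<lambda>r y2. sw C C (app \<Delta>C r) (\<lambda>q1 q2. sw A C (app \<gamma> q2) (\<lambda>x y. tscl (app \<epsilon>C y) (ten H H (tAC u q1) (tAC (b2 \<star> x) y2)))))"
        by (simp add: L_def W1 del: app_sw)
      also have "\<dots> = sw C C (app \<Delta>C y) (\<lambda>q1 r. sw C C (app \<Delta>C r) (\<lambda>q2 y2. sw A C (app \<gamma> q2) (\<lambda>x y. tscl (app \<epsilon>C y) (ten H H (tAC u q1) (tAC (b2 \<star> x) y2)))))"
        by (rule coassoc_C[OF vector_space_tscl]) simp_all
      also have "\<dots> = sw C C (app \<Delta>C y) (\<lambda>q1 r. sw A C (app \<gamma> r) (\<lambda>x y. ten H H (tAC u q1) (tAC (b2 \<star> x) y)))"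
        by (intro sw_cong refl colinear_counit[OF col _ vector_space_tscl, symmetric]) simp_all
      also have "\<dots> = sw C C (app \<Delta>C y) (\<lambda>y1 y2. ten H H (tAC u y1) (b2 \<rhd> app \<gamma> y2))"
        by simp
      finally show "sw C C (app \<Delta>C y) (\<lambda>y1 y2. sw A C (app \<gamma> y1) (\<lambda>x' y'. tscl (app \<epsilon>C y') (\<Xi>' (b1 \<star> x) (b2 \<star> x') y2)))
        = sw C C (app \<Delta>C y) (\<lambda>y1 y2. ten H H (tAC (b1 \<star> x) y1) (b2 \<rhd> app \<gamma> y2))" by (simp only: u_def)
    qed simp_all
    also have "\<dots> = sw C C (app \<Delta>C d) (\<lambda>c1 c2. sw A C (app \<gamma> c1) (\<lambda>x y. ten H H (tAC (b1 \<star> x) y) (b2 \<rhd> app \<gamma> c2)))"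
      by (rule colinear[OF col _ vector_space_tscl]) simp_all
    also have "\<dots> = sw C C (app \<Delta>C d) (\<lambda>c1 c2. ten H H (b1 \<rhd> app \<gamma> c1) (b2 \<rhd> app \<gamma> c2))"
      by (simp del: ten_sw_right)
    finally show "sw C C (app \<Delta>C d) (\<lambda>d1 d2. sw A C (app \<gamma> d1) (\<lambda>x y. sw A C (app \<gamma> y) (\<lambda>x' y'. tscl (app \<epsilon>C y') (\<Xi>' (b1 \<star> x) (b2 \<star> x') d2))))
      = sw C C (app \<Delta>C d) (\<lambda>c1 c2. ten H H (b1 \<rhd> app \<gamma> c1) (b2 \<rhd> app \<gamma> c2))" .
  qed simp_all
  also have "\<dots> = app (extA \<gamma> \<otimes>\<^sub>m extA \<gamma>)
    (sw A A (app \<Delta>A b) (\<lambda>a1 a2. sw C C (app \<Delta>C d) (\<lambda>c1 c2. ten H H (tAC a1 c1) (tAC a2 c2))))"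
    by (simp add: extA_ten)
  finally show ?thesis .
qed

end

section \<open>The conditions on the two maps\<close>

context bialg_coalg begin

lemma counit_extA_iff:
  assumes "arr_to_H g"
  shows "ceps (cocross W0 \<rho>0) \<odot> extA g = ceps (cocross W1 \<rho>1) \<longleftrightarrow> (\<forall>c\<in>pts C. sw A C (app g c) (\<lambda>p q. app \<epsilon>A p * app \<epsilon>C q) = app \<epsilon>C c)"
proof -
  note [simp] = assms arr_to_HD[OF assms] ceps_arr ceps_ten
  have 1: "app (ceps (cocross W0 \<rho>0) \<odot> extA g) (tAC a c) = app \<epsilon>A a * sw A C (app g c) (\<lambda>p q. app \<epsilon>A p * app \<epsilon>C q)" if "a \<in> pts A" "c \<in> pts C" for a c
    using that by (simp add: extA_ten mult.assoc)
  show ?thesis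
  proof
    assume L: "ceps (cocross W0 \<rho>0) \<odot> extA g = ceps (cocross W1 \<rho>1)"
    show "\<forall>c\<in>pts C. sw A C (app g c) (\<lambda>p q. app \<epsilon>A p * app \<epsilon>C q) = app \<epsilon>C c"
    proof
      fix c assume c: "c \<in> pts C"
      from 1[OF oneA c] c show "sw A C (app g c) (\<lambda>p q. app \<epsilon>A p * app \<epsilon>C q) = app \<epsilon>C c"
        unfolding L by simp
    qed
  next
    assume R: "\<forall>c\<in>pts C. sw A C (app g c) (\<lambda>p q. app \<epsilon>A p * app \<epsilon>C q) = app \<epsilon>C c"
    show "ceps (cocross W0 \<rho>0) \<odot> extA g = ceps (cocross W1 \<rho>1)"
      by (rule tens_arr_eqI[of _ _ A C]) (use R 1 in \<open>simp_all del: comp_app\<close>)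
  qed
qed

lemma coact_extA_iff:
  assumes "arr_to_H g"
  defines "co \<equiv> right_coact A \<lparr>cspc = C, cdel = \<Delta>C, ceps = \<epsilon>C\<rparr>"
  shows "(extA g \<otimes>\<^sub>m idl C) \<odot> co = co \<odot> extA g \<longleftrightarrow> colinear g"
proof -
  note [simp] = assms(1) arr_to_HD[OF assms(1)]
  have co: "arr co" "src co = H" "tgt co = H \<otimes>\<^sub>s C" by (simp_all add: co_def right_coact_def)
  have L: "app ((extA g \<otimes>\<^sub>m idl C) \<odot> co) (tAC a c) = sw C C (app \<Delta>C c) (\<lambda>c1 c2. sw A C (app g c1) (\<lambda>p q. ten H C (tAC (a \<star> p) q) c2))"
    if "a \<in> pts A" "c \<in> pts C" for a c using that
    by (simp add: co_def right_coact_def asi_app extA_ten)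
  have R: "app (co \<odot> extA g) (tAC a c) = sw A C (app g c) (\<lambda>p q. sw C C (app \<Delta>C q) (\<lambda>q1 q2. ten H C (tAC (a \<star> p) q1) q2))"
    if "a \<in> pts A" "c \<in> pts C" for a c using that
    by (simp add: co_def right_coact_def asi_app extA_ten)
  show ?thesis
  proof
    assume E: "(extA g \<otimes>\<^sub>m idl C) \<odot> co = co \<odot> extA g"
    show "colinear g" unfolding colinear_def
    proof
      fix c assume c: "c \<in> pts C"
      have "app (asc A C C) (app ((extA g \<otimes>\<^sub>m idl C) \<odot> co) (tAC oneA c)) = app (asc A C C) (app (co \<odot> extA g) (tAC oneA c))" unfolding E ..
      then show "sw A C (app g c) (\<lambda>p q. sw C C (app \<Delta>C q) (\<lambda>q1 q2. ten A (C \<otimes>\<^sub>s C) p (ten C C q1 q2)))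
         = sw C C (app \<Delta>C c) (\<lambda>c1 c2. sw A C (app g c1) (\<lambda>p q. ten A (C \<otimes>\<^sub>s C) p (ten C C q c2)))"
        using c by (simp only: L R oneA) (simp add: asc_app)
    qed
  next
    assume col: "colinear g"
    show "(extA g \<otimes>\<^sub>m idl C) \<odot> co = co \<odot> extA g"
    proof (rule tens_arr_eqI[of _ _ A C])
      fix a c assume ac: "a \<in> pts A" "c \<in> pts C"
      show "app ((extA g \<otimes>\<^sub>m idl C) \<odot> co) (tAC a c) = app (co \<odot> extA g) (tAC a c)"
        unfolding L[OF ac] R[OF ac] by (rule colinear[OF col _ vector_space_tscl, symmetric]) (use ac in simp_all)
    qed (simp_all add: co)
  qed
qed

lemma left_act_extA:
  fixes M' defines "M' \<equiv> \<lparr>aspc = A, amul = \<mu>, aone = oneA\<rparr>"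
  assumes "arr_to_H g"
  shows "extA g \<odot> left_act M' C = left_act M' C \<odot> (idl A \<otimes>\<^sub>m extA g)"
proof -
  note [simp] = assms(2) arr_to_HD[OF assms(2)]
  have l: "arr (left_act M' C)" "src (left_act M' C) = A \<otimes>\<^sub>s H" "tgt (left_act M' C) = H"
    by (simp_all add: M'_def left_act_def)
  show ?thesis
  proof (rule tens_arr_eqI[of _ _ A H])
    fix a x assume ac: "a \<in> pts A" "x \<in> pts H"
    have "app (left_act M' C) (ten A H a y) = a \<rhd> y" if "y \<in> pts H" for y
      using that ac by (simp add: M'_def left_act_def asi_app tmap_app)
    then show "app (extA g \<odot> left_act M' C) (ten A H a x) = app (left_act M' C \<odot> (idl A \<otimes>\<^sub>m extA g)) (ten A H a x)"
      using ac by (simp add: l extA_act del: app_sw)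
  qed (simp_all add: l)
qed

lemma left_act_linearD:
  fixes M' defines "M' \<equiv> \<lparr>aspc = A, amul = \<mu>, aone = oneA\<rparr>"
  assumes "arr f" "src f = H" "tgt f = H"
   "f \<odot> left_act M' C = left_act M' C \<odot> (idl A \<otimes>\<^sub>m f)" "a \<in> pts A" "x \<in> pts H"
  shows "app f (a \<rhd> x) = a \<rhd> app f x"
proof -
  note [simp] = assms(2-4,6,7)
  have l: "arr (left_act M' C)" "src (left_act M' C) = A \<otimes>\<^sub>s H" "tgt (left_act M' C) = H"
    by (simp_all add: M'_def left_act_def)
  have "app (left_act M' C) (ten A H a y) = a \<rhd> y" if "y \<in> pts H" for y
    using that by (simp add: M'_def left_act_def asi_app tmap_app)
  then show ?thesis
    using arg_cong[OF assms(5), of "\<lambda>h. app h (ten A H a x)"] by (simp add: l del: app_sw)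
qed

text \<open>
  Since \<open>\<Delta>\<^sub>A\<close> is multiplicative, the right-hand side of (viii) depends on \<open>a\<close> and \<open>\<theta>(c) = p \<otimes> q\<close> only through \<open>a p \<otimes> q\<close>,
  as required for lemma \<open>eval_at_inverse\<close>.
\<close>

lemma viii_regroup:
  assumes "arr_to_H \<theta>" "arr_to_H \<gamma>" "a \<in> pts A" "c \<in> pts C"
  shows "sw A A (app \<Delta>A a) (\<lambda>a1 a2. sw A C (app \<theta> c) (\<lambda>p q. sw A A (app \<Delta>A p) (\<lambda>p1 p2.
           sw A C (app \<gamma> q) (\<lambda>x y. sw A C (app \<gamma> y) (\<lambda>x' y'.
             scl (A \<otimes>\<^sub>s A) (app \<epsilon>C y') (ten A A ((a1 \<star> p1) \<star> x) ((a2 \<star> p2) \<star> x')))))))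
    = sw A C (app \<theta> c) (\<lambda>p q.
      sw A A (app \<Delta>A (a \<star> p)) (\<lambda>b1 b2. sw A C (app \<gamma> q) (\<lambda>x y. sw A C (app \<gamma> y) (\<lambda>x' y'.
             tscl (app \<epsilon>C y') (ten A A (b1 \<star> x) (b2 \<star> x'))))))"
proof -
  note [simp] = assms arr_to_HD[OF assms(1)] arr_to_HD[OF assms(2)]
  show ?thesis by (subst sw_swap) (simp add: \<Delta>A_mul)
qed

end

context crossed begin

lemma R_conjugate_iff:
  assumes "arr_to_H \<theta>" "arr_to_H \<gamma>" "arr X" "src X = C \<otimes>\<^sub>s A" "tgt X = H"
  shows "X = ((\<mu> \<odot> (idl A \<otimes>\<^sub>m \<mu>)) \<otimes>\<^sub>m idl C) \<odot> asi A (A \<otimes>\<^sub>s A) C \<odot> (idl A \<otimes>\<^sub>m asi A A C)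
             \<odot> (idl A \<otimes>\<^sub>m idl A \<otimes>\<^sub>m \<gamma>) \<odot> (idl A \<otimes>\<^sub>m R) \<odot> asc A C A \<odot> (\<theta> \<otimes>\<^sub>m idl A)
    \<longleftrightarrow> (\<forall>c\<in>pts C. \<forall>a\<in>pts A. app X (ten C A c a) = app (extA \<gamma>) (app \<theta> c \<Zcat> tAC a oneC))" (is "X = ?Y \<longleftrightarrow> _")
proof
  assume "X = ?Y"
  then show "(\<forall>c\<in>pts C. \<forall>a\<in>pts A. app X (ten C A c a) = app (extA \<gamma>) (app \<theta> c \<Zcat> tAC a oneC))"
    by (intro ballI) (simp only: R_conjugate_ten[OF assms(1,2)])
next
  assume "(\<forall>c\<in>pts C. \<forall>a\<in>pts A. app X (ten C A c a) = app (extA \<gamma>) (app \<theta> c \<Zcat> tAC a oneC))"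
  then show "X = ?Y"
    by (intro tens_arr_eqI[of _ _ C A]) (simp_all add: assms R_conjugate_ten[OF assms(1,2)] arr_to_HD[OF assms(1)] arr_to_HD[OF assms(2)] del: comp_app)
qed

lemma sigma_conjugate_iff:
  assumes "arr_to_H \<theta>" "arr_to_H \<gamma>" "arr X" "src X = C \<otimes>\<^sub>s C" "tgt X = H"
  shows "X = (\<mu> \<otimes>\<^sub>m idl C) \<odot> asi A A C \<odot> (idl A \<otimes>\<^sub>m \<gamma>)
             \<odot> ((\<mu> \<odot> (idl A \<otimes>\<^sub>m \<mu>)) \<otimes>\<^sub>m idl C) \<odot> asi A (A \<otimes>\<^sub>s A) C \<odot> (idl A \<otimes>\<^sub>m asi A A C)
             \<odot> (idl A \<otimes>\<^sub>m idl A \<otimes>\<^sub>m \<sigma>) \<odot> (idl A \<otimes>\<^sub>m asc A C C)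
             \<odot> (idl A \<otimes>\<^sub>m R \<otimes>\<^sub>m idl C) \<odot> (idl A \<otimes>\<^sub>m asi C A C) \<odot> asc A C (A \<otimes>\<^sub>s C)
             \<odot> (\<theta> \<otimes>\<^sub>m \<theta>)
    \<longleftrightarrow> (\<forall>c\<in>pts C. \<forall>d\<in>pts C. app X (ten C C c d) = app (extA \<gamma>) (app \<theta> c \<Zcat> app \<theta> d))" (is "X = ?Y \<longleftrightarrow> _")
proof
  assume "X = ?Y"
  then show "(\<forall>c\<in>pts C. \<forall>d\<in>pts C. app X (ten C C c d) = app (extA \<gamma>) (app \<theta> c \<Zcat> app \<theta> d))"
    by (intro ballI) (simp only: sigma_conjugate_ten[OF assms(1,2)])
next
  assume "(\<forall>c\<in>pts C. \<forall>d\<in>pts C. app X (ten C C c d) = app (extA \<gamma>) (app \<theta> c \<Zcat> app \<theta> d))"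
  then show "X = ?Y"
    by (intro tens_arr_eqI[of _ _ C C]) (simp_all add: assms sigma_conjugate_ten[OF assms(1,2)] arr_to_HD[OF assms(1)] arr_to_HD[OF assms(2)] del: comp_app)
qed

end

context two_crossed begin

abbreviation "Alg \<equiv> \<lparr>aspc = A, amul = \<mu>, aone = oneA\<rparr>"

abbreviation "Coalg \<equiv> \<lparr>cspc = C, cdel = \<Delta>C, ceps = \<epsilon>C\<rparr>"

lemma vi_iff:
  assumes "arr_to_H \<gamma>"
  shows "(\<mu> \<otimes>\<^sub>m idl C) \<odot> asi A A C \<odot> (\<mu> \<otimes>\<^sub>m \<sigma>') \<odot> asi A A (C \<otimes>\<^sub>s C) \<odot> (idl A \<otimes>\<^sub>m asc A C C)
          \<odot> (idl A \<otimes>\<^sub>m \<gamma> \<otimes>\<^sub>m idl C) \<odot> asc A C C \<odot> (R \<otimes>\<^sub>m idl C) \<odot> asi C A C \<odot> (idl C \<otimes>\<^sub>m \<gamma>)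
        = (\<mu> \<otimes>\<^sub>m idl C) \<odot> asi A A C \<odot> (idl A \<otimes>\<^sub>m \<gamma>) \<odot> \<sigma> \<longleftrightarrow>
    (\<forall>c\<in>pts C. \<forall>d\<in>pts C. sw A C (app \<gamma> d) (\<lambda>x y. app (extA \<gamma>) (app R (ten C A c x)) \<Zcat>' tAC oneA y)
      = app (extA \<gamma>) (app \<sigma> (ten C C c d)))" (is "?L = ?R \<longleftrightarrow> ?P")
proof -
  note [simp] = assms arr_to_HD[OF assms]
  have arrs: "arr ?L" "src ?L = C \<otimes>\<^sub>s C" "tgt ?L = H" "arr ?R" "src ?R = C \<otimes>\<^sub>s C" "tgt ?R = H" by simp_all
  have R: "app ?R (ten C C c d) = app (extA \<gamma>) (app \<sigma> (ten C C c d))" if "c \<in> pts C" "d \<in> pts C" for c d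
    using that by (simp add: asi_app tmap_app extA_app)
  show ?thesis
  proof
    assume e: "?L = ?R"
    show ?P
    proof (intro ballI)
      fix c d assume cd: "c \<in> pts C" "d \<in> pts C"
      show "sw A C (app \<gamma> d) (\<lambda>x y. app (extA \<gamma>) (app R (ten C A c x)) \<Zcat>' tAC oneA y)
        = app (extA \<gamma>) (app \<sigma> (ten C C c d))"
        unfolding R[OF cd, symmetric] vi_left_ten[OF assms cd, symmetric] e ..
    qed
  next
    assume ?P
    then show "?L = ?R"
      by (intro tens_arr_eqI[OF arrs(1,4,2,5)]) (simp_all add: arrs(3,6) R vi_left_ten[OF assms] del: comp_app)
  qed
qed

lemma alg_map_arr:
  assumes "arr f" "src f = H" "tgt f = H"
  shows "alg_map (crossed_product_alg Alg C oneC R' \<sigma>') (crossed_product_alg Alg C oneC R \<sigma>) f \<longleftrightarrow>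
    app f (tAC oneA oneC) = tAC oneA oneC \<and> (\<forall>x\<in>pts H. \<forall>y\<in>pts H. app f (x \<Zcat>' y) = app f x \<Zcat> app f y)"
proof -
  note [simp] = assms
  have 1: "aspc (crossed_product_alg Alg C oneC R \<sigma>) = H" "aspc (crossed_product_alg Alg C oneC R' \<sigma>') = H"
    "aone (crossed_product_alg Alg C oneC R \<sigma>) = tAC oneA oneC" "aone (crossed_product_alg Alg C oneC R' \<sigma>') = tAC oneA oneC"
    by (simp_all add: crossed_product_alg_def Let_def)
  have "f \<odot> P.M = M \<odot> (f \<otimes>\<^sub>m f) \<longleftrightarrow> (\<forall>x\<in>pts H. \<forall>y\<in>pts H. app f (x \<Zcat>' y) = app f x \<Zcat> app f y)" (is "?L = ?R \<longleftrightarrow> ?P")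
  proof
    assume e: "?L = ?R"
    show ?P
    proof (intro ballI)
      fix x y assume "x \<in> pts H" "y \<in> pts H"
      then show "app f (x \<Zcat>' y) = app f x \<Zcat> app f y"
        using arg_cong[OF e, of "\<lambda>f. app f (ten H H x y)"] by simp
    qed
  next
    assume ?P
    then show "?L = ?R" by (intro tens_arr_eqI[of _ _ H H]) simp_all
  qed
  then show ?thesis by (simp add: alg_map_def 1 arr_Hom)
qed

lemma coalg_map_arr:
  assumes "arr f" "src f = H" "tgt f = H" "cross_arrows W \<rho>" "cross_arrows W0 \<rho>0"
  shows "coalg_map (cocross W \<rho>) (cocross W0 \<rho>0) f \<longleftrightarrow>
    (\<forall>t\<in>pts H. app (f \<otimes>\<^sub>m f) (app (cdel (cocross W \<rho>)) t) = app (cdel (cocross W0 \<rho>0)) (app f t)) \<and> ceps (cocross W0 \<rho>0) \<odot> f = ceps (cocross W \<rho>)"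
proof -
  note [simp] = assms cdel_arr
  have "(f \<otimes>\<^sub>m f) \<odot> cdel (cocross W \<rho>) = cdel (cocross W0 \<rho>0) \<odot> f \<longleftrightarrow> (\<forall>t\<in>pts H. app (f \<otimes>\<^sub>m f) (app (cdel (cocross W \<rho>)) t) = app (cdel (cocross W0 \<rho>0)) (app f t))"
    (is "?L = ?R \<longleftrightarrow> ?P")
  proof
    assume e: "?L = ?R"
    show ?P
    proof (intro ballI)
      fix t assume "t \<in> pts H"
      then show "app (f \<otimes>\<^sub>m f) (app (cdel (cocross W \<rho>)) t) = app (cdel (cocross W0 \<rho>0)) (app f t)"
        using arg_cong[OF e, of "\<lambda>f. app f t"] by simp
    qed
  next
    assume ?P
    then show "?L = ?R" by (intro arr_eqI) simp_all
  qed
  then show ?thesis by (simp add: coalg_map_def cspc_cocross arr_Hom)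
qed

text \<open>
  The properties of an equivalence \<open>\<phi> = extA \<theta>\<close> with inverse \<open>extA \<gamma>\<close>, elementwise. They constrain the inverse only
  through \<open>\<gamma>\<close> being inverse to \<open>\<theta>\<close>; that \<open>\<phi>\<inverse>\<close> is again multiplicative, colinear and counital is derived from
  this.
\<close>

definition equiv_data where
  "equiv_data \<theta> \<gamma> W' \<rho>' W0 \<rho>0 \<longleftrightarrow> arr_to_H \<theta> \<and> arr_to_H \<gamma> \<and>
    (\<forall>c\<in>pts C. app (extA \<gamma>) (app \<theta> c) = tAC oneA c) \<and>
    (\<forall>c\<in>pts C. app (extA \<theta>) (app \<gamma> c) = tAC oneA c) \<and>
    app \<theta> oneC = tAC oneA oneC \<and>
    (\<forall>x\<in>pts H. \<forall>y\<in>pts H. app (extA \<theta>) (x \<Zcat>' y) = app (extA \<theta>) x \<Zcat> app (extA \<theta>) y) \<and>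
    (\<forall>t\<in>pts H. app (extA \<theta> \<otimes>\<^sub>m extA \<theta>) (app (cdel (cocross W' \<rho>')) t) = app (cdel (cocross W0 \<rho>0)) (app (extA \<theta>) t)) \<and>
    (\<forall>c\<in>pts C. sw A C (app \<theta> c) (\<lambda>p q. app \<epsilon>A p * app \<epsilon>C q) = app \<epsilon>C c) \<and> colinear \<theta>"

text \<open>
  An equivalence \<open>\<phi>\<close> commutes with the action of \<open>A\<close>, so it is \<open>extA\<close> of its restriction to \<open>1 \<otimes> C\<close>, and so is
  its inverse.
\<close>

lemma equivalent_iff:
  assumes "cross_arrows W0 \<rho>0" "cross_arrows W' \<rho>'"
  shows "equivalent_cpb Alg \<epsilon>A Coalg oneC W0 \<rho>0 R \<sigma> W' \<rho>' R' \<sigma>' \<longleftrightarrow> (\<exists>\<theta> \<gamma>. equiv_data \<theta> \<gamma> W' \<rho>' W0 \<rho>0)"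
    (is "?L \<longleftrightarrow> ?R")
proof
  assume ?L
  then obtain \<phi> where "\<phi> \<in> Hom H H" and bij: "bij_betw (app \<phi>) (pts H) (pts H)"
    and am: "alg_map (crossed_product_alg Alg C oneC R' \<sigma>') (crossed_product_alg Alg C oneC R \<sigma>) \<phi>"
    and cm: "coalg_map (cocross W' \<rho>') (cocross W0 \<rho>0) \<phi>"
    and la: "\<phi> \<odot> left_act Alg C = left_act Alg C \<odot> (idl A \<otimes>\<^sub>m \<phi>)"
    and rc: "(\<phi> \<otimes>\<^sub>m idl C) \<odot> right_coact A Coalg = right_coact A Coalg \<odot> \<phi>"
    by (auto simp: equivalent_cpb_def Let_def)
  then have \<phi> [simp]: "arr \<phi>" "src \<phi> = H" "tgt \<phi> = H" by (simp_all add: arr_Hom)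
  define \<psi> where "\<psi> = arrow H H (inv_into (pts H) (app \<phi>))"
  have inv1: "app \<phi> (inv_into (pts H) (app \<phi>) x) = x" and inv2: "inv_into (pts H) (app \<phi>) (app \<phi> x) = x"
    and inv3: "inv_into (pts H) (app \<phi>) x \<in> pts H" if "x \<in> pts H" for x
    using bij that by (simp_all add: bij_betw_inv_into_right bij_betw_inv_into_left bij_betw_apply[OF bij_betw_inv_into])
  have inj: "x = y" if "app \<phi> x = app \<phi> y" "x \<in> pts H" "y \<in> pts H" for x y
    using inv2 that by metis
  have \<phi>l: "lin H tscl (app \<phi>)" using lin_app_id[of \<phi> tscl] by simp
  have \<psi> [simp]: "arr \<psi>" "src \<psi> = H" "tgt \<psi> = H"
  proof -
    have "lin H tscl (inv_into (pts H) (app \<phi>))"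
    proof (rule linI)
      fix x y assume xy: "x \<in> pts H" "y \<in> pts H"
      show "inv_into (pts H) (app \<phi>) (x + y) = inv_into (pts H) (app \<phi>) x + inv_into (pts H) (app \<phi>) y"
        by (rule inj) (use \<phi>l xy in \<open>simp_all add: inv1 inv3 lin_def\<close>)
    next
      fix r x assume xy: "x \<in> pts H"
      show "inv_into (pts H) (app \<phi>) (scl H r x) = tscl r (inv_into (pts H) (app \<phi>) x)"
        by (rule inj) (use \<phi>l xy in \<open>simp_all add: inv1 inv3 lin_def\<close>)
    qed
    then show "arr \<psi>" unfolding \<psi>_def by (intro arr_arrow) (simp_all add: inv3)
  qed (simp_all add: \<psi>_def arrow_def)
  have \<phi>\<psi>: "app \<phi> (app \<psi> x) = x" and \<psi>\<phi>: "app \<psi> (app \<phi> x) = x" if "x \<in> pts H" for x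
    using that by (simp_all add: \<psi>_def arrow_app inv1 inv2)
  define res where "res f = arrow C H (\<lambda>c. app f (tAC oneA c))"
    for f :: "('k, ('k, 'a, 'c) tens, ('k, 'a, 'c) tens) arr"
  have res: "arr_to_H (res f)" "\<And>c. c \<in> pts C \<Longrightarrow> app (res f) c = app f (tAC oneA c)" if "arr f" "src f = H" "tgt f = H" for f
    using that unfolding arr_to_H_def res_def by (auto intro!: arr_arrow simp: arrow_app) (simp_all add: arrow_def)
  have extA_res: "extA (res f) = f" if "arr f" "src f = H" "tgt f = H" "\<And>a x. a \<in> pts A \<Longrightarrow> x \<in> pts H \<Longrightarrow> app f (a \<rhd> x) = a \<rhd> app f x" for f
  proof (rule tens_arr_eqI[of _ _ A C])
    fix a c assume "a \<in> pts A" "c \<in> pts C"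
    then show "app (extA (res f)) (tAC a c) = app f (tAC a c)"
      using that(4)[of a "tAC oneA c"] by (simp add: extA_ten res that(1-3))
  qed (use that in \<open>simp_all add: res\<close>)
  have \<phi>a: "app \<phi> (a \<rhd> x) = a \<rhd> app \<phi> x" if "a \<in> pts A" "x \<in> pts H" for a x
    by (rule left_act_linearD[OF \<phi> la that])
  have \<psi>a: "app \<psi> (a \<rhd> x) = a \<rhd> app \<psi> x" if "a \<in> pts A" "x \<in> pts H" for a x
  proof (rule inj)
    show "app \<phi> (app \<psi> (a \<rhd> x)) = app \<phi> (a \<rhd> app \<psi> x)"
      using that by (simp only: \<phi>a \<phi>\<psi> app_in \<psi> sw_in vspace_AC vspace_tensor ten_in str_arrs)
  qed (use that in simp_all)
  let ?t = "res \<phi>" and ?g = "res \<psi>"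
  have e: "extA ?t = \<phi>" "extA ?g = \<psi>" by (intro extA_res \<phi> \<psi> \<phi>a \<psi>a; assumption)+
  have "equiv_data ?t ?g W' \<rho>' W0 \<rho>0"
    unfolding equiv_data_def e
  proof (intro conjI)
    show c: "arr_to_H ?t" "arr_to_H ?g" by (simp_all add: res)
    show "\<forall>c\<in>pts C. app \<psi> (app ?t c) = tAC oneA c" "\<forall>c\<in>pts C. app \<phi> (app ?g c) = tAC oneA c"
      by (simp_all add: res \<phi>\<psi> \<psi>\<phi>)
    show "app ?t oneC = tAC oneA oneC" "\<forall>x\<in>pts H. \<forall>y\<in>pts H. app \<phi> (x \<Zcat>' y) = app \<phi> x \<Zcat> app \<phi> y"
      using am unfolding alg_map_arr[OF \<phi>] by (simp_all add: res)
    show "\<forall>t\<in>pts H. app (\<phi> \<otimes>\<^sub>m \<phi>) (app (cdel (cocross W' \<rho>')) t) = app (cdel (cocross W0 \<rho>0)) (app \<phi> t)"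
      using cm unfolding coalg_map_arr[OF \<phi> assms(2,1)] by blast
    show "\<forall>c\<in>pts C. sw A C (app ?t c) (\<lambda>p q. app \<epsilon>A p * app \<epsilon>C q) = app \<epsilon>C c"
      using cm counit_extA_iff[OF c(1), unfolded e] unfolding coalg_map_arr[OF \<phi> assms(2,1)] by blast
    show "colinear ?t" using rc coact_extA_iff[OF c(1), unfolded e] by blast
  qed
  then show ?R by blast
next
  assume ?R
  then obtain \<theta> \<gamma> where E: "equiv_data \<theta> \<gamma> W' \<rho>' W0 \<rho>0" by blast
  then have c: "arr_to_H \<theta>" "arr_to_H \<gamma>" by (simp_all add: equiv_data_def)
  have inv1: "app (extA \<theta>) (app (extA \<gamma>) x) = x" if "x \<in> pts H" for x
    using E that by (intro extA_inverse[OF c(1,2)]) (simp_all add: equiv_data_def)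
  have inv2: "app (extA \<gamma>) (app (extA \<theta>) x) = x" if "x \<in> pts H" for x
    using E that by (intro extA_inverse[OF c(2,1)]) (simp_all add: equiv_data_def)
  note t = arr_extA(1)[OF c(1)] arr_extA(2,3)[of \<theta>]
  show ?L unfolding equivalent_cpb_def Let_def alg.simps coalg.simps
  proof (intro bexI conjI)
    show "extA \<theta> \<in> Hom H H" using t by (simp add: arr_Hom)
    show "bij_betw (app (extA \<theta>)) (pts H) (pts H)"
      by (rule bij_betw_byWitness[where f'="app (extA \<gamma>)"]) (use c in \<open>auto simp: inv1 inv2\<close>)
    show "alg_map (crossed_product_alg Alg C oneC R' \<sigma>') (crossed_product_alg Alg C oneC R \<sigma>) (extA \<theta>)"
      unfolding alg_map_arr[OF t] using E c by (simp add: equiv_data_def extA_ten)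
    show "coalg_map (cocross W' \<rho>') (cocross W0 \<rho>0) (extA \<theta>)"
      unfolding coalg_map_arr[OF t assms(2,1)] counit_extA_iff[OF c(1)] using E unfolding equiv_data_def by blast
    show "extA \<theta> \<odot> left_act Alg C = left_act Alg C \<odot> (idl A \<otimes>\<^sub>m extA \<theta>)" by (rule left_act_extA[OF c(1)])
    show "(extA \<theta> \<otimes>\<^sub>m idl C) \<odot> right_coact A Coalg = right_coact A Coalg \<odot> extA \<theta>"
      unfolding coact_extA_iff[OF c(1)] using E by (simp add: equiv_data_def)
  qed
qed

end

context two_crossed begin

lemma inverse_colinear:
  assumes c: "arr_to_H \<theta>" "arr_to_H \<gamma>" and inv: "\<And>x. x \<in> pts H \<Longrightarrow> app (extA \<theta>) (app (extA \<gamma>) x) = x"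
    "\<And>x. x \<in> pts H \<Longrightarrow> app (extA \<gamma>) (app (extA \<theta>) x) = x" and col: "colinear \<theta>"
  shows "colinear \<gamma>"
proof -
  define co where "co = right_coact A Coalg"
  have co [simp]: "arr co" "src co = H" "tgt co = H \<otimes>\<^sub>s C" by (simp_all add: co_def right_coact_def)
  have e: "(extA \<theta> \<otimes>\<^sub>m idl C) \<odot> co = co \<odot> extA \<theta>"
    unfolding co_def coact_extA_iff[OF c(1)] by (rule col)
  have "(extA \<gamma> \<otimes>\<^sub>m idl C) \<odot> co = co \<odot> extA \<gamma>"
  proof (rule arr_eqI)
    fix t assume "t \<in> pts (src (co \<odot> extA \<gamma>))"
    then have t: "t \<in> pts H" by simp
    have "app (co \<odot> extA \<theta>) (app (extA \<gamma>) t) = app (extA \<theta> \<otimes>\<^sub>m idl C) (app co (app (extA \<gamma>) t))"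
      unfolding e[symmetric] using t c by simp
    then have "app co t = app (extA \<theta> \<otimes>\<^sub>m idl C) (app co (app (extA \<gamma>) t))"
      using t c by (simp add: inv)
    then show "app ((extA \<gamma> \<otimes>\<^sub>m idl C) \<odot> co) t = app (co \<odot> extA \<gamma>) t"
      using t c tmap_inverse[of "extA \<gamma>" "extA \<theta>" H H "idl C" "idl C" C C "app co (app (extA \<gamma>) t)"] by (simp add: inv)
  qed (use c in simp_all)
  then show ?thesis unfolding co_def coact_extA_iff[OF c(2)] .
qed

lemma inverse_counit:
  assumes c: "arr_to_H \<theta>" "arr_to_H \<gamma>" and inv: "\<And>x. x \<in> pts H \<Longrightarrow> app (extA \<theta>) (app (extA \<gamma>) x) = x"
    and e: "\<forall>c\<in>pts C. sw A C (app \<theta> c) (\<lambda>p q. app \<epsilon>A p * app \<epsilon>C q) = app \<epsilon>C c"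
  shows "\<forall>c\<in>pts C. sw A C (app \<gamma> c) (\<lambda>p q. app \<epsilon>A p * app \<epsilon>C q) = app \<epsilon>C c"
proof -
  fix W \<rho>
  let ?e = "ceps (cocross W \<rho>)"
  note [simp] = ceps_arr
  have 1: "?e \<odot> extA \<theta> = ?e" unfolding counit_extA_iff[OF c(1)] by (rule e)
  have "?e \<odot> extA \<gamma> = ?e"
  proof (rule arr_eqI)
    fix t assume "t \<in> pts (src ?e)"
    then have t: "t \<in> pts H" by simp
    have "app (?e \<odot> extA \<gamma>) t = app (?e \<odot> extA \<theta>) (app (extA \<gamma>) t)" unfolding 1 using t by simp
    also have "\<dots> = app ?e t" using t c by (simp add: inv)
    finally show "app (?e \<odot> extA \<gamma>) t = app ?e t" .
  qed (use c in simp_all)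
  then show ?thesis unfolding counit_extA_iff[OF c(2)] .
qed

text \<open>
  For fixed \<open>\<theta>\<close> and \<open>\<gamma>\<close>, the algebra half of this equivalence has been reduced above to products of special
  elements; what remains is the coalgebra half. From an equivalence, (vii) and (viii) are the counit projections of
  \<open>\<Delta>' = (\<phi>\<inverse> \<otimes> \<phi>\<inverse>) \<circ> \<Delta>\<^sub>0 \<circ> \<phi>\<close>. Conversely, (vii) and (viii) determine \<open>\<Delta>'\<close>, and lemma \<open>cdel_at_inverse\<close> identifies it with
  this transported coproduct.
\<close>

lemma equiv_data_iff_conditions:
  assumes c: "arr_to_H \<theta>" "arr_to_H \<gamma>" and W0: "cross_arrows W0 \<rho>0" "\<forall>a\<in>pts A. \<forall>c\<in>pts C. app W0 (ten A C a c) = ten C A c a"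
   "\<forall>a\<in>pts A. \<forall>c\<in>pts C. app \<rho>0 (ten A C a c) = sw A A (app \<Delta>A a) (\<lambda>a1 a2. ten A A a1 (scl A (app \<epsilon>C c) a2))"
   and W': "crossed_coproduct A \<epsilon>A Coalg W' \<rho>'"
  shows "equiv_data \<theta> \<gamma> W' \<rho>' W0 \<rho>0 \<longleftrightarrow> (
      R' = ((\<mu> \<odot> (idl A \<otimes>\<^sub>m \<mu>)) \<otimes>\<^sub>m idl C) \<odot> asi A (A \<otimes>\<^sub>s A) C \<odot> (idl A \<otimes>\<^sub>m asi A A C)
             \<odot> (idl A \<otimes>\<^sub>m idl A \<otimes>\<^sub>m \<gamma>) \<odot> (idl A \<otimes>\<^sub>m R) \<odot> asc A C A \<odot> (\<theta> \<otimes>\<^sub>m idl A) \<and>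
      \<sigma>' = (\<mu> \<otimes>\<^sub>m idl C) \<odot> asi A A C \<odot> (idl A \<otimes>\<^sub>m \<gamma>)
             \<odot> ((\<mu> \<odot> (idl A \<otimes>\<^sub>m \<mu>)) \<otimes>\<^sub>m idl C) \<odot> asi A (A \<otimes>\<^sub>s A) C \<odot> (idl A \<otimes>\<^sub>m asi A A C)
             \<odot> (idl A \<otimes>\<^sub>m idl A \<otimes>\<^sub>m \<sigma>) \<odot> (idl A \<otimes>\<^sub>m asc A C C)
             \<odot> (idl A \<otimes>\<^sub>m R \<otimes>\<^sub>m idl C) \<odot> (idl A \<otimes>\<^sub>m asi C A C) \<odot> asc A C (A \<otimes>\<^sub>s C)
             \<odot> (\<theta> \<otimes>\<^sub>m \<theta>) \<and>
      app \<theta> oneC = ten A C oneA oneC \<and> app \<gamma> oneC = ten A C oneA oneC \<and>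
      (\<forall>c\<in>pts C. sw A C (app \<theta> c) (\<lambda>p q. sw A C (app \<gamma> q) (\<lambda>x y. ten A C (p \<star> x) y))
         = ten A C oneA c) \<and>
      (\<forall>c\<in>pts C. sw A C (app \<gamma> c) (\<lambda>x y. sw A C (app \<theta> y) (\<lambda>p q. ten A C (x \<star> p) q))
         = ten A C oneA c) \<and>
      (\<mu> \<otimes>\<^sub>m idl C) \<odot> asi A A C \<odot> (\<mu> \<otimes>\<^sub>m \<sigma>') \<odot> asi A A (C \<otimes>\<^sub>s C) \<odot> (idl A \<otimes>\<^sub>m asc A C C)
          \<odot> (idl A \<otimes>\<^sub>m \<gamma> \<otimes>\<^sub>m idl C) \<odot> asc A C C \<odot> (R \<otimes>\<^sub>m idl C) \<odot> asi C A C \<odot> (idl C \<otimes>\<^sub>m \<gamma>)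
        = (\<mu> \<otimes>\<^sub>m idl C) \<odot> asi A A C \<odot> (idl A \<otimes>\<^sub>m \<gamma>) \<odot> \<sigma> \<and>
      (\<forall>a\<in>pts A. \<forall>c\<in>pts C. app W' (ten A C a c) =
         sw A C (app \<theta> c) (\<lambda>p q. sw C C (app \<Delta>C q) (\<lambda>q1 q2.
           sw A C (app \<gamma> q1) (\<lambda>x1 y1. sw A C (app \<gamma> q2) (\<lambda>x2 y2.
             scl (C \<otimes>\<^sub>s A) (app \<epsilon>A x1 * app \<epsilon>C y2) (ten C A y1 ((a \<star> p) \<star> x2))))))) \<and>
      (\<forall>a\<in>pts A. \<forall>c\<in>pts C. app \<rho>' (ten A C a c) =
         sw A A (app \<Delta>A a) (\<lambda>a1 a2. sw A C (app \<theta> c) (\<lambda>p q. sw A A (app \<Delta>A p) (\<lambda>p1 p2.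
           sw A C (app \<gamma> q) (\<lambda>x y. sw A C (app \<gamma> y) (\<lambda>x' y'.
             scl (A \<otimes>\<^sub>s A) (app \<epsilon>C y')
               (ten A A ((a1 \<star> p1) \<star> x) ((a2 \<star> p2) \<star> x')))))))) \<and>
      (\<forall>c\<in>pts C. sw A C (app \<theta> c) (\<lambda>p q. app \<epsilon>A p * app \<epsilon>C q) = app \<epsilon>C c \<and>
         app \<epsilon>C c = sw A C (app \<gamma> c) (\<lambda>x y. app \<epsilon>A x * app \<epsilon>C y)) \<and>
      (\<forall>c\<in>pts C. sw A C (app \<theta> c) (\<lambda>p q. sw C C (app \<Delta>C q) (\<lambda>q1 q2.
           ten A (C \<otimes>\<^sub>s C) p (ten C C q1 q2)))
         = sw C C (app \<Delta>C c) (\<lambda>c1 c2. sw A C (app \<theta> c1) (\<lambda>p q. ten A (C \<otimes>\<^sub>s C) p (ten C C q c2)))) \<and>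
      (\<forall>c\<in>pts C. sw A C (app \<gamma> c) (\<lambda>x y. sw C C (app \<Delta>C y) (\<lambda>y1 y2.
           ten A (C \<otimes>\<^sub>s C) x (ten C C y1 y2)))
         = sw C C (app \<Delta>C c) (\<lambda>c1 c2. sw A C (app \<gamma> c1) (\<lambda>x y. ten A (C \<otimes>\<^sub>s C) x (ten C C y c2)))))" (is "_ \<longleftrightarrow> ?i \<and> ?ii \<and> ?iii \<and> ?iii' \<and> ?iv \<and> ?v \<and> ?vi \<and> ?vii \<and> ?viii \<and> ?ix \<and> ?x \<and> ?xi")
proof -
  note [simp] = c arr_to_HD[OF c(1)] arr_to_HD[OF c(2)]
  note X = crossed_coproduct_counits(1)[OF W']
  let ?D = "cdel (cocross W' \<rho>')" and ?E = "cdel (cocross W0 \<rho>0)"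
  note D = cdel_arr(1)[OF X] cdel_arr(2,3)[of W' \<rho>'] cdel_arr(1)[OF W0(1)] cdel_arr(2,3)[of W0 \<rho>0]
  have iv: "?iv \<longleftrightarrow> (\<forall>c\<in>pts C. app (extA \<gamma>) (app \<theta> c) = tAC oneA c)" by (simp add: extA_app)
  have v: "?v \<longleftrightarrow> (\<forall>c\<in>pts C. app (extA \<theta>) (app \<gamma> c) = tAC oneA c)" by (simp add: extA_app)
  have x: "?x \<longleftrightarrow> colinear \<theta>" and xi: "?xi \<longleftrightarrow> colinear \<gamma>" unfolding colinear_def by (rule refl)+
  have i: "?i \<longleftrightarrow> (\<forall>c\<in>pts C. \<forall>a\<in>pts A. app R' (ten C A c a) = app (extA \<gamma>) (app \<theta> c \<Zcat> tAC a oneC))"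
    by (rule R_conjugate_iff[OF c]) simp_all
  have ii: "?ii \<longleftrightarrow> (\<forall>c\<in>pts C. \<forall>d\<in>pts C. app \<sigma>' (ten C C c d) = app (extA \<gamma>) (app \<theta> c \<Zcat> app \<theta> d))"
    by (rule sigma_conjugate_iff[OF c]) simp_all
  note vi = vi_iff[OF c(2)]
  have viii: "?viii \<longleftrightarrow> (\<forall>a\<in>pts A. \<forall>c\<in>pts C. app \<rho>' (tAC a c) = sw A C (app \<theta> c) (\<lambda>p q.
      sw A A (app \<Delta>A (a \<star> p)) (\<lambda>b1 b2. sw A C (app \<gamma> q) (\<lambda>x y. sw A C (app \<gamma> y) (\<lambda>x' y'.
             tscl (app \<epsilon>C y') (ten A A (b1 \<star> x) (b2 \<star> x')))))))"
    by (intro ball_cong refl) (simp only: viii_regroup[OF c])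
  have vii: "?vii \<longleftrightarrow> (\<forall>a\<in>pts A. \<forall>c\<in>pts C. app W' (tAC a c) = sw A C (app \<theta> c) (\<lambda>p q.
      sw C C (app \<Delta>C q) (\<lambda>q1 q2. sw A C (app \<gamma> q1) (\<lambda>x1 y1. sw A C (app \<gamma> q2) (\<lambda>x2 y2.
             tscl (app \<epsilon>A x1 * app \<epsilon>C y2) (ten C A y1 ((a \<star> p) \<star> x2)))))))"
    by (simp only: scl_tspace)
  show ?thesis
  proof
    assume E: "equiv_data \<theta> \<gamma> W' \<rho>' W0 \<rho>0"
    then have inv: "\<forall>c\<in>pts C. app (extA \<gamma>) (app \<theta> c) = tAC oneA c" "\<forall>c\<in>pts C. app (extA \<theta>) (app \<gamma> c) = tAC oneA c"
      and one: "app \<theta> oneC = tAC oneA oneC"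
      and mult: "\<And>x y. x \<in> pts H \<Longrightarrow> y \<in> pts H \<Longrightarrow> app (extA \<theta>) (x \<Zcat>' y) = app (extA \<theta>) x \<Zcat> app (extA \<theta>) y"
      and comult: "\<And>t. t \<in> pts H \<Longrightarrow> app (extA \<theta> \<otimes>\<^sub>m extA \<theta>) (app ?D t) = app ?E (app (extA \<theta>) t)"
      and eps: "\<forall>c\<in>pts C. sw A C (app \<theta> c) (\<lambda>p q. app \<epsilon>A p * app \<epsilon>C q) = app \<epsilon>C c" and col: "colinear \<theta>"
      unfolding equiv_data_def by blast+
    have inv1: "app (extA \<theta>) (app (extA \<gamma>) x) = x" if "x \<in> pts H" for x
      using inv that by (intro extA_inverse[OF c]) simp_all
    have inv2: "app (extA \<gamma>) (app (extA \<theta>) x) = x" if "x \<in> pts H" for x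
      using inv that by (intro extA_inverse[OF c(2,1)]) simp_all
    have t1: "app (extA \<theta>) (tAC oneA c) = app \<theta> c" if "c \<in> pts C" for c using that by (simp add: extA_ten)
    have tA: "app (extA \<theta>) (tAC a oneC) = tAC a oneC" if "a \<in> pts A" for a using that by (simp add: extA_ten one)
    have I: "app R' (ten C A c a) = app (extA \<gamma>) (app \<theta> c \<Zcat> tAC a oneC)" if "c \<in> pts C" "a \<in> pts A" for a c
    proof -
      have "app R' (ten C A c a) = app (extA \<gamma>) (app (extA \<theta>) (tAC oneA c \<Zcat>' tAC a oneC))"
        using that by (simp add: P.hmul_R inv2)
      then show ?thesis using that by (simp only: mult t1 tA ten_in oneA oneC)
    qed
    have II: "app \<sigma>' (ten C C c d) = app (extA \<gamma>) (app \<theta> c \<Zcat> app \<theta> d)" if "c \<in> pts C" "d \<in> pts C" for c d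
    proof -
      have "app \<sigma>' (ten C C c d) = app (extA \<gamma>) (app (extA \<theta>) (tAC oneA c \<Zcat>' tAC oneA d))"
        using that by (simp add: P.hmul_\<sigma> inv2)
      then show ?thesis using that by (simp only: mult t1 ten_in oneA oneC)
    qed
    have g1: "app \<gamma> oneC = tAC oneA oneC"
    proof -
      have "app (extA \<gamma>) (app \<theta> oneC) = tAC oneA oneC" using inv by simp
      then show ?thesis unfolding one by (simp add: extA_ten)
    qed
    have gm: "app (extA \<gamma>) (x \<Zcat> y) = app (extA \<gamma>) x \<Zcat>' app (extA \<gamma>) y" if "x \<in> pts H" "y \<in> pts H" for x y
    proof -
      have "app (extA \<theta>) (app (extA \<gamma>) x \<Zcat>' app (extA \<gamma>) y) = x \<Zcat> y"
        using that mult[of "app (extA \<gamma>) x" "app (extA \<gamma>) y"] by (simp add: inv1)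
      from arg_cong[OF this, of "app (extA \<gamma>)"] show ?thesis using that by (simp add: inv2)
    qed
    have colg: "colinear \<gamma>" by (rule inverse_colinear[OF c inv1 inv2 col])
    have epsg: "\<forall>c\<in>pts C. sw A C (app \<gamma> c) (\<lambda>p q. app \<epsilon>A p * app \<epsilon>C q) = app \<epsilon>C c"
      by (rule inverse_counit[OF c inv1 eps])
    have DD: "app ?D t = app (extA \<gamma> \<otimes>\<^sub>m extA \<gamma>) (app ?E (app (extA \<theta>) t))" if "t \<in> pts H" for t
      unfolding comult[OF that, symmetric]
      by (rule tmap_inverse[where U=H and V=H and U'=H and V'=H, symmetric]) (use that in \<open>simp_all add: inv2 D\<close>)
    \<comment> \<open>\<open>\<Delta>'(a \<otimes> c)\<close> seen through a linear map \<open>G\<close>, with \<open>\<phi>(a \<otimes> c) = a \<theta>(c)\<close> written as a Sweedler sum\<close>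
    have push: "G (app ?D (tAC a c)) = sw A C (app \<theta> c) (\<lambda>p q. G (app (extA \<gamma> \<otimes>\<^sub>m extA \<gamma>) (app ?E (tAC (a \<star> p) q))))"
      if G: "lin (H \<otimes>\<^sub>s H) tscl G" and ac: "a \<in> pts A" "c \<in> pts C"
      for G :: "('k, ('k, 'a, 'c) tens, ('k, 'a, 'c) tens) tens \<Rightarrow> ('k, 'x, 'y) tens" and a c
    proof -
      have "lin H tscl (\<lambda>t. G (app (extA \<gamma> \<otimes>\<^sub>m extA \<gamma>) (app ?E t)))"
        by (rule lin_comp[OF G]) (simp_all add: D)
      from sw_push(1)[OF _ _ _ this, of A "app \<theta> c" C "\<lambda>p q. tAC (a \<star> p) q"] ac
      have "G (app (extA \<gamma> \<otimes>\<^sub>m extA \<gamma>) (app ?E (a \<rhd> app \<theta> c))) = sw A C (app \<theta> c) (\<lambda>p q. G (app (extA \<gamma> \<otimes>\<^sub>m extA \<gamma>) (app ?E (tAC (a \<star> p) q))))"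
        by (simp del: app_sw)
      then show ?thesis using ac by (simp only: DD ten_in extA_ten[OF c(1)])
    qed
    have VII: "app W' (tAC a c) = sw A C (app \<theta> c) (\<lambda>p q.
      sw C C (app \<Delta>C q) (\<lambda>q1 q2. sw A C (app \<gamma> q1) (\<lambda>x1 y1. sw A C (app \<gamma> q2) (\<lambda>x2 y2.
             tscl (app \<epsilon>A x1 * app \<epsilon>C y2) (ten C A y1 ((a \<star> p) \<star> x2))))))" if ac: "a \<in> pts A" "c \<in> pts C" for a c
      unfolding cdel_W[OF W' ac, symmetric]
      by (subst push) (use ac in \<open>simp_all add: cdel0_ten[OF W0] W_of_conjugate_cdel[OF c(2)] del: app_sw tmap_ten\<close>)
    have VIII: "app \<rho>' (tAC a c) = sw A C (app \<theta> c) (\<lambda>p q.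
      sw A A (app \<Delta>A (a \<star> p)) (\<lambda>b1 b2. sw A C (app \<gamma> q) (\<lambda>x y. sw A C (app \<gamma> y) (\<lambda>x' y'.
             tscl (app \<epsilon>C y') (ten A A (b1 \<star> x) (b2 \<star> x'))))))" if ac: "a \<in> pts A" "c \<in> pts C" for a c
      unfolding cdel_\<rho>[OF W' ac, symmetric]
      by (subst push) (use ac in \<open>simp_all add: cdel0_ten[OF W0] \<rho>_of_conjugate_cdel[OF c(2) colg] del: app_sw tmap_ten\<close>)
    show "?i \<and> ?ii \<and> ?iii \<and> ?iii' \<and> ?iv \<and> ?v \<and> ?vi \<and> ?vii \<and> ?viii \<and> ?ix \<and> ?x \<and> ?xi"
      unfolding i ii iv v vi vii viii x xi
      using I II one g1 inv VII VIII eps epsg col colg inverse_multiplicative_vi[OF c(2) g1 gm] by (intro conjI ballI) simp_all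
  next
    assume "?i \<and> ?ii \<and> ?iii \<and> ?iii' \<and> ?iv \<and> ?v \<and> ?vi \<and> ?vii \<and> ?viii \<and> ?ix \<and> ?x \<and> ?xi"
    then have I: "\<forall>c\<in>pts C. \<forall>a\<in>pts A. app R' (ten C A c a) = app (extA \<gamma>) (app \<theta> c \<Zcat> tAC a oneC)"
      and II: "\<forall>c\<in>pts C. \<forall>d\<in>pts C. app \<sigma>' (ten C C c d) = app (extA \<gamma>) (app \<theta> c \<Zcat> app \<theta> d)"
      and one: "app \<theta> oneC = tAC oneA oneC"
      and inv: "\<forall>c\<in>pts C. app (extA \<gamma>) (app \<theta> c) = tAC oneA c" "\<forall>c\<in>pts C. app (extA \<theta>) (app \<gamma> c) = tAC oneA c"
      and VII: ?vii and VIII: ?viii and IX: ?ix and col: "colinear \<theta>" "colinear \<gamma>"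
      unfolding i ii iv v x xi by blast+
    have eps: "\<forall>c\<in>pts C. sw A C (app \<theta> c) (\<lambda>p q. app \<epsilon>A p * app \<epsilon>C q) = app \<epsilon>C c"
      "\<And>c. c \<in> pts C \<Longrightarrow> sw A C (app \<gamma> c) (\<lambda>p q. app \<epsilon>A p * app \<epsilon>C q) = app \<epsilon>C c"
      using IX by (blast, metis IX)
    have inv1: "app (extA \<theta>) (app (extA \<gamma>) x) = x" if "x \<in> pts H" for x
      using inv that by (intro extA_inverse[OF c]) simp_all
    have inv2: "app (extA \<gamma>) (app (extA \<theta>) x) = x" if "x \<in> pts H" for x
      using inv that by (intro extA_inverse[OF c(2,1)]) simp_all
    have mult: "app (extA \<theta>) (x \<Zcat>' y) = app (extA \<theta>) x \<Zcat> app (extA \<theta>) y" if "x \<in> pts H" "y \<in> pts H" for x y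
      by (rule extA_multiplicative[OF c(1) _ _ that]) (use I II in \<open>simp_all add: inv1\<close>)
    have Dpsi: "app ?D (app (extA \<gamma>) t) = app (extA \<gamma> \<otimes>\<^sub>m extA \<gamma>) (app ?E t)" if "t \<in> pts H" for t
    proof (rule tens_lin_ext[of A C tscl "\<lambda>t. app ?D (app (extA \<gamma>) t)" "\<lambda>t. app (extA \<gamma> \<otimes>\<^sub>m extA \<gamma>) (app ?E t)" t])
      fix b d assume bd: "b \<in> pts A" "d \<in> pts C"
      have "app ?D (b \<rhd> app \<gamma> d) = app (extA \<gamma> \<otimes>\<^sub>m extA \<gamma>)
         (sw A A (app \<Delta>A b) (\<lambda>a1 a2. sw C C (app \<Delta>C d) (\<lambda>c1 c2. ten H H (tAC a1 c1) (tAC a2 c2))))"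
        by (rule cdel_at_inverse[OF c _ X col(2) eps(2) _ _ bd])
          (use inv VII[unfolded vii] VIII[unfolded viii] in blast)+
      then show "app ?D (app (extA \<gamma>) (tAC b d)) = app (extA \<gamma> \<otimes>\<^sub>m extA \<gamma>) (app ?E (tAC b d))"
        using bd by (simp only: extA_ten[OF c(2)] cdel0_ten[OF W0])
    qed (use that in \<open>simp_all add: D\<close>)
    have comult: "app (extA \<theta> \<otimes>\<^sub>m extA \<theta>) (app ?D t) = app ?E (app (extA \<theta>) t)" if "t \<in> pts H" for t
    proof -
      have "app ?D t = app (extA \<gamma> \<otimes>\<^sub>m extA \<gamma>) (app ?E (app (extA \<theta>) t))"
        using Dpsi[of "app (extA \<theta>) t"] that by (simp add: inv2)
      moreover have "app (extA \<theta> \<otimes>\<^sub>m extA \<theta>) (app (extA \<gamma> \<otimes>\<^sub>m extA \<gamma>) (app ?E (app (extA \<theta>) t))) = app ?E (app (extA \<theta>) t)"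
        by (rule tmap_inverse[where U=H and V=H and U'=H and V'=H]) (use that in \<open>simp_all add: inv1 D\<close>)
      ultimately show ?thesis by simp
    qed
    show "equiv_data \<theta> \<gamma> W' \<rho>' W0 \<rho>0"
      unfolding equiv_data_def using one inv mult comult eps(1) col(1) by simp
  qed
qed

end

section \<open>The classification of equivalent cross product bialgebras\<close>

theorem theorem3p6:
  fixes A :: "('k::field, 'a::ab_group_add) kspace"
    and C :: "('k, 'c::ab_group_add) kspace"
    and \<mu> :: "('k, ('k, 'a, 'a) tens, 'a) arr" and oneA :: 'a
    and \<Delta>A :: "('k, 'a, ('k, 'a, 'a) tens) arr" and \<epsilon>A :: "('k, 'a, 'k) arr"
    and \<Delta>C :: "('k, 'c, ('k, 'c, 'c) tens) arr" and \<epsilon>C :: "('k, 'c, 'k) arr" and oneC :: 'c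
    and R R' :: "('k, ('k, 'c, 'a) tens, ('k, 'a, 'c) tens) arr"
    and \<sigma> \<sigma>' :: "('k, ('k, 'c, 'c) tens, ('k, 'a, 'c) tens) arr"
    and W0 W' :: "('k, ('k, 'a, 'c) tens, ('k, 'c, 'a) tens) arr"
    and \<rho>0 \<rho>' :: "('k, ('k, 'a, 'c) tens, ('k, 'a, 'a) tens) arr"
  assumes "bialgebra \<lparr>aspc = A, amul = \<mu>, aone = oneA\<rparr> \<lparr>cspc = A, cdel = \<Delta>A, ceps = \<epsilon>A\<rparr>"
    and "coalgebra \<lparr>cspc = C, cdel = \<Delta>C, ceps = \<epsilon>C\<rparr>" and "oneC \<in> pts C"
    and "crossed_product \<lparr>aspc = A, amul = \<mu>, aone = oneA\<rparr> C oneC R \<sigma>"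
    and "W0 \<in> Hom (A \<otimes>\<^sub>s C) (C \<otimes>\<^sub>s A)"
    and "\<forall>a\<in>pts A. \<forall>c\<in>pts C. app W0 (ten A C a c) = ten C A c a"
    and "\<rho>0 \<in> Hom (A \<otimes>\<^sub>s C) (A \<otimes>\<^sub>s A)"
    and "\<forall>a\<in>pts A. \<forall>c\<in>pts C. app \<rho>0 (ten A C a c)
           = sw A A (app \<Delta>A a) (\<lambda>a1 a2. ten A A a1 (scl A (app \<epsilon>C c) a2))"
    and "cross_product_bialgebra \<lparr>aspc = A, amul = \<mu>, aone = oneA\<rparr> \<epsilon>A
           \<lparr>cspc = C, cdel = \<Delta>C, ceps = \<epsilon>C\<rparr> oneC W0 \<rho>0 R \<sigma>"
    and "cross_product_bialgebra \<lparr>aspc = A, amul = \<mu>, aone = oneA\<rparr> \<epsilon>A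
           \<lparr>cspc = C, cdel = \<Delta>C, ceps = \<epsilon>C\<rparr> oneC W' \<rho>' R' \<sigma>'"
  shows "equivalent_cpb \<lparr>aspc = A, amul = \<mu>, aone = oneA\<rparr> \<epsilon>A
           \<lparr>cspc = C, cdel = \<Delta>C, ceps = \<epsilon>C\<rparr> oneC W0 \<rho>0 R \<sigma> W' \<rho>' R' \<sigma>'
    \<longleftrightarrow> (\<exists>\<theta> \<in> Hom C (A \<otimes>\<^sub>s C). \<exists>\<gamma> \<in> Hom C (A \<otimes>\<^sub>s C).
      (let \<mu>2 = \<mu> \<odot> (idl A \<otimes>\<^sub>m \<mu>); mul = (\<lambda>a b. app \<mu> (ten A A a b)) in
      \<comment> \<open>(i)\<close>
      R' = (\<mu>2 \<otimes>\<^sub>m idl C) \<odot> asi A (A \<otimes>\<^sub>s A) C \<odot> (idl A \<otimes>\<^sub>m asi A A C)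
             \<odot> (idl A \<otimes>\<^sub>m idl A \<otimes>\<^sub>m \<gamma>) \<odot> (idl A \<otimes>\<^sub>m R) \<odot> asc A C A \<odot> (\<theta> \<otimes>\<^sub>m idl A) \<and>
      \<comment> \<open>(ii)\<close>
      \<sigma>' = (\<mu> \<otimes>\<^sub>m idl C) \<odot> asi A A C \<odot> (idl A \<otimes>\<^sub>m \<gamma>)
             \<odot> (\<mu>2 \<otimes>\<^sub>m idl C) \<odot> asi A (A \<otimes>\<^sub>s A) C \<odot> (idl A \<otimes>\<^sub>m asi A A C)
             \<odot> (idl A \<otimes>\<^sub>m idl A \<otimes>\<^sub>m \<sigma>) \<odot> (idl A \<otimes>\<^sub>m asc A C C)
             \<odot> (idl A \<otimes>\<^sub>m R \<otimes>\<^sub>m idl C) \<odot> (idl A \<otimes>\<^sub>m asi C A C) \<odot> asc A C (A \<otimes>\<^sub>s C)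
             \<odot> (\<theta> \<otimes>\<^sub>m \<theta>) \<and>
      \<comment> \<open>(iii)\<close>
      app \<theta> oneC = ten A C oneA oneC \<and> app \<gamma> oneC = ten A C oneA oneC \<and>
      \<comment> \<open>(iv)\<close>
      (\<forall>c\<in>pts C. sw A C (app \<theta> c) (\<lambda>p q. sw A C (app \<gamma> q) (\<lambda>x y. ten A C (mul p x) y))
         = ten A C oneA c) \<and>
      \<comment> \<open>(v)\<close>
      (\<forall>c\<in>pts C. sw A C (app \<gamma> c) (\<lambda>x y. sw A C (app \<theta> y) (\<lambda>p q. ten A C (mul x p) q))
         = ten A C oneA c) \<and>
      \<comment> \<open>(vi)\<close>
      (\<mu> \<otimes>\<^sub>m idl C) \<odot> asi A A C \<odot> (\<mu> \<otimes>\<^sub>m \<sigma>') \<odot> asi A A (C \<otimes>\<^sub>s C) \<odot> (idl A \<otimes>\<^sub>m asc A C C)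
          \<odot> (idl A \<otimes>\<^sub>m \<gamma> \<otimes>\<^sub>m idl C) \<odot> asc A C C \<odot> (R \<otimes>\<^sub>m idl C) \<odot> asi C A C \<odot> (idl C \<otimes>\<^sub>m \<gamma>)
        = (\<mu> \<otimes>\<^sub>m idl C) \<odot> asi A A C \<odot> (idl A \<otimes>\<^sub>m \<gamma>) \<odot> \<sigma> \<and>
      \<comment> \<open>(vii)\<close>
      (\<forall>a\<in>pts A. \<forall>c\<in>pts C. app W' (ten A C a c) =
         sw A C (app \<theta> c) (\<lambda>p q. sw C C (app \<Delta>C q) (\<lambda>q1 q2.
           sw A C (app \<gamma> q1) (\<lambda>x1 y1. sw A C (app \<gamma> q2) (\<lambda>x2 y2.
             scl (C \<otimes>\<^sub>s A) (app \<epsilon>A x1 * app \<epsilon>C y2) (ten C A y1 (mul (mul a p) x2))))))) \<and>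
      \<comment> \<open>(viii)\<close>
      (\<forall>a\<in>pts A. \<forall>c\<in>pts C. app \<rho>' (ten A C a c) =
         sw A A (app \<Delta>A a) (\<lambda>a1 a2. sw A C (app \<theta> c) (\<lambda>p q. sw A A (app \<Delta>A p) (\<lambda>p1 p2.
           sw A C (app \<gamma> q) (\<lambda>x y. sw A C (app \<gamma> y) (\<lambda>x' y'.
             scl (A \<otimes>\<^sub>s A) (app \<epsilon>C y')
               (ten A A (mul (mul a1 p1) x) (mul (mul a2 p2) x')))))))) \<and>
      \<comment> \<open>(ix)\<close>
      (\<forall>c\<in>pts C. sw A C (app \<theta> c) (\<lambda>p q. app \<epsilon>A p * app \<epsilon>C q) = app \<epsilon>C c \<and>
         app \<epsilon>C c = sw A C (app \<gamma> c) (\<lambda>x y. app \<epsilon>A x * app \<epsilon>C y)) \<and>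
      \<comment> \<open>(x)\<close>
      (\<forall>c\<in>pts C. sw A C (app \<theta> c) (\<lambda>p q. sw C C (app \<Delta>C q) (\<lambda>q1 q2.
           ten A (C \<otimes>\<^sub>s C) p (ten C C q1 q2)))
         = sw C C (app \<Delta>C c) (\<lambda>c1 c2. sw A C (app \<theta> c1) (\<lambda>p q. ten A (C \<otimes>\<^sub>s C) p (ten C C q c2)))) \<and>
      \<comment> \<open>(xi)\<close>
      (\<forall>c\<in>pts C. sw A C (app \<gamma> c) (\<lambda>x y. sw C C (app \<Delta>C y) (\<lambda>y1 y2.
           ten A (C \<otimes>\<^sub>s C) x (ten C C y1 y2)))
         = sw C C (app \<Delta>C c) (\<lambda>c1 c2. sw A C (app \<gamma> c1) (\<lambda>x y. ten A (C \<otimes>\<^sub>s C) x (ten C C y c2))))))"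
proof -
  let ?M = "\<lparr>aspc = A, amul = \<mu>, aone = oneA\<rparr>" and ?D = "\<lparr>cspc = C, cdel = \<Delta>C, ceps = \<epsilon>C\<rparr>"
  have B: "crossed_coproduct A \<epsilon>A ?D W0 \<rho>0" "algebra (crossed_product_alg ?M C oneC R \<sigma>)"
    and B': "crossed_product ?M C oneC R' \<sigma>'" "crossed_coproduct A \<epsilon>A ?D W' \<rho>'" "algebra (crossed_product_alg ?M C oneC R' \<sigma>')"
    using assms(9,10) by (simp_all add: cross_product_bialgebra_def bialgebra_def)
  interpret two_crossed A C \<mu> oneA \<Delta>A \<epsilon>A \<Delta>C \<epsilon>C oneC R \<sigma> R' \<sigma>'
    using assms(1-4) B B' by unfold_locales
  note co = crossed_coproduct_counits(1)[OF B(1)]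
  have arr_to_H: "arr_to_H g \<longleftrightarrow> g \<in> Hom C (A \<otimes>\<^sub>s C)" for g by (auto simp: arr_to_H_def arr_Hom)
  note iff = equivalent_iff[OF co crossed_coproduct_counits(1)[OF B'(2)]]
  have "(\<exists>\<theta> \<gamma>. equiv_data \<theta> \<gamma> W' \<rho>' W0 \<rho>0) \<longleftrightarrow> (\<exists>\<theta>\<in>Hom C (A \<otimes>\<^sub>s C). \<exists>\<gamma>\<in>Hom C (A \<otimes>\<^sub>s C). equiv_data \<theta> \<gamma> W' \<rho>' W0 \<rho>0)"
    unfolding equiv_data_def arr_to_H by blast
  then show ?thesis unfolding iff Let_def
    by (simp only:) (intro bex_cong refl equiv_data_iff_conditions[OF _ _ co assms(6,8) B'(2)]; simp only: arr_to_H)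
qed

end
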